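(* Let $p$ be a prime and let $R$ be a NIP $\mathbb{F}_p$-algebra. Then $R$ is (isomorphic to) a finite product of Henselian local rings.
   Context: All rings are commutative and unital. A ring is NIP if its complete theory in the language of rings is NIP. *)

theory Defs
  imports
    "HOL-Computational_Algebra.Primes"
    "HOL-Algebra.IntRing"
    "HOL-Algebra.Module"
    "HOL-Algebra.Polynomials"
    "HOL-Algebra.Chinese_Remainder"
begin

section \<open>First-order logic in the language of rings\<close>

datatype rterm =
    TVar nat
  | TZero
  | TOne
  | TAdd rterm rterm
  | TNeg rterm
  | TMult rterm rterm

datatype rform =
    FEq rterm rterm
  | FNot rform
  | FAnd rform rform
  | FEx nat rform

fun tvars :: "rterm \<Rightarrow> nat set" where
  "tvars (TVar v) = {v}"
| "tvars TZero = {}"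
| "tvars TOne = {}"
| "tvars (TAdd s t) = tvars s \<union> tvars t"
| "tvars (TNeg t) = tvars t"
| "tvars (TMult s t) = tvars s \<union> tvars t"

fun free_vars :: "rform \<Rightarrow> nat set" where
  "free_vars (FEq s t) = tvars s \<union> tvars t"
| "free_vars (FNot \<phi>) = free_vars \<phi>"
| "free_vars (FAnd \<phi> \<psi>) = free_vars \<phi> \<union> free_vars \<psi>"
| "free_vars (FEx v \<phi>) = free_vars \<phi> - {v}"

fun tval :: "('a, 'm) ring_scheme \<Rightarrow> (nat \<Rightarrow> 'a) \<Rightarrow> rterm \<Rightarrow> 'a" where
  "tval M e (TVar v) = e v"
| "tval M e TZero = \<zero>\<^bsub>M\<^esub>"
| "tval M e TOne = \<one>\<^bsub>M\<^esub>"
| "tval M e (TAdd s t) = tval M e s \<oplus>\<^bsub>M\<^esub> tval M e t"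
| "tval M e (TNeg t) = \<ominus>\<^bsub>M\<^esub> tval M e t"
| "tval M e (TMult s t) = tval M e s \<otimes>\<^bsub>M\<^esub> tval M e t"

fun sat :: "('a, 'm) ring_scheme \<Rightarrow> (nat \<Rightarrow> 'a) \<Rightarrow> rform \<Rightarrow> bool" where
  "sat M e (FEq s t) \<longleftrightarrow> tval M e s = tval M e t"
| "sat M e (FNot \<phi>) \<longleftrightarrow> \<not> sat M e \<phi>"
| "sat M e (FAnd \<phi> \<psi>) \<longleftrightarrow> sat M e \<phi> \<and> sat M e \<psi>"
| "sat M e (FEx v \<phi>) \<longleftrightarrow> (\<exists>a \<in> carrier M. sat M (e(v := a)) \<phi>)"

definition complete_theory :: "('a, 'm) ring_scheme \<Rightarrow> rform set" where
  "complete_theory M =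
     {\<sigma>. free_vars \<sigma> = {} \<and> (\<forall>e. range e \<subseteq> carrier M \<longrightarrow> sat M e \<sigma>)}"

text \<open>
  Only theories extending that of commutative rings are considered, so that models
  are commutative rings and the symbol for negation is interpreted by additive inverse.
\<close>

definition is_model :: "('a, 'm) ring_scheme \<Rightarrow> rform set \<Rightarrow> bool" where
  "is_model M T \<longleftrightarrow> cring M \<and>
     (\<forall>\<sigma> \<in> T. \<forall>e. range e \<subseteq> carrier M \<longrightarrow> sat M e \<sigma>)"


section \<open>NIP\<close>

text \<open>
  A partitioned formula \<open>\<phi>(x; y)\<close> is a formula \<open>\<phi>\<close> with a set \<open>V\<close> of variables: the tuple
  \<open>x\<close> consists of the free variables of \<open>\<phi>\<close> in \<open>V\<close>, and \<open>y\<close> of the remaining ones.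
  The tuples \<open>a i\<close> and \<open>b S\<close> are given as assignments, of which only the values at the
  variables of \<open>x\<close> and of \<open>y\<close>, respectively, are used. The \<open>a i\<close> are
  automatically distinct as \<open>x\<close>-tuples.
\<close>

definition shatters :: "('a, 'm) ring_scheme \<Rightarrow> rform \<Rightarrow> nat set \<Rightarrow> nat \<Rightarrow> bool" where
  "shatters M \<phi> V n \<longleftrightarrow>
     (\<exists>(a :: nat \<Rightarrow> nat \<Rightarrow> 'a) (b :: nat set \<Rightarrow> nat \<Rightarrow> 'a).
        (\<forall>i. range (a i) \<subseteq> carrier M) \<and> (\<forall>S. range (b S) \<subseteq> carrier M) \<and>
        (\<forall>i < n. \<forall>S \<subseteq> {..<n}. sat M (override_on (b S) (a i) V) \<phi> \<longleftrightarrow> i \<in> S))"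

text \<open>
  A theory is NIP if no partitioned formula has the independence property, i.e. for each
  of them there is an \<open>n\<close> such that no set of \<open>n\<close> tuples is shattered in any model.
  HOL cannot quantify over all types, so the type of the models is a parameter.
  For the complete theory of a ring it is taken to be the type of that ring. This loses
  nothing: shattering a set of \<open>n\<close> tuples is expressed by a sentence, which has
  the same truth value in all models of a complete theory.
\<close>

definition NIP_theory :: "('a, 'm) ring_scheme itself \<Rightarrow> rform set \<Rightarrow> bool" where
  "NIP_theory _ T \<longleftrightarrow>
     (\<forall>\<phi> V. \<exists>n. \<forall>M :: ('a, 'm) ring_scheme. is_model M T \<longrightarrow> \<not> shatters M \<phi> V n)"

definition NIP_ring :: "('a, 'm) ring_scheme \<Rightarrow> bool" where
  "NIP_ring R \<longleftrightarrow> cring R \<and> NIP_theory TYPE(('a, 'm) ring_scheme) (complete_theory R)"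


section \<open>Henselian local rings\<close>

definition local_cring :: "('a, 'm) ring_scheme \<Rightarrow> bool" where
  "local_cring R \<longleftrightarrow> cring R \<and> (\<exists>!\<mm>. maximalideal \<mm> R)"

text \<open>Polynomials are lists of coefficients, with the leading coefficient first.\<close>

definition formal_deriv :: "('a, 'm) ring_scheme \<Rightarrow> 'a list \<Rightarrow> 'a list" where
  "formal_deriv R f =
     ring.normalize R (map (\<lambda>i. [i] \<cdot>\<^bsub>R\<^esub> ring.coeff R f i) (rev [1..<length f]))"

text \<open>
  Hensel's lemma: a simple root in the residue field (represented by \<open>a\<close>) of a monic
  polynomial lifts to a root in the ring.
\<close>

definition henselian_local_ring :: "('a, 'm) ring_scheme \<Rightarrow> bool" where
  "henselian_local_ring R \<longleftrightarrow> local_cring R \<and>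
     (\<forall>\<mm>. maximalideal \<mm> R \<longrightarrow>
        (\<forall>f \<in> carrier ((carrier R)[X]\<^bsub>R\<^esub>). \<forall>a \<in> carrier R.
           f \<noteq> [] \<and> lead_coeff f = \<one>\<^bsub>R\<^esub> \<and>
           ring.eval R f a \<in> \<mm> \<and> ring.eval R (formal_deriv R f) a \<notin> \<mm> \<longrightarrow>
           (\<exists>b \<in> carrier R. ring.eval R f b = \<zero>\<^bsub>R\<^esub> \<and> b \<ominus>\<^bsub>R\<^esub> a \<in> \<mm>)))"

end

theory Submission
  imports Defs "HOL-Library.Nat_Bijection"
begin

text \<open>
  NIP is used through two families of sets: the multiples of an element, and the sets
  \<open>{x. \<exists>w. x = d\<^sup>p ((g w)\<^sup>p - g w)}\<close>, which involve the Artin-Schreier polynomial. The first gives finitely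
  many maximal ideals. The second shows that no prime ideal lies below two maximal ideals: otherwise
  an element \<open>c\<close> of one and \<open>1 - c\<close> of the other, together with an additive polynomial vanishing on
  powers of \<open>c\<close>, produce a shattered family of every size. A localization argument then isolates each
  maximal ideal by an idempotent, so the ring is a finite product of local rings \<open>A = e R\<close>.
  For a monic \<open>f\<close> over \<open>A\<close>, the finite free algebra \<open>A[X]/(f)\<close> is interpretable in \<open>R\<close>, so its maximal
  ideals are also isolated by idempotents. The one belonging to a simple root \<open>a\<close> of \<open>f\<close> modulo the
  maximal ideal cuts out a factor which equals \<open>A\<close> by Nakayama's lemma, and the image of \<open>X\<close> in it is
  a root of \<open>f\<close> that lifts \<open>a\<close>.
\<close>

section \<open>Ideals and prime ideals\<close>

text \<open>Artin-Schreier polynomials enter because in a domain of characteristic \<open>p\<close>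
  the roots of \<open>r^p - r\<close> are constants from the prime field: modulo a prime below two
  maximal ideals such an \<open>r\<close> cannot be -1 at one and 0 at the other. To shatter a set,
  a single parameter has to decide for every \<open>i\<close> at once whether such a difference
  occurs. The additive polynomial achieves this: up to scaling by \<open>d i\<close>, it is the
  Artin-Schreier polynomial applied after the additive polynomial that omits the root
  \<open>c^i\<close>.

  The obstacle is that quotients and localizations of \<open>R\<close> at a prime need not be
  definable, and that no idempotent separating the two maximal ideals is available yet. So the
  computation stays in \<open>R\<close>, with an element \<open>e\<close> that is idempotent only up
  to a multiple of every scaling factor that occurs.

  Of NIP only two statements on shattered families are retained (\<open>tame_cring\<close>). They
  pass to rings of characteristic \<open>p\<close> coded by tuples over \<open>R\<close>, so the
  existence of idempotents, proved once, serves both for \<open>R\<close> and for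
  \<open>A[X]/(f)\<close>.\<close>

lemma (in cring) exists_maximal_ideal_avoiding:
  assumes "ideal I R" "I \<inter> M = {}"
  obtains J where "ideal J R" "I \<subseteq> J" "J \<inter> M = {}"
    "\<And>K. ideal K R \<Longrightarrow> J \<subseteq> K \<Longrightarrow> K \<inter> M = {} \<Longrightarrow> K = J"
proof -
  \<comment> \<open>\<open>M\<close> stays arbitrary: \<open>{1}\<close> gives maximal ideals, a
    multiplicatively closed set gives prime ideals.\<close>
  define S where "S = {J. ideal J R \<and> I \<subseteq> J \<and> J \<inter> M = {}}"
  have "\<exists>J \<in> S. \<forall>K \<in> S. J \<subseteq> K \<longrightarrow> K = J"
  proof (rule subset_Zorn)
    fix C assume C: "subset.chain S C"
    show "\<exists>U \<in> S. \<forall>K \<in> C. K \<subseteq> U"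
    proof (cases "C = {}")
      case True
      then show ?thesis using assms by (auto simp: S_def)
    next
      case False
      have "subset.chain {I. ideal I R} C"
        using C unfolding pred_on.chain_def S_def by auto
      from chain_Union_is_ideal[OF this] False have "ideal (\<Union>C) R" by simp
      moreover have "I \<subseteq> \<Union>C" "\<Union>C \<inter> M = {}"
        using C False unfolding pred_on.chain_def S_def by blast+
      ultimately show ?thesis unfolding S_def by blast
    qed
  qed
  then obtain J where J: "J \<in> S" "\<And>K. K \<in> S \<Longrightarrow> J \<subseteq> K \<Longrightarrow> K = J" by blast
  show thesis
  proof (rule that[of J])
    fix K assume K: "ideal K R" "J \<subseteq> K" "K \<inter> M = {}"
    then have "K \<in> S" using J(1) by (auto simp: S_def)
    with J(2) K(2) show "K = J" by blast
  qed (use J(1) in \<open>auto simp: S_def\<close>)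
qed

lemma (in cring) exists_maximalideal_containing:
  assumes "ideal I R" "\<one> \<notin> I"
  obtains J where "maximalideal J R" "I \<subseteq> J"
proof -
  obtain J where J: "ideal J R" "I \<subseteq> J" "J \<inter> {\<one>} = {}"
    "\<And>K. ideal K R \<Longrightarrow> J \<subseteq> K \<Longrightarrow> K \<inter> {\<one>} = {} \<Longrightarrow> K = J"
    using exists_maximal_ideal_avoiding[OF assms(1), of "{\<one>}"] assms(2) by auto
  have "maximalideal J R"
  proof (rule maximalidealI[OF J(1)])
    show "carrier R \<noteq> J" using J(3) by auto
  next
    fix K assume K: "ideal K R" "J \<subseteq> K" "K \<subseteq> carrier R"
    show "K = J \<or> K = carrier R"
      using J(4)[OF K(1,2)] ideal.one_imp_carrier[OF K(1)] by auto
  qed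
  with J(2) show thesis by (rule that[rotated])
qed

lemma (in cring) add_cgenideal:
  assumes "ideal I R" "a \<in> carrier R"
  shows "ideal {i \<oplus> a \<otimes> x | i x. i \<in> I \<and> x \<in> carrier R} R"
proof -
  have "{i \<oplus> a \<otimes> x | i x. i \<in> I \<and> x \<in> carrier R} = I <+>\<^bsub>R\<^esub> PIdl a"
    unfolding set_add_def' cgenideal_def using assms(2) m_comm by (auto, metis+)
  then show ?thesis using add_ideals[OF assms(1) cgenideal_ideal[OF assms(2)]] by simp
qed

lemma (in cring) subset_add_cgenideal:
  assumes "ideal I R" "a \<in> carrier R"
  shows "I \<subseteq> {i \<oplus> a \<otimes> x | i x. i \<in> I \<and> x \<in> carrier R}"
    "a \<in> {i \<oplus> a \<otimes> x | i x. i \<in> I \<and> x \<in> carrier R}"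
proof -
  interpret I: ideal I R by fact
  show "I \<subseteq> {i \<oplus> a \<otimes> x | i x. i \<in> I \<and> x \<in> carrier R}"
  proof
    fix i assume i: "i \<in> I"
    then have "i = i \<oplus> a \<otimes> \<zero>" using assms(2) I.a_Hcarr by simp
    with i show "i \<in> {i \<oplus> a \<otimes> x | i x. i \<in> I \<and> x \<in> carrier R}" by blast
  qed
  have "a = \<zero> \<oplus> a \<otimes> \<one>" using assms(2) by simp
  then show "a \<in> {i \<oplus> a \<otimes> x | i x. i \<in> I \<and> x \<in> carrier R}"
    using I.zero_closed by blast
qed

text \<open>If \<open>a\<close> and \<open>b\<close> lie outside an ideal \<open>P\<close> maximal
  among those missing \<open>M\<close>, then \<open>P + aR\<close> and \<open>P + bR\<close> both
  meet \<open>M\<close>. The product of the two meeting elements lies in \<open>M\<close>, and it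
  would lie in \<open>P\<close> if \<open>a b\<close> did.\<close>

lemma (in cring) exists_primeideal_avoiding:
  assumes "\<zero> \<notin> M" "\<one> \<in> M" "M \<subseteq> carrier R" "\<And>x y. x \<in> M \<Longrightarrow> y \<in> M \<Longrightarrow> x \<otimes> y \<in> M"
  obtains P where "primeideal P R" "P \<inter> M = {}"
proof -
  obtain P where P: "ideal P R" "P \<inter> M = {}"
    "\<And>K. ideal K R \<Longrightarrow> P \<subseteq> K \<Longrightarrow> K \<inter> M = {} \<Longrightarrow> K = P"
    by (rule exists_maximal_ideal_avoiding[OF zeroideal, of M]) (use assms(1) in auto)
  interpret P: ideal P R by fact
  have meets: "\<exists>i x. i \<in> P \<and> x \<in> carrier R \<and> i \<oplus> a \<otimes> x \<in> M"
    if a: "a \<in> carrier R" "a \<notin> P" for a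
  proof (rule ccontr)
    assume "\<not> ?thesis"
    then have "{i \<oplus> a \<otimes> x | i x. i \<in> P \<and> x \<in> carrier R} \<inter> M = {}" by blast
    from P(3)[OF add_cgenideal[OF P(1) a(1)] subset_add_cgenideal(1)[OF P(1) a(1)] this]
    show False using subset_add_cgenideal(2)[OF P(1) a(1)] a(2) by simp
  qed
  have "primeideal P R"
  proof (rule primeidealI[OF P(1) is_cring])
    show "carrier R \<noteq> P" using P(2) assms(2,3) by auto
  next
    fix a b assume ab: "a \<in> carrier R" "b \<in> carrier R" "a \<otimes> b \<in> P"
    show "a \<in> P \<or> b \<in> P"
    proof (rule ccontr)
      assume "\<not> (a \<in> P \<or> b \<in> P)"
      then obtain i x j y where h: "i \<in> P" "x \<in> carrier R" "i \<oplus> a \<otimes> x \<in> M"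
        "j \<in> P" "y \<in> carrier R" "j \<oplus> b \<otimes> y \<in> M"
        using meets ab(1,2) by metis
      have c: "i \<in> carrier R" "j \<in> carrier R" using h P.a_Hcarr by auto
      have "(i \<oplus> a \<otimes> x) \<otimes> (j \<oplus> b \<otimes> y) = i \<otimes> (j \<oplus> b \<otimes> y) \<oplus> (j \<otimes> (a \<otimes> x) \<oplus> (a \<otimes> b) \<otimes> (x \<otimes> y))"
        using c h(2,5) ab(1,2) by algebra
      also have "\<dots> \<in> P"
        using h ab c by (auto intro!: P.a_closed P.I_r_closed)
      finally show False using assms(4)[OF h(3,6)] P(2) by blast
    qed
  qed
  with P(2) show thesis by (rule that[rotated])
qed

lemma (in cring) unit_if_no_maximalideal:
  assumes "a \<in> carrier R" "\<And>m. maximalideal m R \<Longrightarrow> a \<notin> m"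
  shows "\<exists>b \<in> carrier R. a \<otimes> b = \<one>"
proof (rule ccontr)
  assume none: "\<not> ?thesis"
  have "\<one> \<notin> PIdl a"     using none assms(1) m_comm[OF assms(1)] unfolding cgenideal_def by force
  from exists_maximalideal_containing[OF cgenideal_ideal[OF assms(1)] this]
  obtain J where "maximalideal J R" "PIdl a \<subseteq> J" by blast
  with assms(2) cgenideal_self[OF assms(1)] show False by blast
qed

lemma (in maximalideal) one_notin: "\<one> \<notin> I"
  using I_notcarr one_imp_carrier by auto

lemma (in maximalideal) prime:
  assumes "cring R" "a \<in> carrier R" "b \<in> carrier R" "a \<otimes> b \<in> I"
  shows "a \<in> I \<or> b \<in> I"
  using cring.maximalideal_prime[OF assms(1) is_maximalideal] assms(2-) primeideal.I_prime by metis

text \<open>For any \<open>a\<close> in \<open>n\<close> outside \<open>m\<close>, the ideal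
  \<open>m + aR\<close> is the whole ring. The resulting \<open>c\<close> has the value 0 at
  \<open>m\<close> and 1 at \<open>n\<close>.\<close>

lemma (in cring) maximalideals_comaximal:
  assumes "maximalideal m R" "maximalideal n R" "m \<noteq> n"
  obtains c where "c \<in> m" "\<one> \<ominus> c \<in> n"
proof -
  interpret m: maximalideal m R by fact
  interpret n: maximalideal n R by fact
  obtain a where a: "a \<in> n" "a \<notin> m"
    using m.I_maximal n.I_maximal assms m.I_notcarr n.I_notcarr m.a_subset n.a_subset
      m.is_ideal n.is_ideal by (metis subsetI)
  have ac: "a \<in> carrier R" using a n.a_Hcarr by blast
  let ?J = "{i \<oplus> a \<otimes> x | i x. i \<in> m \<and> x \<in> carrier R}"
  have "?J = carrier R"
    using m.I_maximal[OF add_cgenideal[OF m.is_ideal ac] subset_add_cgenideal(1)[OF m.is_ideal ac]]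
      subset_add_cgenideal(2)[OF m.is_ideal ac] a(2)
      additive_subgroup.a_subset[OF ideal.axioms(1)[OF add_cgenideal[OF m.is_ideal ac]]] by blast
  then obtain i x where ix: "\<one> = i \<oplus> a \<otimes> x" "i \<in> m" "x \<in> carrier R" using one_closed by blast
  have ic: "i \<in> carrier R" using ix m.a_Hcarr by blast
  have "\<one> \<ominus> i = a \<otimes> x" unfolding ix(1) using ic ac ix(3) by algebra
  also have "\<dots> \<in> n" using a(1) ix(3) n.I_r_closed by blast
  finally show thesis using ix(2) that by blast
qed

section \<open>The Frobenius endomorphism and additive polynomials\<close>

lemma (in cring) binomial:
  fixes n :: nat
  assumes x: "x \<in> carrier R" and y: "y \<in> carrier R"
  shows "(x \<oplus> y) [^] n = (\<Oplus>k\<in>{..n}. [(n choose k)] \<cdot> (x [^] k \<otimes> y [^] (n - k)))"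
proof (induction n)
  case 0
  then show ?case by simp
next
  case (Suc n)
  \<comment> \<open>\<open>F\<close> and \<open>G\<close> are the two contributions to Pascal's
    rule, from the factor \<open>y\<close> and from the factor \<open>x\<close>.\<close>
  define F where "F k = [(n choose k)] \<cdot> (x [^] k \<otimes> y [^] (Suc n - k))" for k
  define G where "G k = [(n choose k)] \<cdot> (x [^] Suc k \<otimes> y [^] (n - k))" for k
  have [simp]: "F k \<in> carrier R" "G k \<in> carrier R" for k using x y by (simp_all add: F_def G_def)
  let ?B = "\<lambda>k. [(n choose k)] \<cdot> (x [^] k \<otimes> y [^] (n - k))"
  have B: "?B \<in> {..n} \<rightarrow> carrier R" using x y by simp
  have "(x \<oplus> y) [^] Suc n = (\<Oplus>k\<in>{..n}. ?B k) \<otimes> (x \<oplus> y)" using Suc x y by simp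
  also have "\<dots> = (\<Oplus>k\<in>{..n}. ?B k \<otimes> (x \<oplus> y))" using finsum_ldistr[OF _ _ B] x y by simp
  also have "\<dots> = (\<Oplus>k\<in>{..n}. G k \<oplus> F k)"
  proof (rule finsum_cong')
    fix k assume "k \<in> {..n}"
    then have s: "Suc n - k = Suc (n - k)" by auto
    have "?B k \<otimes> (x \<oplus> y) = [(n choose k)] \<cdot> ((x [^] k \<otimes> y [^] (n - k)) \<otimes> (x \<oplus> y))"
      using x y by (simp add: add_pow_ldistr)
    also have "(x [^] k \<otimes> y [^] (n - k)) \<otimes> (x \<oplus> y) = (x [^] k \<otimes> x) \<otimes> y [^] (n - k) \<oplus> x [^] k \<otimes> (y [^] (n - k) \<otimes> y)"
      using x y by (simp add: r_distr m_assoc m_comm[of _ x] m_lcomm[of _ x])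
    finally show "?B k \<otimes> (x \<oplus> y) = G k \<oplus> F k"
      using x y by (simp add: F_def G_def s add.nat_pow_distrib)
  qed simp_all
  also have "\<dots> = (\<Oplus>k\<in>{..n}. G k) \<oplus> (\<Oplus>k\<in>{..Suc n}. F k)"
  proof -
    \<comment> \<open>The extra term vanishes, so the sum of \<open>F\<close> extends to a range
      whose shift by one matches the range of \<open>G\<close>.\<close>
    have "F (Suc n) = \<zero>" using x y by (simp add: F_def binomial_eq_0 del: nat_pow_Suc)
    then show ?thesis using finsum_addf[of G "{..n}" F] by simp
  qed
  also have "(\<Oplus>k\<in>{..Suc n}. F k) = (\<Oplus>k\<in>{..n}. F (Suc k)) \<oplus> F 0"
    by (rule finsum_Suc2) simp
  also have "(\<Oplus>k\<in>{..n}. G k) \<oplus> ((\<Oplus>k\<in>{..n}. F (Suc k)) \<oplus> F 0) = (\<Oplus>k\<in>{..n}. G k \<oplus> F (Suc k)) \<oplus> F 0"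
    using finsum_addf[of G "{..n}" "\<lambda>k. F (Suc k)"] by (simp add: a_assoc)
  also have "(\<Oplus>k\<in>{..n}. G k \<oplus> F (Suc k)) = (\<Oplus>k\<in>{..n}. [(Suc n choose Suc k)] \<cdot> (x [^] Suc k \<otimes> y [^] (Suc n - Suc k)))"
    using x y by (intro finsum_cong') (simp_all add: F_def G_def add.nat_pow_mult)
  also have "F 0 = [(Suc n choose 0)] \<cdot> (x [^] (0::nat) \<otimes> y [^] (Suc n - 0))" by (simp add: F_def)
  also have "(\<Oplus>k\<in>{..n}. [(Suc n choose Suc k)] \<cdot> (x [^] Suc k \<otimes> y [^] (Suc n - Suc k))) \<oplus> \<dots>
     = (\<Oplus>k\<in>{..Suc n}. [(Suc n choose k)] \<cdot> (x [^] k \<otimes> y [^] (Suc n - k)))"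
    by (rule finsum_Suc2[symmetric]) (use x y in simp)
  finally show ?case .
qed

locale char_cring = cring R for R (structure) +
  fixes p :: nat
  assumes prime_p: "Factorial_Ring.prime p" and char_p: "[p] \<cdot> \<one> = \<zero>"
begin

lemma p_pos: "p > 0" "p \<ge> 2" "p - Suc 0 > 0"
  using prime_gt_0_nat[OF prime_p] prime_ge_2_nat[OF prime_p] by auto

lemma char_dvd: "p dvd k \<Longrightarrow> x \<in> carrier R \<Longrightarrow> [k] \<cdot> x = \<zero>"
proof -
  assume "p dvd k" and x: "x \<in> carrier R"
  then obtain j where k: "k = p * j" by blast
  have "[k] \<cdot> x = ([k] \<cdot> \<one>) \<otimes> x" using x by (simp add: add_pow_ldistr)
  also have "[k] \<cdot> \<one> = [j] \<cdot> ([p] \<cdot> \<one>)" using add.nat_pow_pow[of \<one> j p] by (simp add: k mult.commute)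
  also have "\<dots> = \<zero>" by (simp add: char_p)
  finally show ?thesis using x by simp
qed

lemma frobenius_add:
  assumes x: "x \<in> carrier R" and y: "y \<in> carrier R"
  shows "(x \<oplus> y) [^] p = x [^] p \<oplus> y [^] p"
proof -
  \<comment> \<open>Two successors are split off so that both end terms can be peeled away; the
    \<open>q + 1\<close> remaining terms have a binomial coefficient divisible by
    \<open>p\<close>.\<close>
  obtain q where q: "p = Suc (Suc q)" using p_pos(2) by (metis add_2_eq_Suc le_iff_add)
  define B where "B k = [(p choose k)] \<cdot> (x [^] k \<otimes> y [^] (p - k))" for k
  have c: "B k \<in> carrier R" for k using x y by (simp add: B_def)
  have "(x \<oplus> y) [^] p = (\<Oplus>k\<in>{..Suc (Suc q)}. B k)"
    using binomial[OF x y, of p] by (simp add: B_def[symmetric] flip: q)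
  also have "\<dots> = B p \<oplus> (\<Oplus>k\<in>{..Suc q}. B k)" using c by (simp add: q)
  also have "(\<Oplus>k\<in>{..Suc q}. B k) = (\<Oplus>k\<in>{..q}. B (Suc k)) \<oplus> B 0"
    by (rule finsum_Suc2) (use c in simp)
  also have "(\<Oplus>k\<in>{..q}. B (Suc k)) = (\<Oplus>k\<in>{..q}. \<zero>)"
  proof (rule finsum_cong')
    fix k assume "k \<in> {..q}"
    then have "p dvd (p choose Suc k)"
      by (intro dvd_choose_prime) (use prime_p p_pos q in auto)
    then show "B (Suc k) = \<zero>" using x y by (simp add: B_def char_dvd del: nat_pow_Suc)
  qed simp_all
  finally show ?thesis using x y by (simp add: B_def)
qed

lemma frobenius_zero: "\<zero> [^] p = \<zero>" "\<zero> [^] (p - Suc 0) = \<zero>"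
  using p_pos nat_pow_zero by auto

lemma frobenius_uminus:
  assumes x: "x \<in> carrier R"
  shows "(\<ominus> x) [^] p = \<ominus> (x [^] p)"
proof -
  have "x [^] p \<oplus> (\<ominus> x) [^] p = \<zero>"
    using frobenius_add[of x "\<ominus> x"] x by (simp add: r_neg frobenius_zero)
  then have "\<ominus> (x [^] p) = (\<ominus> x) [^] p"
    using minus_equality[of "(\<ominus> x) [^] p" "x [^] p"] x by (simp add: a_comm)
  then show ?thesis by simp
qed

lemma frobenius_minus:
  assumes "x \<in> carrier R" "y \<in> carrier R"
  shows "(x \<ominus> y) [^] p = x [^] p \<ominus> y [^] p"
  using assms by (simp add: minus_eq frobenius_add frobenius_uminus)

lemma power_p: "x \<in> carrier R \<Longrightarrow> x [^] p = x \<otimes> x [^] (p - Suc 0)"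
  using p_pos nat_pow_Suc2[of x "p - 1"] by simp

text \<open>Comparing \<open>-1 = (-1)^p\<close> with \<open>(-1) (-1)^(p-1)\<close> gives
  \<open>(-1)^(p-1) = 1\<close> without separating the case \<open>p = 2\<close>.\<close>

lemma uminus_power_p_minus_1:
  assumes x: "x \<in> carrier R"
  shows "(\<ominus> x) [^] (p - Suc 0) = x [^] (p - Suc 0)"
proof -
  have "(\<ominus> \<one>) [^] (p - Suc 0) = \<one>"
  proof -
    have "\<ominus> \<one> = (\<ominus> \<one>) [^] p" by (simp add: frobenius_uminus)
    also have "\<dots> = (\<ominus> \<one>) \<otimes> (\<ominus> \<one>) [^] (p - Suc 0)" by (simp add: power_p)
    finally have "\<ominus> \<one> = \<ominus> ((\<ominus> \<one>) [^] (p - Suc 0))" by (simp add: l_minus)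
    then have "\<ominus> (\<ominus> \<one>) = \<ominus> (\<ominus> ((\<ominus> \<one>) [^] (p - Suc 0)))" by (rule arg_cong)
    then show ?thesis by simp
  qed
  moreover have "(\<ominus> \<one> \<otimes> x) [^] (p - Suc 0) = (\<ominus> \<one>) [^] (p - Suc 0) \<otimes> x [^] (p - Suc 0)"
    by (rule nat_pow_distrib) (use x in auto)
  moreover have "\<ominus> \<one> \<otimes> x = \<ominus> x" using x by algebra
  ultimately show ?thesis using x by simp
qed

text \<open>The additive polynomial whose roots are the \<open>\<F>\<^sub>p\<close>-linear combinations of the given elements.\<close>

primrec additive_poly :: "'a list \<Rightarrow> 'a \<Rightarrow> 'a" where
  "additive_poly [] t = t"
| "additive_poly (s # ss) t =
     additive_poly ss t [^] p \<ominus> additive_poly ss s [^] (p - Suc 0) \<otimes> additive_poly ss t"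

lemma additive_poly_closed [simp]:
  "set ss \<subseteq> carrier R \<Longrightarrow> t \<in> carrier R \<Longrightarrow> additive_poly ss t \<in> carrier R"
  by (induction ss arbitrary: t) auto

lemma additive_poly_add:
  "set ss \<subseteq> carrier R \<Longrightarrow> s \<in> carrier R \<Longrightarrow> t \<in> carrier R \<Longrightarrow>
    additive_poly ss (s \<oplus> t) = additive_poly ss s \<oplus> additive_poly ss t"
proof (induction ss arbitrary: s t)
  case Nil
  then show ?case by simp
next
  case (Cons a ss)
  define A S T where "A = additive_poly ss a [^] (p - Suc 0)" and "S = additive_poly ss s" and "T = additive_poly ss t"
  have c: "A \<in> carrier R" "S \<in> carrier R" "T \<in> carrier R" "S [^] p \<in> carrier R" "T [^] p \<in> carrier R"
    using Cons.prems by (auto simp: A_def S_def T_def)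
  have "additive_poly ss (s \<oplus> t) = S \<oplus> T" using Cons by (simp add: S_def T_def)
  moreover have "(S [^] p \<oplus> T [^] p) \<ominus> A \<otimes> (S \<oplus> T) = (S [^] p \<ominus> A \<otimes> S) \<oplus> (T [^] p \<ominus> A \<otimes> T)"
    using c by algebra
  ultimately show ?case using c by (simp add: frobenius_add A_def S_def T_def)
qed

lemma additive_poly_zero [simp]: "set ss \<subseteq> carrier R \<Longrightarrow> additive_poly ss \<zero> = \<zero>"
  by (induction ss) (auto simp: frobenius_zero)

lemma additive_poly_root:
  "set ss \<subseteq> carrier R \<Longrightarrow> s \<in> set ss \<Longrightarrow> additive_poly ss s = \<zero>"
proof (induction ss)
  case (Cons a ss)
  have "additive_poly ss a [^] p = additive_poly ss a [^] (p - Suc 0) \<otimes> additive_poly ss a"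
    using Cons.prems power_p[of "additive_poly ss a"] m_comm[of "additive_poly ss a"] by simp
  then show ?case using Cons by (cases "s = a") (auto simp: frobenius_zero r_neg minus_eq)
qed simp

text \<open>For linearly independent roots in a field, the polynomial is a product over their span
  and hence symmetric. In an arbitrary ring this becomes a polynomial identity, checked by
  expansion. It allows every listed root to be treated as the outermost one.\<close>

lemma additive_poly_swap:
  assumes ss: "set ss \<subseteq> carrier R" and a: "a \<in> carrier R" and b: "b \<in> carrier R" and t: "t \<in> carrier R"
  shows "additive_poly (a # b # ss) t = additive_poly (b # a # ss) t"
proof -
  \<comment> \<open>\<open>N\<close> is the expanded form. Its coefficient of \<open>T^p\<close>
    must be symmetric in \<open>A\<close> and \<open>B\<close>; with \<open>U\<close>,
    \<open>V\<close>, \<open>W\<close> below this is \<open>U^p + V W = V^p + U W\<close>, which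
    follows from \<open>(V - U) W = (V - U)^p = V^p - U^p\<close>.\<close>
  define N where "N A B T = (T [^] p) [^] p \<ominus> (A [^] (p - Suc 0)) [^] p \<otimes> T [^] p
      \<ominus> B [^] (p - Suc 0) \<otimes> (B [^] (p - Suc 0) \<ominus> A [^] (p - Suc 0)) [^] (p - Suc 0) \<otimes> T [^] p
      \<oplus> (A \<otimes> B) [^] (p - Suc 0) \<otimes> (B [^] (p - Suc 0) \<ominus> A [^] (p - Suc 0)) [^] (p - Suc 0) \<otimes> T" for A B T
  have key: "(T [^] p \<ominus> B [^] (p - Suc 0) \<otimes> T) [^] p
      \<ominus> (A [^] p \<ominus> B [^] (p - Suc 0) \<otimes> A) [^] (p - Suc 0) \<otimes> (T [^] p \<ominus> B [^] (p - Suc 0) \<otimes> T) = N A B T"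
    and symmetric: "N A B T = N B A T"
    if A: "A \<in> carrier R" and B: "B \<in> carrier R" and T: "T \<in> carrier R" for A B T
  proof -
    define U V W where "U = A [^] (p - Suc 0)" and "V = B [^] (p - Suc 0)" and "W = (V \<ominus> U) [^] (p - Suc 0)"
    have c: "U \<in> carrier R" "V \<in> carrier R" "W \<in> carrier R" "T [^] p \<in> carrier R" "(T [^] p) [^] p \<in> carrier R"
      "U [^] p \<in> carrier R" "V [^] p \<in> carrier R"
      using A B T by (simp_all add: U_def V_def W_def)
    have W': "(U \<ominus> V) [^] (p - Suc 0) = W"
    proof -
      have "U \<ominus> V = \<ominus> (V \<ominus> U)" using c by algebra
      then show ?thesis using c by (simp add: uminus_power_p_minus_1 W_def)
    qed
    have "A [^] p \<ominus> V \<otimes> A = A \<otimes> (U \<ominus> V)"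
      using power_p[OF A] A c by (simp add: U_def[symmetric]) algebra
    then have e: "(A [^] p \<ominus> V \<otimes> A) [^] (p - Suc 0) = U \<otimes> W"
      using A c by (simp add: nat_pow_distrib U_def[symmetric] W')
    have f: "(V \<ominus> U) \<otimes> W = V [^] p \<ominus> U [^] p"
      using power_p[of "V \<ominus> U"] frobenius_minus[of V U] c by (simp add: W_def)
    have "(T [^] p \<ominus> V \<otimes> T) [^] p \<ominus> (U \<otimes> W) \<otimes> (T [^] p \<ominus> V \<otimes> T)
       = (T [^] p) [^] p \<ominus> V [^] p \<otimes> T [^] p \<ominus> (U \<otimes> W) \<otimes> (T [^] p \<ominus> V \<otimes> T)"
      using c T by (simp add: frobenius_minus nat_pow_distrib)
    also have "V [^] p = U [^] p \<oplus> (V \<ominus> U) \<otimes> W" unfolding f using c by algebra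
    also have "(T [^] p) [^] p \<ominus> (U [^] p \<oplus> (V \<ominus> U) \<otimes> W) \<otimes> T [^] p \<ominus> (U \<otimes> W) \<otimes> (T [^] p \<ominus> V \<otimes> T)
      = (T [^] p) [^] p \<ominus> U [^] p \<otimes> T [^] p \<ominus> V \<otimes> W \<otimes> T [^] p \<oplus> (U \<otimes> V) \<otimes> W \<otimes> T"
      using c T by algebra
    finally show "(T [^] p \<ominus> B [^] (p - Suc 0) \<otimes> T) [^] p
      \<ominus> (A [^] p \<ominus> B [^] (p - Suc 0) \<otimes> A) [^] (p - Suc 0) \<otimes> (T [^] p \<ominus> B [^] (p - Suc 0) \<otimes> T) = N A B T"
      using A B by (simp add: N_def e U_def[symmetric] V_def[symmetric] W_def[symmetric] nat_pow_distrib)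
    have "U [^] p \<oplus> V \<otimes> W = U [^] p \<oplus> (V \<ominus> U) \<otimes> W \<oplus> U \<otimes> W" using c by algebra
    also have "\<dots> = V [^] p \<oplus> U \<otimes> W" unfolding f using c by algebra
    finally have "U [^] p \<oplus> V \<otimes> W = V [^] p \<oplus> U \<otimes> W" .
    moreover have "(T [^] p) [^] p \<ominus> x \<otimes> T [^] p \<ominus> y \<otimes> W \<otimes> T [^] p = (T [^] p) [^] p \<ominus> (x \<oplus> y \<otimes> W) \<otimes> T [^] p"
      if "x \<in> carrier R" "y \<in> carrier R" for x y using that c by algebra
    ultimately show "N A B T = N B A T"
      using c by (simp add: N_def U_def[symmetric] V_def[symmetric] W_def[symmetric] W' m_comm[OF A B])
  qed
  show ?thesis
    using key[of "additive_poly ss a" "additive_poly ss b" "additive_poly ss t"]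
      key[of "additive_poly ss b" "additive_poly ss a" "additive_poly ss t"]
      symmetric[of "additive_poly ss a" "additive_poly ss b" "additive_poly ss t"] assms
    by simp
qed

lemma additive_poly_move_front:
  "set xs \<subseteq> carrier R \<Longrightarrow> set ys \<subseteq> carrier R \<Longrightarrow> a \<in> carrier R \<Longrightarrow> t \<in> carrier R \<Longrightarrow>
    additive_poly (xs @ a # ys) t = additive_poly (a # xs @ ys) t"
proof (induction xs arbitrary: t)
  case (Cons x xs)
  have "additive_poly (x # xs @ a # ys) t = additive_poly (x # a # xs @ ys) t"
    using Cons by (auto simp del: additive_poly.simps simp: additive_poly.simps(2)[of x])
  also have "\<dots> = additive_poly (a # x # xs @ ys) t"
    using Cons.prems by (intro additive_poly_swap) auto
  finally show ?case by simp
qed simp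

end

section \<open>Units modulo \<open>c\<close> and valuations of additive polynomials\<close>

definition (in cring) unit_mod :: "'a \<Rightarrow> 'a \<Rightarrow> bool" where
  "unit_mod c h \<longleftrightarrow> h \<in> carrier R \<and> (\<exists>k \<in> carrier R. \<exists>q \<in> carrier R. h \<otimes> k = \<one> \<oplus> c \<otimes> q)"

lemma (in cring) unit_mod_closed: "unit_mod c h \<Longrightarrow> h \<in> carrier R"
  by (simp add: unit_mod_def)

lemma (in cring) unit_mod_one: "c \<in> carrier R \<Longrightarrow> unit_mod c \<one>"
  unfolding unit_mod_def by (intro conjI bexI[of _ \<one>] bexI[of _ \<zero>]) auto

lemma (in cring) unit_mod_mult:
  assumes c: "c \<in> carrier R" and "unit_mod c g" "unit_mod c h"
  shows "unit_mod c (g \<otimes> h)"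
proof -
  obtain k q where g: "g \<in> carrier R" "k \<in> carrier R" "q \<in> carrier R" "g \<otimes> k = \<one> \<oplus> c \<otimes> q"
    using assms(2) unfolding unit_mod_def by auto
  obtain l r where h: "h \<in> carrier R" "l \<in> carrier R" "r \<in> carrier R" "h \<otimes> l = \<one> \<oplus> c \<otimes> r"
    using assms(3) unfolding unit_mod_def by auto
  have "(g \<otimes> h) \<otimes> (k \<otimes> l) = (g \<otimes> k) \<otimes> (h \<otimes> l)" using g(1,2) h(1,2) by algebra
  also have "\<dots> = \<one> \<oplus> c \<otimes> (q \<oplus> r \<oplus> c \<otimes> (q \<otimes> r))"
    unfolding g(4) h(4) using c g(3) h(3) by algebra
  finally show ?thesis unfolding unit_mod_def using g h c by blast
qed

lemma (in cring) unit_mod_power: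
  "c \<in> carrier R \<Longrightarrow> unit_mod c h \<Longrightarrow> unit_mod c (h [^] (n::nat))"
  by (induction n) (simp_all add: unit_mod_one unit_mod_mult)

lemma (in cring) unit_mod_add:
  assumes c: "c \<in> carrier R" and "unit_mod c h" and x: "x \<in> carrier R"
  shows "unit_mod c (h \<oplus> c \<otimes> x)"
proof -
  obtain k q where h: "h \<in> carrier R" "k \<in> carrier R" "q \<in> carrier R" "h \<otimes> k = \<one> \<oplus> c \<otimes> q"
    using assms(2) unfolding unit_mod_def by auto
  have "(h \<oplus> c \<otimes> x) \<otimes> k = h \<otimes> k \<oplus> c \<otimes> (x \<otimes> k)" using c x h(1,2) by algebra
  also have "\<dots> = \<one> \<oplus> c \<otimes> (q \<oplus> x \<otimes> k)" unfolding h(4) using c x h(1-3) by algebra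
  finally show ?thesis unfolding unit_mod_def using h c x by blast
qed

lemma (in cring) unit_mod_uminus:
  assumes c: "c \<in> carrier R" and "unit_mod c h"
  shows "unit_mod c (\<ominus> h)"
proof -
  obtain k q where h: "h \<in> carrier R" "k \<in> carrier R" "q \<in> carrier R" "h \<otimes> k = \<one> \<oplus> c \<otimes> q"
    using assms(2) unfolding unit_mod_def by auto
  have "(\<ominus> h) \<otimes> (\<ominus> k) = h \<otimes> k" using h(1,2) by algebra
  with h show ?thesis unfolding unit_mod_def by (metis a_inv_closed)
qed

text \<open>
  The value of the additive polynomial with roots \<open>c\<^sup>j\<close> at \<open>c\<^sup>i\<close> behaves as over a valuation ring
  with \<open>c\<close> of positive valuation: it is \<open>c\<close> to a power strictly increasing in \<open>i\<close>, up to a unit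
  modulo \<open>c\<close>. The strict monotonicity is what prevents cancellation in the inductive step.
\<close>

lemma (in char_cring) additive_poly_powers:
  assumes c: "c \<in> carrier R" and "distinct js"
  shows "\<exists>v :: nat \<Rightarrow> nat.
    (\<forall>i j. i \<notin> set js \<longrightarrow> j \<notin> set js \<longrightarrow> i < j \<longrightarrow> v i < v j) \<and>
    (\<forall>i. i \<notin> set js \<longrightarrow> (\<exists>h. unit_mod c h \<and>
       additive_poly (map (\<lambda>j. c [^] j) js) (c [^] i) = c [^] v i \<otimes> h))"
  using assms(2)
proof (induction js)
  case Nil
  have "\<exists>h. unit_mod c h \<and> c [^] i = c [^] i \<otimes> h" for i :: nat
    using unit_mod_one[OF c] c by (intro exI[of _ \<one>]) simp
  then show ?case by (intro exI[of _ "\<lambda>i. i"]) auto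
next
  case (Cons j js)
  have "distinct js" using Cons.prems by simp
  from Cons.IH[OF this] obtain v :: "nat \<Rightarrow> nat" where
    "(\<forall>i j. i \<notin> set js \<longrightarrow> j \<notin> set js \<longrightarrow> i < j \<longrightarrow> v i < v j) \<and>
    (\<forall>i. i \<notin> set js \<longrightarrow> (\<exists>h. unit_mod c h \<and>
       additive_poly (map (\<lambda>j. c [^] j) js) (c [^] i) = c [^] v i \<otimes> h))" by (elim exE)
  then have mono: "\<And>i k. i \<notin> set js \<Longrightarrow> k \<notin> set js \<Longrightarrow> i < k \<Longrightarrow> v i < v k"
    and v: "\<And>i. i \<notin> set js \<Longrightarrow> \<exists>h. unit_mod c h \<and>
       additive_poly (map (\<lambda>j. c [^] j) js) (c [^] i) = c [^] v i \<otimes> h" by blast+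
  have j: "j \<notin> set js" using Cons.prems by simp
  obtain k where k: "unit_mod c k" "additive_poly (map (\<lambda>j. c [^] j) js) (c [^] j) = c [^] v j \<otimes> k"
    using v[OF j] by auto
  have kc: "k \<in> carrier R" using k(1) by (rule unit_mod_closed)
  \<comment> \<open>The two summands of the recursion have the exponents \<open>p * v i\<close> and
    \<open>(p - 1) * v j + v i\<close>; \<open>w i\<close> is the smaller one.\<close>
  define w where "w i = v i + (p - 1) * min (v i) (v j)" for i
  have "w i < w l" if "i \<notin> set js" "l \<notin> set js" "i < l" for i l
  proof -
    have "v i < v l" using mono that by blast
    then show ?thesis unfolding w_def by (intro add_less_le_mono mult_le_mono2) auto
  qed
  moreover have "\<exists>h. unit_mod c h \<and>
       additive_poly (map (\<lambda>j. c [^] j) (j # js)) (c [^] i) = c [^] w i \<otimes> h"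
    if i: "i \<notin> set (j # js)" for i
  proof -
    obtain h where h: "unit_mod c h" "additive_poly (map (\<lambda>j. c [^] j) js) (c [^] i) = c [^] v i \<otimes> h"
      using v[of i] i by auto
    have hc: "h \<in> carrier R" using h(1) by (rule unit_mod_closed)
    have e: "additive_poly (map (\<lambda>j. c [^] j) (j # js)) (c [^] i)
      = (c [^] v i \<otimes> h) [^] p \<ominus> (c [^] v j \<otimes> k) [^] (p - Suc 0) \<otimes> (c [^] v i \<otimes> h)"
      by (simp add: h(2) k(2))
    have e1: "(c [^] v i \<otimes> h) [^] p = c [^] (p * v i) \<otimes> h [^] p"
      using c hc by (simp add: nat_pow_distrib nat_pow_pow mult.commute)
    have e2: "(c [^] v j \<otimes> k) [^] (p - Suc 0) \<otimes> (c [^] v i \<otimes> h)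
      = c [^] ((p - 1) * v j + v i) \<otimes> (k [^] (p - Suc 0) \<otimes> h)"
    proof -
      have "(c [^] v j \<otimes> k) [^] (p - Suc 0) = c [^] ((p - 1) * v j) \<otimes> k [^] (p - Suc 0)"
        using c kc by (simp add: nat_pow_distrib nat_pow_pow mult.commute)
      moreover have "c [^] ((p - 1) * v j + v i) = c [^] ((p - 1) * v j) \<otimes> c [^] v i"
        using c by (simp add: nat_pow_mult)
      moreover have "a \<otimes> b \<otimes> (d \<otimes> h) = (a \<otimes> d) \<otimes> (b \<otimes> h)"
        if "a \<in> carrier R" "b \<in> carrier R" "d \<in> carrier R" for a b d using that hc by algebra
      ultimately show ?thesis using c kc by simp
    qed
    have pp: "p * n = n + (p - 1) * n" for n
      using p_pos(1) by (metis Suc_pred' One_nat_def mult_Suc)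
    have "v i \<noteq> v j" using mono i j by (metis linorder_neqE_nat list.set_intros(1,2) nat_neq_iff)
    then consider "v i < v j" | "v j < v i" by linarith
    then show ?thesis
    proof cases
      case 1
      \<comment> \<open>The gap between the exponents is \<open>Suc m\<close>, so one factor
        \<open>c\<close> is left over: the other summand changes the leading cofactor
        \<open>h^p\<close> only by a multiple of \<open>c\<close>.\<close>
      define m where "m = (p - 1) * (v j - v i) - 1"
      have "(p - 1) * (v j - v i) > 0" using 1 p_pos by simp
      moreover have "(p - 1) * v j = (p - 1) * v i + (p - 1) * (v j - v i)"
        using 1 by (metis add_diff_inverse_nat add_mult_distrib2 less_imp_not_less)
      ultimately have m: "(p - 1) * v j + v i = p * v i + Suc m" unfolding pp m_def by linarith
      have w: "w i = p * v i" using 1 by (simp add: w_def pp)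
      define x where "x = \<ominus> (c [^] m \<otimes> (k [^] (p - Suc 0) \<otimes> h))"
      have xc: "x \<in> carrier R" using c kc hc by (simp add: x_def)
      have "c [^] ((p - 1) * v j + v i) = c [^] (p * v i) \<otimes> (c [^] m \<otimes> c)"
        using c nat_pow_mult[OF c, of "p * v i" "Suc m"] unfolding m by simp
      moreover have "a \<otimes> b \<ominus> (a \<otimes> (d \<otimes> c)) \<otimes> f = a \<otimes> (b \<oplus> c \<otimes> (\<ominus> (d \<otimes> f)))"
        if "a \<in> carrier R" "b \<in> carrier R" "d \<in> carrier R" "f \<in> carrier R" for a b d f
        using that c by algebra
      ultimately have "additive_poly (map (\<lambda>j. c [^] j) (j # js)) (c [^] i) = c [^] w i \<otimes> (h [^] p \<oplus> c \<otimes> x)"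
        unfolding e e1 e2 w x_def using c kc hc by simp
      moreover have "unit_mod c (h [^] p \<oplus> c \<otimes> x)"
        using c h(1) xc by (intro unit_mod_add unit_mod_power)
      ultimately show ?thesis by blast
    next
      case 2
      \<comment> \<open>Now the second summand leads, with a cofactor that is up to sign a product
        of units modulo \<open>c\<close>. Again \<open>Suc m\<close> is the gap, here
        \<open>(p - 1) * (v i - v j)\<close>.\<close>
      define m where "m = v i - v j - 1 + (p - 2) * (v i - v j)"
      have pq: "p - 1 = Suc (p - 2)" using p_pos by linarith
      have "p * v i = v i + (p - 1) * v j + (p - 1) * (v i - v j)"
        using 2 pp[of "v i"] by (metis add.assoc add_diff_inverse_nat add_mult_distrib2 less_imp_not_less)
      moreover have "(p - 1) * (v i - v j) = Suc m" using 2 unfolding m_def pq by simp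
      ultimately have m: "p * v i = ((p - 1) * v j + v i) + Suc m" by linarith
      have w: "w i = (p - 1) * v j + v i" using 2 by (simp add: w_def)
      define x where "x = c [^] m \<otimes> h [^] p"
      have xc: "x \<in> carrier R" using c kc hc by (simp add: x_def)
      have "c [^] (p * v i) = c [^] ((p - 1) * v j + v i) \<otimes> (c [^] m \<otimes> c)"
        using c nat_pow_mult[OF c, of "(p - 1) * v j + v i" "Suc m"] unfolding m by simp
      moreover have "(a \<otimes> (d \<otimes> c)) \<otimes> b \<ominus> a \<otimes> f = a \<otimes> (\<ominus> f \<oplus> c \<otimes> (d \<otimes> b))"
        if "a \<in> carrier R" "b \<in> carrier R" "d \<in> carrier R" "f \<in> carrier R" for a b d f
        using that c by algebra
      ultimately have "additive_poly (map (\<lambda>j. c [^] j) (j # js)) (c [^] i)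
          = c [^] w i \<otimes> (\<ominus> (k [^] (p - Suc 0) \<otimes> h) \<oplus> c \<otimes> x)"
        unfolding e e1 e2 w x_def using c kc hc by simp
      moreover have "unit_mod c (\<ominus> (k [^] (p - Suc 0) \<otimes> h) \<oplus> c \<otimes> x)"
        using c h(1) k(1) xc by (intro unit_mod_add unit_mod_uminus unit_mod_mult unit_mod_power)
      ultimately show ?thesis by blast
    qed
  qed
  ultimately show ?case by (intro exI[of _ w]) auto
qed

text \<open>The polynomial has no constant term, so a factor of the argument survives. This allows a
  value to be split into a multiple of \<open>e\<close> and a multiple of
  \<open>1 - e\<close>.\<close>

lemma (in char_cring) additive_poly_divides:
  "set ss \<subseteq> carrier R \<Longrightarrow> t \<in> carrier R \<Longrightarrow> x \<in> carrier R \<Longrightarrow>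
    \<exists>y \<in> carrier R. additive_poly ss (t \<otimes> x) = t \<otimes> y"
proof (induction ss)
  case (Cons s ss)
  then obtain y where y: "y \<in> carrier R" "additive_poly ss (t \<otimes> x) = t \<otimes> y" by auto
  define A where "A = additive_poly ss s [^] (p - Suc 0)"
  have A: "A \<in> carrier R" using Cons by (simp add: A_def)
  have "(t \<otimes> y) [^] p \<ominus> A \<otimes> (t \<otimes> y) = (t \<otimes> y) \<otimes> (t \<otimes> y) [^] (p - Suc 0) \<ominus> A \<otimes> (t \<otimes> y)"
    using y Cons.prems by (simp add: power_p)
  also have "\<dots> = t \<otimes> (y \<otimes> (t \<otimes> y) [^] (p - Suc 0) \<ominus> A \<otimes> y)"
    using y(1) Cons.prems(2) A nat_pow_closed[of "t \<otimes> y" "p - Suc 0"] by algebra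
  finally show ?case using y Cons.prems A by (auto simp: A_def)
qed auto

section \<open>Comparability of primes below maximal ideals\<close>

text \<open>The combinatorial content of NIP for arbitrary sets of points and parameters; formulas
  enter only where it is derived.\<close>

definition no_shatter :: "'a set \<Rightarrow> 'b set \<Rightarrow> ('a \<Rightarrow> 'b \<Rightarrow> bool) \<Rightarrow> bool" where
  "no_shatter D E Q \<longleftrightarrow> (\<exists>n. \<not> (\<exists>(d :: nat \<Rightarrow> 'a) b.
     (\<forall>i < n. d i \<in> D) \<and> (\<forall>T \<subseteq> {..<n}. b T \<in> E) \<and> (\<forall>i < n. \<forall>T \<subseteq> {..<n}. Q (d i) (b T) \<longleftrightarrow> i \<in> T)))"

text \<open>In the second family the points are scaling factors \<open>d\<close>, and a parameter
  consists of the tested element \<open>x\<close> and a modulus \<open>g\<close>. Keeping only these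
  statements makes the arguments available in every ring that inherits them.\<close>

locale tame_cring = char_cring +
  assumes tame_dvd: "no_shatter (carrier R) (carrier R) (\<lambda>x y. \<exists>w \<in> carrier R. y = x \<otimes> w)"
    and tame_artin_schreier: "no_shatter (carrier R) (carrier R \<times> carrier R)
      (\<lambda>d (x, g). \<exists>w \<in> carrier R. x = d [^] p \<otimes> ((g \<otimes> w) [^] p \<ominus> g \<otimes> w))"

section \<open>Approximate idempotents\<close>

lemma (in cring) unit_mod_common_multiple:
  fixes n :: nat
  assumes c: "c \<in> carrier R" and h: "\<And>i. i < n \<Longrightarrow> unit_mod c (h i)"
  shows "\<exists>H. unit_mod c H \<and> (\<forall>i < n. \<exists>r \<in> carrier R. H = h i \<otimes> r)"
  using h
proof (induction n)
  case 0
  then show ?case using unit_mod_one[OF c] by auto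
next
  case (Suc n)
  then obtain H where H: "unit_mod c H" "\<And>i. i < n \<Longrightarrow> \<exists>r \<in> carrier R. H = h i \<otimes> r" by auto
  have hn: "unit_mod c (h n)" using Suc.prems by simp
  have cl: "H \<in> carrier R" "h n \<in> carrier R" using H hn by (auto intro: unit_mod_closed)
  have "\<exists>r \<in> carrier R. H \<otimes> h n = h i \<otimes> r" if i: "i < Suc n" for i
  proof (cases "i = n")
    case True
    then show ?thesis using cl by (auto simp: m_comm)
  next
    case False
    then obtain r where r: "r \<in> carrier R" "H = h i \<otimes> r" using H(2)[of i] i by auto
    have "h i \<in> carrier R" using Suc.prems i by (auto intro: unit_mod_closed)
    then show ?thesis using r cl by (intro bexI[of _ "r \<otimes> h n"]) (auto simp: m_assoc)
  qed
  moreover have "unit_mod c (H \<otimes> h n)" using unit_mod_mult[OF c H(1) hn] .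
  ultimately show ?case by blast
qed

lemma (in cring) one_minus_power:
  assumes z: "z \<in> carrier R"
  shows "\<exists>y \<in> carrier R. \<one> \<ominus> z [^] (N :: nat) = (\<one> \<ominus> z) \<otimes> y"
proof (induction N)
  case 0
  have "\<one> \<ominus> \<one> = (\<one> \<ominus> z) \<otimes> \<zero>" using z by algebra
  then show ?case by auto
next
  case (Suc N)
  then obtain y where y: "y \<in> carrier R" "\<one> \<ominus> z [^] N = (\<one> \<ominus> z) \<otimes> y" by auto
  have cz: "z [^] N \<in> carrier R" using z by simp
  have "\<one> \<ominus> z [^] N \<otimes> z = (\<one> \<ominus> z [^] N) \<otimes> z \<oplus> (\<one> \<ominus> z)" using z cz by algebra
  also have "\<dots> = (\<one> \<ominus> z) \<otimes> (y \<otimes> z \<oplus> \<one>)" unfolding y(2) using z y(1) by algebra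
  finally show ?case using y(1) z by auto
qed

text \<open>
  The witness is \<open>e = 1 - (c s)\<^sup>N\<close> with \<open>N\<close> large, where \<open>1 - c s\<close> is a common multiple of \<open>1 - c\<close>
  and all \<open>h i\<close>.
\<close>

lemma (in cring) exists_approximate_idempotent:
  fixes n :: nat
  assumes c: "c \<in> carrier R" and h: "\<And>i. i < n \<Longrightarrow> unit_mod c (h i)"
  obtains e u v where "e \<in> carrier R" "u \<in> carrier R" "v \<in> carrier R"
    "e = (\<one> \<ominus> c) \<otimes> u" "\<one> \<ominus> e = c \<otimes> v"
    "\<And>i. i < n \<Longrightarrow> \<exists>z \<in> carrier R. e \<otimes> (\<one> \<ominus> e) = (c [^] (\<nu> i :: nat) \<otimes> h i) \<otimes> (c \<otimes> (\<one> \<ominus> c)) \<otimes> z"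
proof -
  obtain H where H: "unit_mod c H" "\<And>i. i < n \<Longrightarrow> \<exists>r \<in> carrier R. H = h i \<otimes> r"
    using unit_mod_common_multiple[of c n h] assms by blast
  then obtain k q where k: "H \<in> carrier R" "k \<in> carrier R" "q \<in> carrier R" "H \<otimes> k = \<one> \<oplus> c \<otimes> q"
    unfolding unit_mod_def by auto
  \<comment> \<open>Found by expanding \<open>(1 - c) (1 + c q) = 1 - c (1 - q + c q)\<close>, where
    \<open>1 + c q = H k\<close>.\<close>
  define s where "s = \<one> \<ominus> q \<oplus> c \<otimes> q"
  \<comment> \<open>Larger than every \<open>\<nu> i\<close>: the power \<open>c^N\<close> in
    \<open>1 - e\<close> has to supply \<open>c^(\<nu> i)\<close> and also the factor
    \<open>c\<close> of \<open>c (1 - c)\<close>, while \<open>h i\<close> and \<open>1 - c\<close>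
    come from \<open>e\<close>.\<close>
  define N where "N = Suc (\<Sum>i<n. \<nu> i)"
  have s: "s \<in> carrier R" using c k by (simp add: s_def)
  have E: "\<one> \<ominus> c \<otimes> s = (\<one> \<ominus> c) \<otimes> (H \<otimes> k)" unfolding k(4) s_def using c k(3) by algebra
  obtain y where y: "y \<in> carrier R" "\<one> \<ominus> (c \<otimes> s) [^] N = (\<one> \<ominus> c \<otimes> s) \<otimes> y"
    using one_minus_power[of "c \<otimes> s" N] c s by auto
  define e where "e = \<one> \<ominus> (c \<otimes> s) [^] N"
  have e: "e = (\<one> \<ominus> c) \<otimes> (H \<otimes> k \<otimes> y)"
    unfolding e_def y(2) E using c k(1,2) y(1) by algebra
  have e': "\<one> \<ominus> e = c [^] N \<otimes> s [^] N"
  proof -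
    have "\<one> \<ominus> (\<one> \<ominus> x) = x" if "x \<in> carrier R" for x using that by algebra
    then show ?thesis using c s by (simp add: e_def nat_pow_distrib)
  qed
  show thesis
  proof (rule that)
    show "e \<in> carrier R" "H \<otimes> k \<otimes> y \<in> carrier R" using c s k y by (simp_all add: e_def)
    show "c [^] (N - 1) \<otimes> s [^] N \<in> carrier R" using c s by simp
    show "e = (\<one> \<ominus> c) \<otimes> (H \<otimes> k \<otimes> y)" by (rule e)
    show "\<one> \<ominus> e = c \<otimes> (c [^] (N - 1) \<otimes> s [^] N)"
      unfolding e' using c s nat_pow_Suc2[OF c, of "N - 1"] by (simp add: N_def m_assoc)
  next
    fix i assume i: "i < n"
    obtain r where r: "r \<in> carrier R" "H = h i \<otimes> r" using H(2)[OF i] by auto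
    have hi: "h i \<in> carrier R" using h[OF i] by (rule unit_mod_closed)
    have "\<nu> i \<le> (\<Sum>i<n. \<nu> i)" using i by (intro member_le_sum) auto
    then obtain M where M: "N = Suc (\<nu> i) + M" unfolding N_def using le_Suc_ex by (metis add_Suc)
    have cN: "c [^] N = c [^] \<nu> i \<otimes> c \<otimes> c [^] M"
      using c nat_pow_mult[OF c, of "Suc (\<nu> i)" M] by (simp add: M)
    have "e \<otimes> (\<one> \<ominus> e) = ((\<one> \<ominus> c) \<otimes> (h i \<otimes> r \<otimes> k \<otimes> y)) \<otimes> (c [^] \<nu> i \<otimes> c \<otimes> c [^] M \<otimes> s [^] N)"
      unfolding e' unfolding e r(2) cN ..
    also have "\<dots> = (c [^] \<nu> i \<otimes> h i) \<otimes> (c \<otimes> (\<one> \<ominus> c)) \<otimes> (r \<otimes> k \<otimes> y \<otimes> c [^] M \<otimes> s [^] N)"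
    proof -
      have "(a \<otimes> (b \<otimes> r \<otimes> k \<otimes> y)) \<otimes> (x \<otimes> c \<otimes> x' \<otimes> x'') = (x \<otimes> b) \<otimes> (c \<otimes> a) \<otimes> (r \<otimes> k \<otimes> y \<otimes> x' \<otimes> x'')"
        if "a \<in> carrier R" "b \<in> carrier R" "x \<in> carrier R" "x' \<in> carrier R" "x'' \<in> carrier R" for a b x x' x''
        using that c r(1) k(2) y(1) by (simp add: m_assoc m_comm m_lcomm)
      then show ?thesis using c s hi by simp
    qed
    finally show "\<exists>z \<in> carrier R. e \<otimes> (\<one> \<ominus> e) = (c [^] \<nu> i \<otimes> h i) \<otimes> (c \<otimes> (\<one> \<ominus> c)) \<otimes> z"
      using r k y c s by blast
  qed
qed

text \<open>The construction gives \<open>A (t T) = d i^p (y^p - y)\<close>, where \<open>y\<close>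
  is congruent modulo \<open>g\<close> to \<open>e\<close> or to 0 according as \<open>i\<close> is
  in \<open>T\<close> or not. If a multiple \<open>g z\<close> could replace \<open>y\<close>, then
  \<open>r = g z - y\<close> would satisfy \<open>r^p = r\<close> modulo \<open>P\<close>. For
  \<open>i\<close> in \<open>T\<close> this is absurd, since \<open>r\<close> is then -1 at
  \<open>m\<close> and 0 at \<open>n\<close>.\<close>

lemma (in tame_cring) no_prime_below_comaximal:
  assumes P: "primeideal P R" and m: "ideal m R" "\<one> \<notin> m" and n: "ideal n R" "\<one> \<notin> n"
    and sub: "P \<subseteq> m" "P \<subseteq> n" and cm: "c \<in> m" "\<one> \<ominus> c \<in> n"
  shows False
proof -
  interpret P: primeideal P R by fact
  interpret m: ideal m R by fact
  interpret n: ideal n R by fact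
  have c: "c \<in> carrier R" using cm(1) m.a_Hcarr by blast
  have notP: "c \<notin> P"
  proof
    assume "c \<in> P"
    then have "c \<oplus> (\<one> \<ominus> c) \<in> n" using sub cm n.a_closed by blast
    moreover have "c \<oplus> (\<one> \<ominus> c) = \<one>" using c by algebra
    ultimately show False using n by simp
  qed
  have cnotP: "c [^] (k :: nat) \<notin> P" for k
  proof (induction k)
    case 0
    then show ?case using m(2) sub by auto
  next
    case (Suc k)
    then show ?case using P.I_prime[of "c [^] k" c] c notP by auto
  qed
  \<comment> \<open>An equation \<open>h k = 1 + c q\<close> keeps \<open>h\<close> out of every
    proper ideal containing \<open>c\<close>, and \<open>P\<close> lies in such an ideal.\<close>
  have unotP: "h \<notin> P" if h: "unit_mod c h" for h
  proof
    assume "h \<in> P"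
    obtain k q where k: "h \<in> carrier R" "k \<in> carrier R" "q \<in> carrier R" "h \<otimes> k = \<one> \<oplus> c \<otimes> q"
      using h unfolding unit_mod_def by auto
    have "h \<otimes> k \<ominus> c \<otimes> q \<in> m"
      unfolding minus_eq using \<open>h \<in> P\<close> sub cm k by (intro m.a_closed m.a_inv_closed m.I_r_closed) auto
    moreover have "h \<otimes> k \<ominus> c \<otimes> q = \<one>" unfolding k(4) using c k by algebra
    ultimately show False using m by simp
  qed
  \<comment> \<open>Zero both at \<open>m\<close> and at \<open>n\<close>, so adding multiples of
    \<open>g\<close> does not disturb the values of \<open>e\<close> there.\<close>
  define g where "g = c \<otimes> (\<one> \<ominus> c)"
  have g: "g \<in> carrier R" using c by (simp add: g_def)
  obtain l :: nat where l: "\<not> (\<exists>(d :: nat \<Rightarrow> 'a) b. (\<forall>i < l. d i \<in> carrier R) \<and> (\<forall>T \<subseteq> {..<l}. b T \<in> carrier R \<times> carrier R) \<and>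
    (\<forall>i < l. \<forall>T \<subseteq> {..<l}. (case b T of (x, g) \<Rightarrow> \<exists>w \<in> carrier R. x = (d i) [^] p \<otimes> ((g \<otimes> w) [^] p \<ominus> g \<otimes> w)) \<longleftrightarrow> i \<in> T))"
    using tame_artin_schreier unfolding no_shatter_def by (elim exE)
  \<comment> \<open>\<open>L i\<close> omits the root \<open>c^i\<close>, and its value there is the
    scaling factor \<open>d i\<close>. \<open>A\<close> has all \<open>l\<close> roots, so it does
    not depend on \<open>i\<close>.\<close>
  define js where "js i = [0..<i] @ [Suc i..<l]" for i
  define L where "L i = additive_poly (map (\<lambda>j. c [^] j) (js i))" for i
  define A where "A = additive_poly (map (\<lambda>j. c [^] j) [0..<l])"
  have sets: "set (map (\<lambda>j. c [^] j) (js i)) \<subseteq> carrier R" "set (map (\<lambda>j. c [^] j) [0..<l]) \<subseteq> carrier R" for i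
    using c by auto
  have Lc: "L i t \<in> carrier R" if "t \<in> carrier R" for i t using sets that by (simp add: L_def del: set_map)
  have Ac: "A t \<in> carrier R" if "t \<in> carrier R" for t using sets that by (simp add: A_def del: set_map)
  define d where "d i = L i (c [^] i)" for i
  have dc: "d i \<in> carrier R" for i using Lc c by (simp add: d_def)
  have "\<exists>\<nu> h. unit_mod c h \<and> d i = c [^] (\<nu>::nat) \<otimes> h" if "i < l" for i
  proof -
    have "distinct (js i)" "i \<notin> set (js i)" by (auto simp: js_def)
    with additive_poly_powers[OF c, of "js i"] show ?thesis unfolding d_def L_def by blast
  qed
  then have "\<forall>i. \<exists>\<nu> h. i < l \<longrightarrow> unit_mod c h \<and> d i = c [^] (\<nu>::nat) \<otimes> h" by blast
  from choice[OF this] obtain \<nu> where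
    "\<forall>i. \<exists>h. i < l \<longrightarrow> unit_mod c h \<and> d i = c [^] (\<nu> i :: nat) \<otimes> h" by blast
  from choice[OF this] obtain h where
    nh: "\<And>i. i < l \<Longrightarrow> unit_mod c (h i)" "\<And>i. i < l \<Longrightarrow> d i = c [^] (\<nu> i :: nat) \<otimes> h i" by blast
  have dP: "d i \<notin> P" if "i < l" for i
  proof
    assume "d i \<in> P"
    moreover have "h i \<in> carrier R" using nh(1)[OF that] by (rule unit_mod_closed)
    ultimately have "c [^] \<nu> i \<in> P \<or> h i \<in> P"
      using nh(2)[OF that] c by (intro P.I_prime) auto
    then show False using cnotP unotP[OF nh(1)[OF that]] by blast
  qed
  \<comment> \<open>The defect \<open>e (1 - e)\<close> is divisible by every \<open>d i g\<close>,
    so the error made by treating \<open>e\<close> as an idempotent is absorbed by the modulus even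
    after division by \<open>d i\<close>.\<close>
  obtain e u v where e: "e \<in> carrier R" "u \<in> carrier R" "v \<in> carrier R"
    "e = (\<one> \<ominus> c) \<otimes> u" "\<one> \<ominus> e = c \<otimes> v"
    "\<And>i. i < l \<Longrightarrow> \<exists>z \<in> carrier R. e \<otimes> (\<one> \<ominus> e) = d i \<otimes> g \<otimes> z"
  proof (rule exists_approximate_idempotent[of c l h \<nu>])
    fix e u v
    assume *: "e \<in> carrier R" "u \<in> carrier R" "v \<in> carrier R"
      "e = (\<one> \<ominus> c) \<otimes> u" "\<one> \<ominus> e = c \<otimes> v"
      "\<And>i. i < l \<Longrightarrow> \<exists>z \<in> carrier R. e \<otimes> (\<one> \<ominus> e) = (c [^] \<nu> i \<otimes> h i) \<otimes> (c \<otimes> (\<one> \<ominus> c)) \<otimes> z"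
    show thesis by (rule that[OF *(1-5)]) (use *(6) nh(2) in \<open>simp add: g_def\<close>)
  qed (use c nh(1) in auto)
  have L_term: "\<exists>w \<in> carrier R. L i (c [^] j \<otimes> e) = d i \<otimes> ((if i = j then e else \<zero>) \<oplus> g \<otimes> w)"
    if i: "i < l" and j: "j < l" for i j
  proof -
    define x where "x = c [^] j"
    have x: "x \<in> carrier R" using c by (simp add: x_def)
    define V where "V = L i x"
    obtain y1 where y1: "y1 \<in> carrier R" "L i (e \<otimes> x) = e \<otimes> y1"
      using additive_poly_divides[OF sets(1) e(1) x] unfolding L_def by blast
    obtain y2 where y2: "y2 \<in> carrier R" "L i ((\<one> \<ominus> e) \<otimes> x) = (\<one> \<ominus> e) \<otimes> y2"
      using additive_poly_divides[OF sets(1), of "\<one> \<ominus> e" x] x e(1) unfolding L_def by auto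
    obtain z where z: "z \<in> carrier R" "e \<otimes> (\<one> \<ominus> e) = d i \<otimes> g \<otimes> z" using e(6)[OF i] by blast
    \<comment> \<open>For an idempotent \<open>e\<close>, the value \<open>L i (e x)\<close> would
      be \<open>e (L i x)\<close>. Splitting \<open>x\<close> into \<open>e x\<close> and
      \<open>(1 - e) x\<close> shows that the difference is a multiple of
      \<open>e (1 - e)\<close>.\<close>
    have "x = e \<otimes> x \<oplus> (\<one> \<ominus> e) \<otimes> x" using x e(1) by algebra
    then have "V = L i (e \<otimes> x \<oplus> (\<one> \<ominus> e) \<otimes> x)" by (simp add: V_def)
    also have "\<dots> = e \<otimes> y1 \<oplus> (\<one> \<ominus> e) \<otimes> y2"
      unfolding y1(2)[symmetric] y2(2)[symmetric] unfolding L_def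
      using sets x e(1) by (intro additive_poly_add) auto
    finally have V: "V = e \<otimes> y1 \<oplus> (\<one> \<ominus> e) \<otimes> y2" .
    have "L i (x \<otimes> e) = e \<otimes> y1" using y1(2) x e(1) by (simp add: m_comm)
    also have "\<dots> = e \<otimes> V \<oplus> (e \<otimes> (\<one> \<ominus> e)) \<otimes> (y1 \<ominus> y2)"
      unfolding V using e(1) y1(1) y2(1) by algebra
    finally have *: "L i (x \<otimes> e) = e \<otimes> V \<oplus> d i \<otimes> g \<otimes> z \<otimes> (y1 \<ominus> y2)" unfolding z(2) .
    have Vi: "V = (if i = j then d i else \<zero>)"
    proof (cases "i = j")
      case True
      then show ?thesis by (simp add: V_def x_def d_def)
    next
      case False
      then have "j \<in> set (js i)" using j by (auto simp: js_def)
      then have "x \<in> set (map (\<lambda>j. c [^] j) (js i))" by (auto simp: x_def)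
      then show ?thesis using False additive_poly_root[OF sets(1)] by (simp add: V_def L_def)
    qed
    have "L i (x \<otimes> e) = d i \<otimes> ((if i = j then e else \<zero>) \<oplus> g \<otimes> (z \<otimes> (y1 \<ominus> y2)))"
    proof (cases "i = j")
      case True
      have "e \<otimes> d i \<oplus> d i \<otimes> g \<otimes> z \<otimes> (y1 \<ominus> y2) = d i \<otimes> (e \<oplus> g \<otimes> (z \<otimes> (y1 \<ominus> y2)))"
        using dc[of i] g z(1) y1(1) y2(1) e(1) by algebra
      with True * Vi show ?thesis by simp
    next
      case False
      have "e \<otimes> \<zero> \<oplus> d i \<otimes> g \<otimes> z \<otimes> (y1 \<ominus> y2) = d i \<otimes> (\<zero> \<oplus> g \<otimes> (z \<otimes> (y1 \<ominus> y2)))"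
        using dc[of i] g z(1) y1(1) y2(1) e(1) by algebra
      with False * Vi show ?thesis by simp
    qed
    then show ?thesis using z y1 y2 unfolding x_def by blast
  qed
  \<comment> \<open>Additivity encodes a subset as a sum: the roots of \<open>L i\<close> remove
    every \<open>j\<close> other than \<open>i\<close>, up to multiples of
    \<open>d i g\<close>.\<close>
  define t where "t T = (\<Oplus>j\<in>T. c [^] j \<otimes> e)" for T :: "nat set"
  have tc: "t T \<in> carrier R" for T using c e by (auto simp: t_def)
  have L_sum: "\<exists>w \<in> carrier R. L i (t T) = d i \<otimes> ((if i \<in> T then e else \<zero>) \<oplus> g \<otimes> w)"
    if i: "i < l" and T: "T \<subseteq> {..<l}" for i T
  proof -
    have "finite T" using T finite_subset by blast
    then show ?thesis using T
    proof (induction T)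
      case empty
      have "L i (t {}) = d i \<otimes> (\<zero> \<oplus> g \<otimes> \<zero>)"
        using dc g sets(1)[of i] by (simp add: t_def L_def del: set_map)
      then show ?case by auto
    next
      case (insert j T)
      obtain w where w: "w \<in> carrier R" "L i (t T) = d i \<otimes> ((if i \<in> T then e else \<zero>) \<oplus> g \<otimes> w)"
        using insert by auto
      obtain w' where w': "w' \<in> carrier R" "L i (c [^] j \<otimes> e) = d i \<otimes> ((if i = j then e else \<zero>) \<oplus> g \<otimes> w')"
        using L_term[OF i, of j] insert.prems by auto
      have "t (insert j T) = c [^] j \<otimes> e \<oplus> t T"
        unfolding t_def using insert.hyps c e by (subst finsum_insert) auto
      then have "L i (t (insert j T)) = L i (c [^] j \<otimes> e) \<oplus> L i (t T)"
        unfolding L_def using sets c e tc by (simp add: additive_poly_add del: set_map)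
      also have "\<dots> = d i \<otimes> ((if i \<in> insert j T then e else \<zero>) \<oplus> g \<otimes> (w' \<oplus> w))"
      proof -
        define a b where "a = (if i = j then e else \<zero>)" and "b = (if i \<in> T then e else \<zero>)"
        have ab: "a \<in> carrier R" "b \<in> carrier R" using e by (auto simp: a_def b_def)
        have "a \<oplus> b = (if i \<in> insert j T then e else \<zero>)"
          using e(1) insert.hyps by (auto simp: a_def b_def)
        moreover have "d i \<otimes> (a \<oplus> g \<otimes> w') \<oplus> d i \<otimes> (b \<oplus> g \<otimes> w) = d i \<otimes> ((a \<oplus> b) \<oplus> g \<otimes> (w' \<oplus> w))"
          using dc[of i] g ab w(1) w'(1) by algebra
        ultimately show ?thesis unfolding w(2) w'(2) by (simp add: a_def b_def)
      qed
      finally show ?case using w w' by blast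
    qed
  qed
  \<comment> \<open>Moving the root \<open>c^i\<close> to the front writes the same
    \<open>A\<close>, for each \<open>i\<close>, as \<open>L i\<close> followed by a single step of
    the recursion.\<close>
  have A_L: "A x = L i x [^] p \<ominus> d i [^] (p - Suc 0) \<otimes> L i x" if i: "i < l" and x: "x \<in> carrier R" for i x
  proof -
    have "[0..<l] = [0..<i] @ i # [Suc i..<l]"
      using i upt_add_eq_append[of 0 i "l - i"] by (simp add: upt_conv_Cons)
    then have "A x = additive_poly (map (\<lambda>j. c [^] j) [0..<i] @ c [^] i # map (\<lambda>j. c [^] j) [Suc i..<l]) x"
      by (simp add: A_def)
    also have "\<dots> = additive_poly (c [^] i # map (\<lambda>j. c [^] j) [0..<i] @ map (\<lambda>j. c [^] j) [Suc i..<l]) x"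
      using c x by (intro additive_poly_move_front) auto
    finally show ?thesis by (simp add: L_def d_def js_def)
  qed
  \<comment> \<open>The step \<open>z^p - d i^(p-1) z\<close> at \<open>z = d i y\<close> takes out
    the factor \<open>d i^p\<close> and leaves the Artin-Schreier polynomial in
    \<open>y\<close>.\<close>
  have A_y: "A (t T) = d i [^] p \<otimes> (y [^] p \<ominus> y)"
    if i: "i < l" and y: "y \<in> carrier R" "L i (t T) = d i \<otimes> y" for i T y
  proof -
    have "A (t T) = (d i \<otimes> y) [^] p \<ominus> d i [^] (p - Suc 0) \<otimes> (d i \<otimes> y)" using A_L[OF i tc] y by simp
    also have "\<dots> = d i [^] p \<otimes> y [^] p \<ominus> d i [^] p \<otimes> y"
    proof -
      have "d i [^] (p - Suc 0) \<otimes> (d i \<otimes> y) = d i [^] p \<otimes> y"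
        using y dc[of i] m_comm[of "d i [^] (p - Suc 0)" "d i"]
        by (simp add: power_p m_assoc[symmetric])
      then show ?thesis using y dc[of i] by (simp add: nat_pow_distrib)
    qed
    also have "\<dots> = d i [^] p \<otimes> (y [^] p \<ominus> y)"
      using y(1) dc[of i] nat_pow_closed[OF dc[of i], of p] nat_pow_closed[OF y(1), of p] by algebra
    finally show ?thesis .
  qed
  have iff: "(\<exists>w \<in> carrier R. A (t T) = d i [^] p \<otimes> ((g \<otimes> w) [^] p \<ominus> g \<otimes> w)) \<longleftrightarrow> i \<notin> T"
    if i: "i < l" and T: "T \<subseteq> {..<l}" for i T
  proof -
    obtain w where w: "w \<in> carrier R" "L i (t T) = d i \<otimes> ((if i \<in> T then e else \<zero>) \<oplus> g \<otimes> w)"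
      using L_sum[OF i T] by blast
    define y where "y = (if i \<in> T then e else \<zero>) \<oplus> g \<otimes> w"
    have y: "y \<in> carrier R" using w g e by (simp add: y_def)
    have Ay: "A (t T) = d i [^] p \<otimes> (y [^] p \<ominus> y)" using A_y[OF i y] w(2) by (simp add: y_def)
    show ?thesis
    proof (cases "i \<in> T")
      case False
      then have "y = g \<otimes> w" using w g by (simp add: y_def)
      then show ?thesis using False Ay w(1) by blast
    next
      case True
      have False if z: "z \<in> carrier R" "A (t T) = d i [^] p \<otimes> ((g \<otimes> z) [^] p \<ominus> g \<otimes> z)" for z
      proof -
        \<comment> \<open>By additivity of Frobenius \<open>d i^p (r^p - r) = 0\<close>. As
          \<open>d i\<close> is outside the prime \<open>P\<close>, the scaling cancels modulo
          \<open>P\<close>, and \<open>r\<close> or \<open>r^(p-1) - 1\<close> lies in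
          \<open>P\<close>.\<close>
        define r where "r = g \<otimes> z \<ominus> y"
        have r: "r \<in> carrier R" using z g y by (simp add: r_def)
        have "d i [^] p \<otimes> (r [^] p \<ominus> r) = d i [^] p \<otimes> ((g \<otimes> z) [^] p \<ominus> g \<otimes> z) \<ominus> d i [^] p \<otimes> (y [^] p \<ominus> y)"
        proof -
          have "a \<otimes> ((b \<ominus> b') \<ominus> (f \<ominus> f')) = a \<otimes> (b \<ominus> f) \<ominus> a \<otimes> (b' \<ominus> f')"
            if "a \<in> carrier R" "b \<in> carrier R" "b' \<in> carrier R" "f \<in> carrier R" "f' \<in> carrier R" for a b b' f f'
            using that by algebra
          then show ?thesis unfolding r_def using z g y dc[of i] by (simp add: frobenius_minus)
        qed
        also have "\<dots> = \<zero>" using z(2) Ay y dc[of i] by (metis a_minus_def minus_closed nat_pow_closed m_closed r_neg)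
        finally have "d i [^] p \<otimes> (r [^] p \<ominus> r) \<in> P" by simp
        moreover have "d i [^] (k::nat) \<notin> P" for k
        proof (induction k)
          case 0
          then show ?case using m(2) sub by auto
        next
          case (Suc k)
          then show ?case using P.I_prime[of "d i [^] k" "d i"] dc[of i] dP[OF i] by auto
        qed
        ultimately have "r [^] p \<ominus> r \<in> P" using P.I_prime[of "d i [^] p" "r [^] p \<ominus> r"] dc r by auto
        moreover have "r [^] p \<ominus> r = r \<otimes> (r [^] (p - Suc 0) \<ominus> \<one>)"
          using r nat_pow_closed[OF r, of "p - Suc 0"] unfolding power_p[OF r] by algebra
        ultimately have "r \<in> P \<or> r [^] (p - Suc 0) \<ominus> \<one> \<in> P"
          using P.I_prime[of r "r [^] (p - Suc 0) \<ominus> \<one>"] r by auto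
        then show False
        proof
          assume "r \<in> P"
          \<comment> \<open>Modulo \<open>c\<close> this reads \<open>r = -1\<close>, so
            \<open>r\<close> cannot lie in \<open>m\<close>.\<close>
          have r_eq: "r = c \<otimes> ((\<one> \<ominus> c) \<otimes> z \<ominus> (\<one> \<ominus> c) \<otimes> w \<oplus> v) \<ominus> \<one>"
          proof -
            have "r = c \<otimes> ((\<one> \<ominus> c) \<otimes> z \<ominus> (\<one> \<ominus> c) \<otimes> w) \<oplus> (\<one> \<ominus> e) \<ominus> \<one>"
              using True c z(1) w(1) e(1) by (simp add: r_def y_def g_def) algebra
            also have "\<dots> = c \<otimes> ((\<one> \<ominus> c) \<otimes> z \<ominus> (\<one> \<ominus> c) \<otimes> w \<oplus> v) \<ominus> \<one>"
              unfolding e(5) using c z(1) w(1) e(3) by algebra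
            finally show ?thesis .
          qed
          have "\<one> = c \<otimes> ((\<one> \<ominus> c) \<otimes> z \<ominus> (\<one> \<ominus> c) \<otimes> w \<oplus> v) \<ominus> r" (is "_ = c \<otimes> ?x \<ominus> _")
          proof -
            have "c \<otimes> x \<ominus> (c \<otimes> x \<ominus> \<one>) = \<one>" if "x \<in> carrier R" for x using that c by algebra
            moreover have "?x \<in> carrier R" using c z(1) w(1) e(3) by simp
            ultimately show ?thesis using r_eq by metis
          qed
          also have "\<dots> \<in> m"
            unfolding minus_eq[of "c \<otimes> ?x"]
            using c z(1) w(1) e(3) cm(1) \<open>r \<in> P\<close> sub by (intro m.a_closed m.I_r_closed m.a_inv_closed) auto
          finally show False using m by simp
        next
          assume rP: "r [^] (p - Suc 0) \<ominus> \<one> \<in> P"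
          \<comment> \<open>As a multiple of \<open>1 - c\<close>, the element \<open>r\<close> lies
            in \<open>n\<close>. Since \<open>p - 1\<close> is positive, \<open>r^(p-1)\<close> lies
            in \<open>n\<close> too and cannot be 1 modulo \<open>P\<close>.\<close>
          have "r = (\<one> \<ominus> c) \<otimes> (c \<otimes> z \<ominus> u \<ominus> c \<otimes> w)"
          proof -
            have "r = (\<one> \<ominus> c) \<otimes> (c \<otimes> z \<ominus> c \<otimes> w) \<ominus> e"
              using True c z(1) w(1) e(1) by (simp add: r_def y_def g_def) algebra
            also have "\<dots> = (\<one> \<ominus> c) \<otimes> (c \<otimes> z \<ominus> u \<ominus> c \<otimes> w)"
              unfolding e(4) using c z(1) w(1) e(2) by algebra
            finally show ?thesis .
          qed
          also have "\<dots> \<in> n" using cm(2) c z w e by (intro n.I_r_closed) auto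
          finally have rn: "r \<in> n" .
          have "r [^] (p - Suc 0) = r \<otimes> r [^] (p - 2)"
            using r p_pos nat_pow_Suc2[OF r, of "p - 2"] by (simp add: numeral_2_eq_2 Suc_diff_Suc)
          then have "r [^] (p - Suc 0) \<in> n" using rn r by (simp add: n.I_r_closed)
          then have "r [^] (p - Suc 0) \<ominus> (r [^] (p - Suc 0) \<ominus> \<one>) \<in> n"
            unfolding minus_eq[of "r [^] (p - Suc 0)" "r [^] (p - Suc 0) \<ominus> \<one>"]
            using rP sub by (intro n.a_closed n.a_inv_closed) auto
          moreover have "r [^] (p - Suc 0) \<ominus> (r [^] (p - Suc 0) \<ominus> \<one>) = \<one>"
            using nat_pow_closed[OF r, of "p - Suc 0"] by algebra
          ultimately show False using n by simp
        qed
      qed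
      then show ?thesis using True by blast
    qed
  qed
  \<comment> \<open>A positive answer means that \<open>i\<close> is not in \<open>T\<close>, hence
    the passage to complements.\<close>
  have "\<exists>d b. (\<forall>i < l. d i \<in> carrier R) \<and> (\<forall>T \<subseteq> {..<l}. b T \<in> carrier R \<times> carrier R) \<and>
    (\<forall>i < l. \<forall>T \<subseteq> {..<l}. (case b T of (x, g) \<Rightarrow> \<exists>w \<in> carrier R. x = (d i) [^] p \<otimes> ((g \<otimes> w) [^] p \<ominus> g \<otimes> w)) \<longleftrightarrow> i \<in> T)"
    using iff[OF _ Diff_subset] dc Ac[OF tc] g
    by (intro exI[of _ d] exI[of _ "\<lambda>T. (A (t ({..<l} - T)), g)"]) auto
  with l show False by blast
qed

section \<open>Idempotents isolating the maximal ideals\<close>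

lemma (in cring) exists_comaximal_to_finite:
  assumes m: "maximalideal m R" and "finite N" and "\<And>n. n \<in> N \<Longrightarrow> maximalideal n R \<and> n \<noteq> m"
  shows "\<exists>c \<in> m. \<forall>n \<in> N. \<one> \<ominus> c \<in> n"
  using assms(2,3)
proof (induction N)
  case empty
  interpret m: maximalideal m R by fact
  show ?case using m.zero_closed by blast
next
  case (insert n N)
  interpret m: maximalideal m R by fact
  interpret n: maximalideal n R using insert.prems by simp
  obtain c where c: "c \<in> m" "\<And>n. n \<in> N \<Longrightarrow> \<one> \<ominus> c \<in> n" using insert by auto
  obtain a where a: "a \<in> m" "\<one> \<ominus> a \<in> n"
    using maximalideals_comaximal[OF m, of n] insert.prems by auto
  have cl: "a \<in> carrier R" "c \<in> carrier R" using a c m.a_Hcarr by auto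
  \<comment> \<open>Chosen so that \<open>1 - d = (1 - a) (1 - c)\<close>.\<close>
  define d where "d = c \<oplus> a \<otimes> (\<one> \<ominus> c)"
  have "d \<in> m" unfolding d_def using a c cl by (auto intro!: m.a_closed m.I_r_closed)
  moreover have d: "\<one> \<ominus> d = (\<one> \<ominus> a) \<otimes> (\<one> \<ominus> c)" unfolding d_def using cl by algebra
  moreover have "(\<one> \<ominus> a) \<otimes> (\<one> \<ominus> c) \<in> n" using a cl by (auto intro: n.I_r_closed)
  moreover have "(\<one> \<ominus> a) \<otimes> (\<one> \<ominus> c) \<in> k" if k: "k \<in> N" for k
  proof -
    interpret k: maximalideal k R using k insert.prems by simp
    show ?thesis using c(2)[OF k] cl by (auto intro: k.I_l_closed)
  qed
  ultimately show ?case by (intro bexI[of _ d]) auto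
qed

text \<open>Among \<open>n\<close> distinct maximal ideals take \<open>c i\<close> in the
  \<open>i\<close>-th and congruent to 1 modulo the others. The product of these elements over
  \<open>T\<close> is divisible by \<open>c i\<close> for \<open>i\<close> in \<open>T\<close> and
  lies outside the \<open>i\<close>-th ideal otherwise, so divisibility would shatter
  \<open>n\<close> points for every \<open>n\<close>.\<close>

lemma (in tame_cring) finite_maximalideals: "finite {m. maximalideal m R}"
proof (rule ccontr)
  assume inf: "infinite {m. maximalideal m R}"
  from infinite_countable_subset[OF inf] obtain M :: "nat \<Rightarrow> 'a set"
    where M: "inj M" "\<And>i. maximalideal (M i) R" by auto
  obtain n :: nat where n: "\<not> (\<exists>(d :: nat \<Rightarrow> 'a) b. (\<forall>i < n. d i \<in> carrier R) \<and> (\<forall>T \<subseteq> {..<n}. b T \<in> carrier R) \<and>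
    (\<forall>i < n. \<forall>T \<subseteq> {..<n}. (\<exists>w \<in> carrier R. b T = d i \<otimes> w) \<longleftrightarrow> i \<in> T))"
    using tame_dvd unfolding no_shatter_def by (elim exE)
  have "\<forall>i. \<exists>c. c \<in> M i \<and> (\<forall>n \<in> M ` ({..<n} - {i}). \<one> \<ominus> c \<in> n)"
  proof
    fix i
    have "\<exists>c \<in> M i. \<forall>n \<in> M ` ({..<n} - {i}). \<one> \<ominus> c \<in> n"
      by (rule exists_comaximal_to_finite) (use M in \<open>auto simp: inj_def\<close>)
    then show "\<exists>c. c \<in> M i \<and> (\<forall>n \<in> M ` ({..<n} - {i}). \<one> \<ominus> c \<in> n)" by blast
  qed
  from choice[OF this] obtain c where c: "\<And>i. c i \<in> M i"
    "\<And>i j. j < n \<Longrightarrow> j \<noteq> i \<Longrightarrow> \<one> \<ominus> c i \<in> M j" by blast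
  have cc: "c i \<in> carrier R" for i
    using c(1)[of i] maximalideal.axioms(1)[OF M(2)] ideal.axioms(1) additive_subgroup.a_Hcarr by metis
  have cnot: "c i \<notin> M j" if "j < n" "j \<noteq> i" for i j
  proof
    interpret M: maximalideal "M j" R by (rule M(2))
    assume "c i \<in> M j"
    then have "c i \<oplus> (\<one> \<ominus> c i) \<in> M j" using c(2) that M.a_closed by blast
    moreover have "c i \<oplus> (\<one> \<ominus> c i) = \<one>" using cc[of i] by algebra
    ultimately show False using M.one_notin by simp
  qed
  define b where "b T = (\<Otimes>i\<in>T. c i)" for T :: "nat set"
  have bc: "b T \<in> carrier R" for T using cc by (auto simp: b_def)
  have b1: "\<exists>w \<in> carrier R. b T = c i \<otimes> w" if "T \<subseteq> {..<n}" "i \<in> T" for i T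
  proof -
    have "b (insert i (T - {i})) = c i \<otimes> b (T - {i})"
      unfolding b_def using finite_subset[OF that(1)] cc by (subst finprod_insert) auto
    then show ?thesis using that bc by (metis insert_Diff)
  qed
  have b2: "b T \<notin> M i" if "finite T" "i < n" "i \<notin> T" for i T
    using that(1,3)
  proof (induction T)
    case empty
    then show ?case using maximalideal.one_notin[OF M(2)] by (simp add: b_def)
  next
    case (insert j T)
    have "b (insert j T) = c j \<otimes> b T"
      unfolding b_def using insert.hyps cc by (subst finprod_insert) auto
    moreover have "c j \<notin> M i" "b T \<notin> M i" using cnot[of i j] insert that(2) by auto
    ultimately show ?case using maximalideal.prime[OF M(2)[of i] is_cring cc[of j] bc[of T]] by metis
  qed
  have "(\<exists>w \<in> carrier R. b T = c i \<otimes> w) \<longleftrightarrow> i \<in> T" if "i < n" "T \<subseteq> {..<n}" for i T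
  proof
    assume "\<exists>w \<in> carrier R. b T = c i \<otimes> w"
    then obtain w where "w \<in> carrier R" "b T = c i \<otimes> w" by blast
    then have "b T \<in> M i"
      using c(1)[of i] ideal.I_r_closed[OF maximalideal.axioms(1)[OF M(2)]] by metis
    then show "i \<in> T" using b2[of T i] that finite_subset[OF that(2)] by auto
  qed (use b1 that in blast)
  then have "\<exists>(d :: nat \<Rightarrow> 'a) b. (\<forall>i < n. d i \<in> carrier R) \<and> (\<forall>T \<subseteq> {..<n}. b T \<in> carrier R) \<and>
    (\<forall>i < n. \<forall>T \<subseteq> {..<n}. (\<exists>w \<in> carrier R. b T = d i \<otimes> w) \<longleftrightarrow> i \<in> T)"
    by (intro exI[of _ c] exI[of _ b] conjI allI impI cc bc) simp
  with n show False by contradiction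
qed

text \<open>If no such pair exists, the products \<open>u v\<close> form a multiplicatively closed
  set without 0. A prime avoiding it lies below \<open>m\<close> and below \<open>n\<close>, as seen
  by taking \<open>v\<close> or \<open>u\<close> to be 1.\<close>

lemma (in tame_cring) maximalideals_separated:
  assumes m: "maximalideal m R" and n: "maximalideal n R" and "m \<noteq> n"
  obtains u v where "u \<in> carrier R" "v \<in> carrier R" "u \<notin> m" "v \<notin> n" "u \<otimes> v = \<zero>"
proof (rule ccontr)
  assume no: "\<not> thesis"
  interpret m: maximalideal m R by fact
  interpret n: maximalideal n R by fact
  define S where "S = {u \<otimes> v | u v. u \<in> carrier R \<and> v \<in> carrier R \<and> u \<notin> m \<and> v \<notin> n}"
  have SI: "u \<otimes> v \<in> S" if "u \<in> carrier R" "v \<in> carrier R" "u \<notin> m" "v \<notin> n" for u v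
    unfolding S_def by (intro CollectI exI[of _ u] exI[of _ v] conjI refl that)
  have "primeideal P R \<Longrightarrow> P \<inter> S = {} \<Longrightarrow> False" for P
  proof -
    assume P: "primeideal P R" and PS: "P \<inter> S = {}"
    interpret P: primeideal P R by fact
    have 1: "x \<in> m" if "x \<in> P" for x
    proof (rule ccontr)
      assume "x \<notin> m"
      then have "x \<otimes> \<one> \<in> S" using n.one_notin P.a_Hcarr[OF that] by (intro SI) auto
      then show False using PS that P.a_Hcarr by auto
    qed
    have 2: "x \<in> n" if "x \<in> P" for x
    proof (rule ccontr)
      assume "x \<notin> n"
      then have "\<one> \<otimes> x \<in> S" using m.one_notin P.a_Hcarr[OF that] by (intro SI) auto
      then show False using PS that P.a_Hcarr by auto
    qed
    obtain c where "c \<in> m" "\<one> \<ominus> c \<in> n" by (rule maximalideals_comaximal[OF assms])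
    then show False
      using no_prime_below_comaximal[OF P m.is_ideal m.one_notin n.is_ideal n.one_notin subsetI subsetI] 1 2
      by simp
  qed
  moreover have "\<exists>P. primeideal P R \<and> P \<inter> S = {}"
  proof (rule exists_primeideal_avoiding[of S])
    show "\<zero> \<notin> S"
    proof
      assume "\<zero> \<in> S"
      then obtain u v where "u \<in> carrier R" "v \<in> carrier R" "u \<notin> m" "v \<notin> n" "u \<otimes> v = \<zero>"
        unfolding S_def by auto
      then have thesis by (rule that)
      with no show False ..
    qed
    show "\<one> \<in> S" using SI[OF one_closed one_closed m.one_notin n.one_notin] by simp
    show "S \<subseteq> carrier R" unfolding S_def by auto
    fix x y assume "x \<in> S" "y \<in> S"
    from \<open>x \<in> S\<close> obtain u v where uv: "u \<in> carrier R" "v \<in> carrier R" "u \<notin> m" "v \<notin> n" "x = u \<otimes> v"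
      unfolding S_def by auto
    from \<open>y \<in> S\<close> obtain u' v' where uv': "u' \<in> carrier R" "v' \<in> carrier R" "u' \<notin> m" "v' \<notin> n" "y = u' \<otimes> v'"
      unfolding S_def by auto
    have "x \<otimes> y = (u \<otimes> u') \<otimes> (v \<otimes> v')" using uv uv' by (simp add: m_assoc m_comm m_lcomm)
    moreover have "u \<otimes> u' \<notin> m" "v \<otimes> v' \<notin> n"
      using uv(1-4) uv'(1-4) m.prime[OF is_cring, of u u'] n.prime[OF is_cring, of v v'] by auto
    ultimately show "x \<otimes> y \<in> S" using uv(1-4) uv'(1-4) SI[of "u \<otimes> u'" "v \<otimes> v'"] by simp
  next
    fix P assume "primeideal P R" "P \<inter> S = {}"
    then show ?thesis by (intro exI conjI)
  qed
  ultimately show False by blast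
qed

text \<open>A product \<open>u\<close> of separating elements lies outside \<open>m\<close>, and its
  annihilator lies in no other maximal ideal. So the annihilator and \<open>u\<close> generate the
  ring; in \<open>1 = s + u r\<close> with \<open>u s = 0\<close> the summand \<open>u r\<close> is
  the idempotent.\<close>

lemma (in tame_cring) maximal_idempotent:
  assumes m: "maximalideal m R"
  obtains e where "e \<in> carrier R" "e \<otimes> e = e" "e \<notin> m" "\<And>n. maximalideal n R \<Longrightarrow> n \<noteq> m \<Longrightarrow> e \<in> n"
proof -
  interpret m: maximalideal m R by fact
  have ex: "\<exists>u \<in> carrier R. u \<notin> m \<and> (\<forall>n \<in> N. \<exists>v \<in> carrier R. v \<notin> n \<and> u \<otimes> v = \<zero>)"
    if "finite N" "\<And>n. n \<in> N \<Longrightarrow> maximalideal n R \<and> n \<noteq> m" for N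
    using that
  proof (induction N)
    case empty
    then show ?case using m.one_notin by blast
  next
    case (insert n N)
    obtain u where u: "u \<in> carrier R" "u \<notin> m" "\<forall>n \<in> N. \<exists>v \<in> carrier R. v \<notin> n \<and> u \<otimes> v = \<zero>"
      using insert by auto
    obtain u' v' where u': "u' \<in> carrier R" "v' \<in> carrier R" "u' \<notin> m" "v' \<notin> n" "u' \<otimes> v' = \<zero>"
      using maximalideals_separated[OF m, of n] insert.prems by auto
    have "\<exists>v \<in> carrier R. v \<notin> k \<and> (u \<otimes> u') \<otimes> v = \<zero>" if k: "k \<in> insert n N" for k
    proof (cases "k = n")
      case True
      have "(u \<otimes> u') \<otimes> v' = \<zero>" using u u' by (simp add: m_assoc)
      then show ?thesis using True u' by blast
    next
      case False
      then obtain v where "v \<in> carrier R" "v \<notin> k" "u \<otimes> v = \<zero>" using u k by auto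
      moreover have "(u \<otimes> u') \<otimes> v = (u \<otimes> v) \<otimes> u'"
        using u u' \<open>v \<in> carrier R\<close> by (simp add: m_assoc m_comm m_lcomm)
      ultimately show ?thesis using u' by auto
    qed
    moreover have "u \<otimes> u' \<notin> m" using m.prime[OF is_cring, of u u'] u u' by blast
    ultimately show ?case using u u' by blast
  qed
  \<comment> \<open>Finiteness of the set of maximal ideals enters here: one \<open>u\<close> serves
    for all \<open>n\<close>.\<close>
  have "\<exists>u \<in> carrier R. u \<notin> m \<and> (\<forall>n \<in> {n. maximalideal n R} - {m}. \<exists>v \<in> carrier R. v \<notin> n \<and> u \<otimes> v = \<zero>)"
    by (rule ex) (use finite_maximalideals in simp_all)
  then obtain u where u: "u \<in> carrier R" "u \<notin> m"
    and u0: "\<forall>n \<in> {n. maximalideal n R} - {m}. \<exists>v \<in> carrier R. v \<notin> n \<and> u \<otimes> v = \<zero>" by (elim bexE conjE)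
  have uv: "\<exists>v \<in> carrier R. v \<notin> n \<and> u \<otimes> v = \<zero>" if "maximalideal n R" "n \<noteq> m" for n
    using bspec[OF u0, of n] that by simp
  have un: "u \<in> n" if n: "maximalideal n R" "n \<noteq> m" for n
  proof -
    interpret n: maximalideal n R by fact
    obtain v where "v \<in> carrier R" "v \<notin> n" "u \<otimes> v = \<zero>" using uv[OF n] by blast
    then show ?thesis using n.prime[OF is_cring, of u v] u n.zero_closed by auto
  qed
  define Ann where "Ann = {s \<in> carrier R. u \<otimes> s = \<zero>}"
  have Ann: "ideal Ann R"
  proof (rule idealI[OF ring_axioms])
    show "subgroup Ann (add_monoid R)"
      by (rule add.subgroupI) (use u(1) in \<open>auto simp: Ann_def r_distr r_minus a_inv_def[symmetric]\<close>)
  next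
    fix a x assume ax: "a \<in> Ann" "x \<in> carrier R"
    have ua: "a \<in> carrier R" "u \<otimes> a = \<zero>" using ax by (simp_all add: Ann_def)
    have "u \<otimes> (a \<otimes> x) = (u \<otimes> a) \<otimes> x" by (rule m_assoc[symmetric]) (use ua ax u in auto)
    also have "\<dots> = \<zero>" unfolding ua using ax by simp
    finally show "a \<otimes> x \<in> Ann" using ax by (simp add: Ann_def)
    then show "x \<otimes> a \<in> Ann" using ax m_comm[of a x] by (simp add: Ann_def)
  qed
  let ?J = "{i \<oplus> u \<otimes> x | i x. i \<in> Ann \<and> x \<in> carrier R}"
  have "\<one> \<in> ?J"
  proof (rule ccontr)
    assume "\<one> \<notin> ?J"
    from exists_maximalideal_containing[OF add_cgenideal[OF Ann u(1)] this]
    obtain n where n: "maximalideal n R" "?J \<subseteq> n" by blast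
    then have "u \<in> n" using subset_add_cgenideal(2)[OF Ann u(1)] by blast
    then have "n \<noteq> m" using u(2) by blast
    with uv[OF n(1)] obtain v where "v \<in> Ann" "v \<notin> n" unfolding Ann_def by blast
    then show False using subset_add_cgenideal(1)[OF Ann u(1)] n by blast
  qed
  then obtain s r where sr: "\<one> = s \<oplus> u \<otimes> r" "s \<in> carrier R" "u \<otimes> s = \<zero>" "r \<in> carrier R"
    unfolding Ann_def by blast
  show thesis
  proof (rule that)
    show "u \<otimes> r \<in> carrier R" using u sr by simp
    have "u \<otimes> r = (s \<oplus> u \<otimes> r) \<otimes> (u \<otimes> r)" unfolding sr(1)[symmetric] using u(1) sr(4) by simp
    also have "\<dots> = (u \<otimes> s) \<otimes> r \<oplus> (u \<otimes> r) \<otimes> (u \<otimes> r)"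
      using u(1) sr(2,4) by algebra
    finally show "(u \<otimes> r) \<otimes> (u \<otimes> r) = u \<otimes> r" using sr u by simp
    \<comment> \<open>Since \<open>u\<close> is outside the prime ideal \<open>m\<close>, the
      equation \<open>u s = 0\<close> puts \<open>s\<close> into \<open>m\<close>, and
      \<open>u r = 1 - s\<close> stays outside.\<close>
    have "s \<in> m" using m.prime[OF is_cring u(1) sr(2)] u(2) sr(3) m.zero_closed by simp
    then show "u \<otimes> r \<notin> m" using m.one_notin m.a_closed sr(1) by metis
    show "u \<otimes> r \<in> n" if "maximalideal n R" "n \<noteq> m" for n
      using un[OF that] ideal.I_r_closed[OF maximalideal.axioms(1)[OF that(1)]] sr by blast
  qed
qed

section \<open>Definability and rings coded by tuples\<close>

text \<open>The even variables carry the assignment, the odd ones the parameters.\<close>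

definition with_params :: "(nat \<Rightarrow> 'a) \<Rightarrow> (nat \<Rightarrow> 'a) \<Rightarrow> nat \<Rightarrow> 'a" where
  "with_params h e = (\<lambda>k. if even k then e (k div 2) else h (k div 2))"

lemma with_params_upd: "(with_params h e)(2 * v := a) = with_params h (e(v := a))"
  by (auto simp: with_params_def fun_eq_iff)

lemma with_params_override:
  "override_on (with_params h e) (with_params h e') ((\<lambda>v. 2 * v) ` V) = with_params h (override_on e e' V)"
  by (auto simp: with_params_def fun_eq_iff override_on_def)

lemma range_with_params: "range h \<subseteq> A \<Longrightarrow> range e \<subseteq> A \<Longrightarrow> range (with_params h e) \<subseteq> A"
  by (auto simp: with_params_def)

locale definability = cring R for R (structure) +
  fixes h :: "nat \<Rightarrow> 'a"
  assumes h_closed: "range h \<subseteq> carrier R"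
begin

text \<open>Definability with parameters \<open>h\<close> is a property of functions and predicates
  on assignments; closure rules then replace the explicit writing of formulas.\<close>

definition definable_term :: "((nat \<Rightarrow> 'a) \<Rightarrow> 'a) \<Rightarrow> bool" where
  "definable_term t \<longleftrightarrow> (\<exists>\<tau>. \<forall>e. range e \<subseteq> carrier R \<longrightarrow> tval R (with_params h e) \<tau> = t e)"

definition definable :: "((nat \<Rightarrow> 'a) \<Rightarrow> bool) \<Rightarrow> bool" where
  "definable Q \<longleftrightarrow> (\<exists>\<phi>. \<forall>e. range e \<subseteq> carrier R \<longrightarrow> (sat R (with_params h e) \<phi> \<longleftrightarrow> Q e))"

lemma tval_closed: "range e \<subseteq> carrier R \<Longrightarrow> tval R e \<tau> \<in> carrier R"
  by (induction \<tau>) auto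

lemma definable_term_closed:
  "definable_term t \<Longrightarrow> range e \<subseteq> carrier R \<Longrightarrow> t e \<in> carrier R"
  unfolding definable_term_def using tval_closed[OF range_with_params[OF h_closed]] by metis

lemma definable_term_var: "definable_term (\<lambda>e. e v)"
  unfolding definable_term_def by (intro exI[of _ "TVar (2 * v)"]) (simp add: with_params_def)

lemma definable_term_param: "definable_term (\<lambda>e. h v)"
  unfolding definable_term_def by (intro exI[of _ "TVar (2 * v + 1)"]) (simp add: with_params_def)

lemma definable_term_zero: "definable_term (\<lambda>e. \<zero>)"
  unfolding definable_term_def by (intro exI[of _ TZero]) simp

lemma definable_term_add:
  assumes "definable_term s" "definable_term t"
  shows "definable_term (\<lambda>e. s e \<oplus> t e)"
proof -
  obtain \<sigma> \<tau> where "\<forall>e. range e \<subseteq> carrier R \<longrightarrow> tval R (with_params h e) \<sigma> = s e"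
    "\<forall>e. range e \<subseteq> carrier R \<longrightarrow> tval R (with_params h e) \<tau> = t e"
    using assms unfolding definable_term_def by blast
  then show ?thesis unfolding definable_term_def by (intro exI[of _ "TAdd \<sigma> \<tau>"]) simp
qed

lemma definable_term_mult:
  assumes "definable_term s" "definable_term t"
  shows "definable_term (\<lambda>e. s e \<otimes> t e)"
proof -
  obtain \<sigma> \<tau> where "\<forall>e. range e \<subseteq> carrier R \<longrightarrow> tval R (with_params h e) \<sigma> = s e"
    "\<forall>e. range e \<subseteq> carrier R \<longrightarrow> tval R (with_params h e) \<tau> = t e"
    using assms unfolding definable_term_def by blast
  then show ?thesis unfolding definable_term_def by (intro exI[of _ "TMult \<sigma> \<tau>"]) simp
qed

lemma definable_term_uminus:
  assumes "definable_term s"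
  shows "definable_term (\<lambda>e. \<ominus> s e)"
proof -
  obtain \<sigma> where "\<forall>e. range e \<subseteq> carrier R \<longrightarrow> tval R (with_params h e) \<sigma> = s e"
    using assms unfolding definable_term_def by blast
  then show ?thesis unfolding definable_term_def by (intro exI[of _ "TNeg \<sigma>"]) simp
qed

lemma definable_term_cong:
  assumes "definable_term s" "\<And>e. range e \<subseteq> carrier R \<Longrightarrow> s e = t e"
  shows "definable_term t"
  using assms unfolding definable_term_def by auto

lemma definable_cong:
  assumes "definable P" "\<And>e. range e \<subseteq> carrier R \<Longrightarrow> P e \<longleftrightarrow> Q e"
  shows "definable Q"
  using assms unfolding definable_def by auto

lemma definable_term_sum:
  fixes n :: nat
  assumes t: "\<And>i. definable_term (t i)"
  shows "definable_term (\<lambda>e. \<Oplus>i\<in>{..<n}. t i e)"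
proof (induction n)
  case 0
  then show ?case by (simp add: definable_term_zero)
next
  case (Suc n)
  show ?case
    by (rule definable_term_cong[OF definable_term_add[OF t[of n] Suc]])
      (simp add: lessThan_Suc definable_term_closed[OF t] finsum_insert)
qed

lemma definable_eq:
  assumes "definable_term s" "definable_term t"
  shows "definable (\<lambda>e. s e = t e)"
proof -
  obtain \<sigma> \<tau> where "\<forall>e. range e \<subseteq> carrier R \<longrightarrow> tval R (with_params h e) \<sigma> = s e"
    "\<forall>e. range e \<subseteq> carrier R \<longrightarrow> tval R (with_params h e) \<tau> = t e"
    using assms unfolding definable_term_def by blast
  then show ?thesis unfolding definable_def by (intro exI[of _ "FEq \<sigma> \<tau>"]) simp
qed

lemma definable_conj:
  assumes "definable P" "definable Q"
  shows "definable (\<lambda>e. P e \<and> Q e)"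
proof -
  obtain \<sigma> \<tau> where "\<forall>e. range e \<subseteq> carrier R \<longrightarrow> (sat R (with_params h e) \<sigma> \<longleftrightarrow> P e)"
    "\<forall>e. range e \<subseteq> carrier R \<longrightarrow> (sat R (with_params h e) \<tau> \<longleftrightarrow> Q e)"
    using assms unfolding definable_def by blast
  then show ?thesis unfolding definable_def by (intro exI[of _ "FAnd \<sigma> \<tau>"]) simp
qed

lemma definable_all_less:
  fixes n :: nat
  assumes "\<And>i. definable (Q i)"
  shows "definable (\<lambda>e. \<forall>i<n. Q i e)"
proof (induction n)
  case 0
  then show ?case using definable_eq[OF definable_term_zero definable_term_zero] by simp
next
  case (Suc n)
  show ?case
    by (rule definable_cong[OF definable_conj[OF Suc assms[of n]]]) (auto simp: less_Suc_eq)
qed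

lemma definable_ex:
  assumes "definable Q"
  shows "definable (\<lambda>e. \<exists>a \<in> carrier R. Q (e(v := a)))"
proof -
  obtain \<phi> where \<phi>: "\<forall>e. range e \<subseteq> carrier R \<longrightarrow> (sat R (with_params h e) \<phi> \<longleftrightarrow> Q e)"
    using assms unfolding definable_def by blast
  have "range (e(v := a)) \<subseteq> carrier R" if "range e \<subseteq> carrier R" "a \<in> carrier R" for e a
    using that by (auto simp: fun_upd_def)
  with \<phi> show ?thesis
    unfolding definable_def by (intro exI[of _ "FEx (2 * v) \<phi>"]) (simp add: with_params_upd)
qed

text \<open>An element coded by a tuple is quantified by a block of variables, which is handled one
  variable at a time.\<close>

lemma definable_ex_set:
  assumes "finite W" "definable Q"
  shows "definable (\<lambda>e. \<exists>u. range u \<subseteq> carrier R \<and> Q (override_on e u W))"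
  using assms(1)
proof (induction W)
  case empty
  have "range (\<lambda>_. \<zero>) \<subseteq> carrier R" by auto
  then show ?case by (intro definable_cong[OF assms(2)]) (auto simp: override_on_def)
next
  case (insert v W)
  show ?case
  proof (rule definable_cong[OF definable_ex[OF insert.IH, of v]])
    fix e :: "nat \<Rightarrow> 'a" assume e: "range e \<subseteq> carrier R"
    show "(\<exists>a\<in>carrier R. \<exists>u. range u \<subseteq> carrier R \<and> Q (override_on (e(v := a)) u W)) \<longleftrightarrow>
      (\<exists>u. range u \<subseteq> carrier R \<and> Q (override_on e u (insert v W)))" (is "?L \<longleftrightarrow> ?R")
    proof
      assume ?L
      then obtain a u where a: "a \<in> carrier R" "range u \<subseteq> carrier R" "Q (override_on (e(v := a)) u W)" by blast
      have "override_on (e(v := a)) u W = override_on e (u(v := a)) (insert v W)"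
        using insert.hyps by (auto simp: override_on_def fun_eq_iff)
      moreover have "range (u(v := a)) \<subseteq> carrier R" using a by (auto simp: fun_upd_def)
      ultimately show ?R using a by (intro exI[of _ "u(v := a)"]) auto
    next
      assume ?R
      then obtain u where u: "range u \<subseteq> carrier R" "Q (override_on e u (insert v W))" by blast
      have "override_on (e(v := u v)) u W = override_on e u (insert v W)"
        using insert.hyps by (auto simp: override_on_def fun_eq_iff)
      then show ?L using u by (intro bexI[of _ "u v"] exI[of _ u]) auto
    qed
  qed
qed

text \<open>The formula itself has no parameters: their values sit at odd variables, which lie
  outside the doubled set \<open>V\<close> and so belong to the tuple \<open>b\<close>. The bound
  \<open>n\<close> holds for all models of the complete theory, in particular for
  \<open>R\<close>.\<close>

lemma definable_not_shattered:
  assumes "NIP_ring R" "definable Q"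
  shows "\<exists>n :: nat. \<forall>(a :: nat \<Rightarrow> nat \<Rightarrow> 'a) (b :: nat set \<Rightarrow> nat \<Rightarrow> 'a).
    (\<forall>i. range (a i) \<subseteq> carrier R) \<longrightarrow> (\<forall>T. range (b T) \<subseteq> carrier R) \<longrightarrow>
    \<not> (\<forall>i < n. \<forall>T \<subseteq> {..<n}. Q (override_on (b T) (a i) V) \<longleftrightarrow> i \<in> T)"
proof -
  obtain \<phi> where \<phi>: "\<And>e. range e \<subseteq> carrier R \<Longrightarrow> sat R (with_params h e) \<phi> \<longleftrightarrow> Q e"
    using assms(2) unfolding definable_def by blast
  have "is_model R (complete_theory R)"
    unfolding is_model_def complete_theory_def using is_cring by auto
  then obtain n where n: "\<not> shatters R \<phi> ((\<lambda>v. 2 * v) ` V) n"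
    using assms(1) unfolding NIP_ring_def NIP_theory_def by blast
  show ?thesis
  proof (intro exI[of _ n] allI impI notI)
    fix a :: "nat \<Rightarrow> nat \<Rightarrow> 'a" and b :: "nat set \<Rightarrow> nat \<Rightarrow> 'a"
    assume a: "\<forall>i. range (a i) \<subseteq> carrier R" and b: "\<forall>T. range (b T) \<subseteq> carrier R"
      and Q: "\<forall>i < n. \<forall>T \<subseteq> {..<n}. Q (override_on (b T) (a i) V) \<longleftrightarrow> i \<in> T"
    have ov: "range (override_on (b T) (a i) V) \<subseteq> carrier R" for T i
      using a b by (auto simp: override_on_def image_subset_iff)
    have "shatters R \<phi> ((\<lambda>v. 2 * v) ` V) n"
      unfolding shatters_def
    proof (intro exI[of _ "\<lambda>i. with_params h (a i)"] exI[of _ "\<lambda>T. with_params h (b T)"] conjI allI impI)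
      show "range (with_params h (a i)) \<subseteq> carrier R" for i by (rule range_with_params[OF h_closed]) (use a in simp)
      show "range (with_params h (b T)) \<subseteq> carrier R" for T by (rule range_with_params[OF h_closed]) (use b in simp)
      show "sat R (override_on (with_params h (b T)) (with_params h (a i)) ((\<lambda>v. 2 * v) ` V)) \<phi> \<longleftrightarrow> i \<in> T"
        if "i < n" "T \<subseteq> {..<n}" for i T
        unfolding with_params_override \<phi>[OF ov] using Q that by simp
    qed
    with n show False by contradiction
  qed
qed

end

lemma (in cring) is_definability: "range h \<subseteq> carrier R \<Longrightarrow> definability R h"
  by (intro definability.intro definability_axioms.intro is_cring)

text \<open>
  The ring \<open>S\<close> is coded by \<open>d\<close>-tuples over \<open>R\<close> (given as sequences of which only the first \<open>d\<close> terms
  matter): \<open>\<beta>\<close> decodes, and \<open>\<gamma>\<close> are structure constants. The element \<open>\<epsilon>\<close> makes it possible to code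
  modules over a factor of \<open>R\<close>.
\<close>

locale coded_ring = R: cring R + S: cring S
  for R :: "('a, 'm) ring_scheme" (structure) and S :: "('b, 'n) ring_scheme" +
  fixes d :: nat and \<epsilon> :: 'a and \<beta> :: "(nat \<Rightarrow> 'a) \<Rightarrow> 'b" and \<gamma> :: "nat \<Rightarrow> nat \<Rightarrow> nat \<Rightarrow> 'a"
  assumes eps_closed: "\<epsilon> \<in> carrier R" and gamma_closed: "\<gamma> i j l \<in> carrier R"
    and beta_closed: "range u \<subseteq> carrier R \<Longrightarrow> \<beta> u \<in> carrier S"
    and beta_surj: "s \<in> carrier S \<Longrightarrow> \<exists>u. range u \<subseteq> carrier R \<and> \<beta> u = s"
    and beta_add: "range u \<subseteq> carrier R \<Longrightarrow> range v \<subseteq> carrier R \<Longrightarrow> \<beta> u \<oplus>\<^bsub>S\<^esub> \<beta> v = \<beta> (\<lambda>i. u i \<oplus> v i)"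
    and beta_mult: "range u \<subseteq> carrier R \<Longrightarrow> range v \<subseteq> carrier R \<Longrightarrow>
      \<beta> u \<otimes>\<^bsub>S\<^esub> \<beta> v = \<beta> (\<lambda>l. \<Oplus>i\<in>{..<d}. \<Oplus>j\<in>{..<d}. \<gamma> i j l \<otimes> (u i \<otimes> v j))"
    and beta_eq: "range u \<subseteq> carrier R \<Longrightarrow> range v \<subseteq> carrier R \<Longrightarrow>
      \<beta> u = \<beta> v \<longleftrightarrow> (\<forall>i<d. \<epsilon> \<otimes> u i = \<epsilon> \<otimes> v i)"
begin

text \<open>One sequence has to hold all parameters: \<open>\<epsilon>\<close> at 0, and behind it
  the structure constants through iterated pairing.\<close>

definition param :: "nat \<Rightarrow> 'a" where
  "param k = (case k of 0 \<Rightarrow> \<epsilon> | Suc m \<Rightarrow> (case prod_decode m of (i, n) \<Rightarrow> case prod_decode n of (j, l) \<Rightarrow> \<gamma> i j l))"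

lemma param_eps: "param 0 = \<epsilon>" by (simp add: param_def)

lemma param_gamma: "param (Suc (prod_encode (i, prod_encode (j, l)))) = \<gamma> i j l"
  by (simp add: param_def)

sublocale definability R param
  by (rule R.is_definability)
    (auto simp: param_def eps_closed gamma_closed split: nat.splits prod.splits)

lemma definable_term_gamma: "definable_term (\<lambda>e. \<gamma> i j l)"
  using definable_term_param[of "Suc (prod_encode (i, prod_encode (j, l)))"] by (simp only: param_gamma)

text \<open>Pairing cuts the variables into infinitely many blocks, each holding one coded element.
  Below, block 0 is the point, blocks 1 and 2 are the parameters and block 3 is the quantified
  witness.\<close>

definition block :: "(nat \<Rightarrow> 'a) \<Rightarrow> nat \<Rightarrow> nat \<Rightarrow> 'a" where
  "block e k i = e (prod_encode (k, i))"

text \<open>A function into \<open>S\<close> is tracked through one code whose coordinates are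
  terms. Codes are not unique; \<open>beta_eq\<close> turns equality in \<open>S\<close> into
  equations in \<open>R\<close>.\<close>

definition codes :: "((nat \<Rightarrow> 'a) \<Rightarrow> 'b) \<Rightarrow> bool" where
  "codes t \<longleftrightarrow> (\<exists>ts. (\<forall>i. definable_term (ts i)) \<and> (\<forall>e. range e \<subseteq> carrier R \<longrightarrow> t e = \<beta> (\<lambda>i. ts i e)))"

lemma codesE:
  assumes "codes t"
  obtains ts where "\<And>i. definable_term (ts i)" "\<And>e. range e \<subseteq> carrier R \<Longrightarrow> t e = \<beta> (\<lambda>i. ts i e)"
  using assms unfolding codes_def by blast

lemma codesI:
  assumes "\<And>i. definable_term (ts i)" "\<And>e. range e \<subseteq> carrier R \<Longrightarrow> t e = \<beta> (\<lambda>i. ts i e)"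
  shows "codes t"
  unfolding codes_def by (intro exI[of _ ts] conjI allI impI assms)

lemma beta_zero: "\<beta> (\<lambda>_. \<zero>) = \<zero>\<^bsub>S\<^esub>"
proof -
  have c: "\<beta> (\<lambda>_. \<zero>) \<in> carrier S" by (rule beta_closed) auto
  have "\<beta> (\<lambda>_. \<zero>) \<oplus>\<^bsub>S\<^esub> \<beta> (\<lambda>_. \<zero>) = \<beta> (\<lambda>_. \<zero>)" by (subst beta_add) auto
  then show ?thesis using c S.add.r_cancel_one' by metis
qed

lemma beta_uminus:
  assumes "range u \<subseteq> carrier R"
  shows "\<beta> (\<lambda>i. \<ominus> u i) = \<ominus>\<^bsub>S\<^esub> \<beta> u"
proof -
  have r: "range (\<lambda>i. \<ominus> u i) \<subseteq> carrier R" using assms by auto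
  have "\<beta> (\<lambda>i. \<ominus> u i) \<oplus>\<^bsub>S\<^esub> \<beta> u = \<beta> (\<lambda>i. \<ominus> u i \<oplus> u i)" by (rule beta_add[OF r assms])
  also have "(\<lambda>i. \<ominus> u i \<oplus> u i) = (\<lambda>_. \<zero>)" using assms by (auto simp: fun_eq_iff image_subset_iff R.l_neg)
  finally have "\<beta> (\<lambda>i. \<ominus> u i) \<oplus>\<^bsub>S\<^esub> \<beta> u = \<zero>\<^bsub>S\<^esub>" using beta_zero by simp
  then show ?thesis using S.minus_equality[OF _ beta_closed[OF assms] beta_closed[OF r]] by simp
qed

lemma codes_block: "codes (\<lambda>e. \<beta> (block e k))"
  unfolding codes_def block_def
  by (rule exI[of _ "\<lambda>i e. e (prod_encode (k, i))"]) (auto simp: definable_term_var)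

lemma codes_closed:
  assumes "codes t" "range e \<subseteq> carrier R"
  shows "t e \<in> carrier S"
proof -
  obtain ts where ts: "\<And>i. definable_term (ts i)" "\<And>e. range e \<subseteq> carrier R \<Longrightarrow> t e = \<beta> (\<lambda>i. ts i e)"
    by (rule codesE[OF assms(1)]) (rule that)
  have "range (\<lambda>i. ts i e) \<subseteq> carrier R" using definable_term_closed[OF ts(1) assms(2)] by auto
  from beta_closed[OF this] show ?thesis using ts(2)[OF assms(2)] by simp
qed

lemma codes_add:
  assumes "codes s" "codes t"
  shows "codes (\<lambda>e. s e \<oplus>\<^bsub>S\<^esub> t e)"
proof -
  obtain ss where ss: "\<And>i. definable_term (ss i)" "\<And>e. range e \<subseteq> carrier R \<Longrightarrow> s e = \<beta> (\<lambda>i. ss i e)"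
    by (rule codesE[OF assms(1)]) (rule that)
  obtain ts where ts: "\<And>i. definable_term (ts i)" "\<And>e. range e \<subseteq> carrier R \<Longrightarrow> t e = \<beta> (\<lambda>i. ts i e)"
    by (rule codesE[OF assms(2)]) (rule that)
  have eq: "s e \<oplus>\<^bsub>S\<^esub> t e = \<beta> (\<lambda>i. ss i e \<oplus> ts i e)" if e: "range e \<subseteq> carrier R" for e
    unfolding ss(2)[OF e] ts(2)[OF e]
    by (rule beta_add) (use definable_term_closed[OF ss(1) e] definable_term_closed[OF ts(1) e] in auto)
  show ?thesis by (rule codesI[OF definable_term_add[OF ss(1) ts(1)] eq])
qed

lemma codes_uminus:
  assumes "codes s"
  shows "codes (\<lambda>e. \<ominus>\<^bsub>S\<^esub> s e)"
proof -
  obtain ss where ss: "\<And>i. definable_term (ss i)" "\<And>e. range e \<subseteq> carrier R \<Longrightarrow> s e = \<beta> (\<lambda>i. ss i e)"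
    by (rule codesE[OF assms]) (rule that)
  have eq: "\<ominus>\<^bsub>S\<^esub> s e = \<beta> (\<lambda>i. \<ominus> ss i e)" if e: "range e \<subseteq> carrier R" for e
    unfolding ss(2)[OF e]
    by (rule beta_uminus[symmetric]) (use definable_term_closed[OF ss(1) e] in auto)
  show ?thesis by (rule codesI[OF definable_term_uminus[OF ss(1)] eq])
qed

lemma codes_mult:
  assumes "codes s" "codes t"
  shows "codes (\<lambda>e. s e \<otimes>\<^bsub>S\<^esub> t e)"
proof -
  obtain ss where ss: "\<And>i. definable_term (ss i)" "\<And>e. range e \<subseteq> carrier R \<Longrightarrow> s e = \<beta> (\<lambda>i. ss i e)"
    by (rule codesE[OF assms(1)]) (rule that)
  obtain ts where ts: "\<And>i. definable_term (ts i)" "\<And>e. range e \<subseteq> carrier R \<Longrightarrow> t e = \<beta> (\<lambda>i. ts i e)"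
    by (rule codesE[OF assms(2)]) (rule that)
  define us where "us l e = (\<Oplus>i\<in>{..<d}. \<Oplus>j\<in>{..<d}. \<gamma> i j l \<otimes> (ss i e \<otimes> ts j e))" for l e
  have eq: "s e \<otimes>\<^bsub>S\<^esub> t e = \<beta> (\<lambda>l. us l e)" if e: "range e \<subseteq> carrier R" for e
    unfolding ss(2)[OF e] ts(2)[OF e] us_def
    by (rule beta_mult) (use definable_term_closed[OF ss(1) e] definable_term_closed[OF ts(1) e] in auto)
  have def_us: "definable_term (us l)" for l
    unfolding us_def by (intro definable_term_sum definable_term_mult definable_term_gamma ss(1) ts(1))
  show ?thesis by (rule codesI[OF def_us eq])
qed

text \<open>Positive exponents only: the empty product would require a code of the unit of
  \<open>S\<close> by terms.\<close>

lemma codes_power: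
  assumes "codes s" "n > 0"
  shows "codes (\<lambda>e. s e [^]\<^bsub>S\<^esub> (n :: nat))"
  using assms(2)
proof (induction n rule: nat_induct_non_zero)
  case 1
  obtain ss where "\<And>i. definable_term (ss i)" "\<And>e. range e \<subseteq> carrier R \<Longrightarrow> s e = \<beta> (\<lambda>i. ss i e)"
    by (rule codesE[OF assms(1)]) (rule that)
  then show ?case using codes_closed[OF assms(1)] by (intro codesI[of ss]) simp_all
next
  case (Suc n)
  show ?case using codes_mult[OF Suc.IH assms(1)] by simp
qed

lemma codes_eq:
  assumes "codes s" "codes t"
  shows "definable (\<lambda>e. s e = t e)"
proof -
  obtain ss where ss: "\<And>i. definable_term (ss i)" "\<And>e. range e \<subseteq> carrier R \<Longrightarrow> s e = \<beta> (\<lambda>i. ss i e)"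
    by (rule codesE[OF assms(1)]) (rule that)
  obtain ts where ts: "\<And>i. definable_term (ts i)" "\<And>e. range e \<subseteq> carrier R \<Longrightarrow> t e = \<beta> (\<lambda>i. ts i e)"
    by (rule codesE[OF assms(2)]) (rule that)
  have "definable (\<lambda>e. \<forall>i<d. param 0 \<otimes> ss i e = param 0 \<otimes> ts i e)"
    by (intro definable_all_less definable_eq definable_term_mult definable_term_param ss(1) ts(1))
  then show ?thesis
  proof (rule definable_cong)
    fix e :: "nat \<Rightarrow> 'a" assume e: "range e \<subseteq> carrier R"
    show "(\<forall>i<d. param 0 \<otimes> ss i e = param 0 \<otimes> ts i e) \<longleftrightarrow> s e = t e"
      unfolding ss(2)[OF e] ts(2)[OF e] param_eps
      by (rule beta_eq[symmetric])
        (use definable_term_closed[OF ss(1) e] definable_term_closed[OF ts(1) e] in auto)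
  qed
qed

lemma beta_cong:
  assumes "range u \<subseteq> carrier R" "range v \<subseteq> carrier R" "\<And>i. i < d \<Longrightarrow> u i = v i"
  shows "\<beta> u = \<beta> v"
  using beta_eq[OF assms(1,2)] assms(3) by simp

text \<open>Since \<open>\<beta>\<close> is surjective and depends on the first \<open>d\<close>
  coordinates only, a quantifier over \<open>S\<close> amounts to \<open>d\<close> quantifiers over
  \<open>R\<close>, on the initial variables of block 3.\<close>

lemma definable_coded_ex:
  assumes "definable (\<lambda>e. Q (\<beta> (block e 0)) (\<beta> (block e 1)) (\<beta> (block e 2)) (\<beta> (block e 3)))"
  shows "definable (\<lambda>e. \<exists>w \<in> carrier S. Q (\<beta> (block e 0)) (\<beta> (block e 1)) (\<beta> (block e 2)) w)"
proof -
  define W where "W = (\<lambda>i. prod_encode (3, i)) ` {..<d}"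
  have "finite W" by (simp add: W_def)
  from definable_ex_set[OF this assms] show ?thesis
  proof (rule definable_cong)
    fix e :: "nat \<Rightarrow> 'a" assume e: "range e \<subseteq> carrier R"
    have other: "block (override_on e u W) k = block e k" if "k \<noteq> 3" for u k
      using that by (auto simp: fun_eq_iff block_def override_on_def W_def)
    have new: "\<beta> (block (override_on e u W) 3) = \<beta> (\<lambda>i. u (prod_encode (3, i)))"
      if "range u \<subseteq> carrier R" for u
      by (rule beta_cong) (use e that in \<open>auto simp: block_def override_on_def W_def\<close>)
    show "(\<exists>u. range u \<subseteq> carrier R \<and> Q (\<beta> (block (override_on e u W) 0)) (\<beta> (block (override_on e u W) 1))
          (\<beta> (block (override_on e u W) 2)) (\<beta> (block (override_on e u W) 3))) \<longleftrightarrow>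
        (\<exists>w \<in> carrier S. Q (\<beta> (block e 0)) (\<beta> (block e 1)) (\<beta> (block e 2)) w)" (is "?L \<longleftrightarrow> ?R")
    proof
      assume ?L
      then obtain u where u: "range u \<subseteq> carrier R"
        "Q (\<beta> (block e 0)) (\<beta> (block e 1)) (\<beta> (block e 2)) (\<beta> (\<lambda>i. u (prod_encode (3, i))))"
        by (auto simp: other new)
      moreover have "\<beta> (\<lambda>i. u (prod_encode (3, i))) \<in> carrier S"
        by (rule beta_closed) (use u in auto)
      ultimately show ?R by blast
    next
      assume ?R
      then obtain w where w: "w \<in> carrier S" "Q (\<beta> (block e 0)) (\<beta> (block e 1)) (\<beta> (block e 2)) w" by blast
      obtain v where v: "range v \<subseteq> carrier R" "\<beta> v = w" using beta_surj[OF w(1)] by blast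
      \<comment> \<open>The code of \<open>w\<close> is written into every block, but only the
        variables in \<open>W\<close> are overridden.\<close>
      have r: "range (\<lambda>m. v (snd (prod_decode m))) \<subseteq> carrier R" using v by auto
      show ?L
        by (rule exI[of _ "\<lambda>m. v (snd (prod_decode m))"]) (use v w r in \<open>simp add: other new\<close>)
    qed
  qed
qed

lemma definable_coded_no_shatter:
  assumes "NIP_ring R" and Q: "definable (\<lambda>e. Q (\<beta> (block e 0)) (\<beta> (block e 1)) (\<beta> (block e 2)))"
  shows "no_shatter (carrier S) (carrier S \<times> carrier S) (\<lambda>x (y, z). Q x y z)"
proof -
  \<comment> \<open>The point variables are those of block 0; all others belong to the parameter
    tuple.\<close>
  define V where "V = range (\<lambda>i. prod_encode (0, i))"
  from definable_not_shattered[OF assms(1) Q, of V] obtain n :: nat where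
    n: "\<forall>(a :: nat \<Rightarrow> nat \<Rightarrow> 'a) (b :: nat set \<Rightarrow> nat \<Rightarrow> 'a).
      (\<forall>i. range (a i) \<subseteq> carrier R) \<longrightarrow> (\<forall>T. range (b T) \<subseteq> carrier R) \<longrightarrow>
      \<not> (\<forall>i < n. \<forall>T \<subseteq> {..<n}. Q (\<beta> (block (override_on (b T) (a i) V) 0))
        (\<beta> (block (override_on (b T) (a i) V) 1)) (\<beta> (block (override_on (b T) (a i) V) 2)) \<longleftrightarrow> i \<in> T)" ..
  show ?thesis
    unfolding no_shatter_def
  proof (intro exI[of _ n] notI, elim exE conjE)
    fix x :: "nat \<Rightarrow> 'b" and yz :: "nat set \<Rightarrow> 'b \<times> 'b"
    assume x: "\<forall>i<n. x i \<in> carrier S" and yz: "\<forall>T\<subseteq>{..<n}. yz T \<in> carrier S \<times> carrier S"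
      and iff: "\<forall>i<n. \<forall>T\<subseteq>{..<n}. (case yz T of (y, z) \<Rightarrow> Q (x i) y z) \<longleftrightarrow> i \<in> T"
    \<comment> \<open>Assignments are required for all indices and all sets, also those beyond
      \<open>n\<close>; outside \<open>carrier S\<close> the zero tuple is the default.\<close>
    define cd where "cd s = (if s \<in> carrier S then SOME u. range u \<subseteq> carrier R \<and> \<beta> u = s else (\<lambda>_. \<zero>))" for s
    have cd0: "range (cd s) \<subseteq> carrier R \<and> \<beta> (cd s) = s" if "s \<in> carrier S" for s
      using someI_ex[OF beta_surj[OF that]] that by (simp add: cd_def)
    have cd: "cd s m \<in> carrier R" for s m
    proof (cases "s \<in> carrier S")
      case True
      then show ?thesis using cd0 by blast
    next
      case False
      then show ?thesis by (simp add: cd_def)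
    qed
    define a where "a i = (\<lambda>m. cd (x i) (snd (prod_decode m)))" for i
    define b where "b T = (\<lambda>m. cd (if fst (prod_decode m) = 1 then fst (yz T) else snd (yz T)) (snd (prod_decode m)))" for T
    have a: "\<forall>i. range (a i) \<subseteq> carrier R" unfolding a_def image_subset_iff using cd by blast
    have b: "\<forall>T. range (b T) \<subseteq> carrier R" unfolding b_def image_subset_iff using cd by blast
    have iff': "Q (\<beta> (block e 0)) (\<beta> (block e 1)) (\<beta> (block e 2)) \<longleftrightarrow> i \<in> T"
      if i: "i < n" and T: "T \<subseteq> {..<n}" and e: "e = override_on (b T) (a i) V" for i T e
    proof -
      have "prod_encode (k, j) \<in> V \<longleftrightarrow> k = 0" for k j by (auto simp: V_def)
      then have "block e 0 = cd (x i)" "block e 1 = cd (fst (yz T))" "block e 2 = cd (snd (yz T))"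
        by (simp_all add: fun_eq_iff e block_def override_on_def a_def b_def)
      moreover have "x i \<in> carrier S" "fst (yz T) \<in> carrier S" "snd (yz T) \<in> carrier S"
        using x[rule_format, OF i] yz[rule_format, OF T] by (simp_all add: mem_Times_iff)
      ultimately show ?thesis using cd0 iff[rule_format, OF i T] by (simp add: case_prod_unfold)
    qed
    have "\<not> (\<forall>i < n. \<forall>T \<subseteq> {..<n}. Q (\<beta> (block (override_on (b T) (a i) V) 0))
        (\<beta> (block (override_on (b T) (a i) V) 1)) (\<beta> (block (override_on (b T) (a i) V) 2)) \<longleftrightarrow> i \<in> T)"
      by (rule n[THEN spec[of _ a], THEN spec[of _ b], THEN mp, THEN mp, OF a b])
    moreover have "\<forall>i < n. \<forall>T \<subseteq> {..<n}. Q (\<beta> (block (override_on (b T) (a i) V) 0))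
        (\<beta> (block (override_on (b T) (a i) V) 1)) (\<beta> (block (override_on (b T) (a i) V) 2)) \<longleftrightarrow> i \<in> T"
      by (intro allI impI iff'[OF _ _ refl])
    ultimately show False by contradiction
  qed
qed

text \<open>Both families are given in \<open>S\<close> by a single existential quantifier over an
  equation, so they are definable in \<open>R\<close> with the structure constants as
  parameters.\<close>

theorem tame:
  assumes nip: "NIP_ring R" and p: "Factorial_Ring.prime p" and char: "[p] \<cdot>\<^bsub>S\<^esub> \<one>\<^bsub>S\<^esub> = \<zero>\<^bsub>S\<^esub>"
  shows "tame_cring S p"
proof (intro tame_cring.intro tame_cring_axioms.intro char_cring.intro char_cring_axioms.intro S.is_cring p char)
  have "definable (\<lambda>e. \<exists>w \<in> carrier S. \<beta> (block e 1) = \<beta> (block e 0) \<otimes>\<^bsub>S\<^esub> w)"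
    by (rule definable_coded_ex) (intro codes_eq codes_mult codes_block)
  from definable_coded_no_shatter[OF nip this]
  have "no_shatter (carrier S) (carrier S \<times> carrier S) (\<lambda>x (y, z). \<exists>w\<in>carrier S. y = x \<otimes>\<^bsub>S\<^esub> w)" .
  then obtain n where n: "\<not> (\<exists>(d :: nat \<Rightarrow> 'b) b. (\<forall>i < n. d i \<in> carrier S) \<and> (\<forall>T \<subseteq> {..<n}. b T \<in> carrier S \<times> carrier S) \<and>
    (\<forall>i < n. \<forall>T \<subseteq> {..<n}. (case b T of (y, z) \<Rightarrow> \<exists>w\<in>carrier S. y = d i \<otimes>\<^bsub>S\<^esub> w) \<longleftrightarrow> i \<in> T))"
    unfolding no_shatter_def by (elim exE)
  \<comment> \<open>The coded statement takes pairs as parameters; for divisibility the single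
    parameter is entered twice.\<close>
  show "no_shatter (carrier S) (carrier S) (\<lambda>x y. \<exists>w\<in>carrier S. y = x \<otimes>\<^bsub>S\<^esub> w)"
    unfolding no_shatter_def
  proof (intro exI[of _ n] notI, elim exE conjE)
    fix x y assume x: "\<forall>i<n. x i \<in> carrier S" "\<forall>T\<subseteq>{..<n}. y T \<in> carrier S"
      "\<forall>i<n. \<forall>T\<subseteq>{..<n}. (\<exists>w\<in>carrier S. y T = x i \<otimes>\<^bsub>S\<^esub> w) \<longleftrightarrow> i \<in> T"
    show False
      by (rule notE[OF n], rule exI[of _ x], rule exI[of _ "\<lambda>T. (y T, y T)"]) (use x in simp)
  qed
next
  have p0: "p > 0" using p prime_gt_0_nat by blast
  have "definable (\<lambda>e. \<exists>w \<in> carrier S. \<beta> (block e 1) = \<beta> (block e 0) [^]\<^bsub>S\<^esub> p \<otimes>\<^bsub>S\<^esub>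
      ((\<beta> (block e 2) \<otimes>\<^bsub>S\<^esub> w) [^]\<^bsub>S\<^esub> p \<ominus>\<^bsub>S\<^esub> \<beta> (block e 2) \<otimes>\<^bsub>S\<^esub> w))"
    unfolding a_minus_def
    by (rule definable_coded_ex) (intro codes_eq codes_mult codes_block codes_add codes_uminus codes_power p0)
  from definable_coded_no_shatter[OF nip this]
  show "no_shatter (carrier S) (carrier S \<times> carrier S)
     (\<lambda>d (x, g). \<exists>w\<in>carrier S. x = d [^]\<^bsub>S\<^esub> p \<otimes>\<^bsub>S\<^esub> ((g \<otimes>\<^bsub>S\<^esub> w) [^]\<^bsub>S\<^esub> p \<ominus>\<^bsub>S\<^esub> g \<otimes>\<^bsub>S\<^esub> w))" .
qed

end

section \<open>The algebra obtained by adjoining a root of a monic polynomial\<close>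

text \<open>
  \<open>S\<close> is \<open>A[X]/(f)\<close> for the monic polynomial \<open>f = \<Sum>i\<le>d. c i X\<^sup>i\<close>, with \<open>\<xi>\<close> the class of \<open>X\<close>.
\<close>

locale monogenic_algebra = ring_hom_cring A S \<phi> for A (structure) and S (structure) and \<phi> +
  fixes \<xi> and d :: nat and c
  assumes xi_closed: "\<xi> \<in> carrier S"
    and coeff_closed: "c i \<in> carrier A"
    and monic: "c d = \<one>"
    and span: "s \<in> carrier S \<Longrightarrow>
      \<exists>u. (\<forall>i. u i \<in> carrier A) \<and> s = (\<Oplus>\<^bsub>S\<^esub>i\<in>{..<d}. \<phi> (u i) \<otimes>\<^bsub>S\<^esub> \<xi> [^]\<^bsub>S\<^esub> i)"
    and independent: "(\<And>i. u i \<in> carrier A) \<Longrightarrow>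
      (\<Oplus>\<^bsub>S\<^esub>i\<in>{..<d}. \<phi> (u i) \<otimes>\<^bsub>S\<^esub> \<xi> [^]\<^bsub>S\<^esub> i) = \<zero>\<^bsub>S\<^esub> \<Longrightarrow> i < d \<Longrightarrow> u i = \<zero>"
    and root: "(\<Oplus>\<^bsub>S\<^esub>i\<in>{..d}. \<phi> (c i) \<otimes>\<^bsub>S\<^esub> \<xi> [^]\<^bsub>S\<^esub> i) = \<zero>\<^bsub>S\<^esub>"
    and maximalideal_over: "a \<in> carrier A \<Longrightarrow> ideal m A \<Longrightarrow> \<one> \<notin> m \<Longrightarrow>
      (\<Oplus>i\<in>{..d}. c i \<otimes> a [^] i) \<in> m \<Longrightarrow>
      \<exists>n. maximalideal n S \<and> \<phi> ` m \<subseteq> n \<and> \<xi> \<ominus>\<^bsub>S\<^esub> \<phi> a \<in> n"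

lemma (in UP_cring) coeff_sum_monom:
  assumes "\<And>i. u i \<in> carrier R" "finite I"
  shows "up_ring.coeff P (\<Oplus>\<^bsub>P\<^esub>i\<in>I. up_ring.monom P (u i) i) n = (if n \<in> I then u n else \<zero>)"
proof -
  have "up_ring.coeff P (\<Oplus>\<^bsub>P\<^esub>i\<in>I. up_ring.monom P (u i) i) n = (\<Oplus>i\<in>I. up_ring.coeff P (up_ring.monom P (u i) i) n)"
    using assms by (intro coeff_finsum) auto
  also have "\<dots> = (\<Oplus>i\<in>I. if n = i then u i else \<zero>)"
    using assms by (intro R.finsum_cong') auto
  also have "\<dots> = (if n \<in> I then u n else \<zero>)"
  proof (cases "n \<in> I")
    case True
    then show ?thesis using R.add.finprod_singleton[of n I u] assms by auto
  next
    case False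
    then have "(\<Oplus>i\<in>I. if n = i then u i else \<zero>) = (\<Oplus>i\<in>I. \<zero>)"
      using assms by (intro R.finsum_cong') auto
    with False show ?thesis by simp
  qed
  finally show ?thesis .
qed

text \<open>For nonzero \<open>q\<close>, the coefficient of \<open>F q\<close> at
  \<open>d + deg q\<close> is the leading coefficient of \<open>q\<close>, as \<open>F\<close> is
  monic. This makes the powers of the variable below \<open>d\<close> independent modulo
  \<open>F\<close>.\<close>

lemma (in UP_cring) monic_multiple_low_degree:
  assumes F: "F \<in> carrier P" "up_ring.coeff P F d = \<one>" "\<And>n. n > d \<Longrightarrow> up_ring.coeff P F n = \<zero>"
    and q: "q \<in> carrier P" and low: "\<And>n. n \<ge> d \<Longrightarrow> up_ring.coeff P (F \<otimes>\<^bsub>P\<^esub> q) n = \<zero>"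
  shows "F \<otimes>\<^bsub>P\<^esub> q = \<zero>\<^bsub>P\<^esub>"
proof (cases "q = \<zero>\<^bsub>P\<^esub>")
  case True
  then show ?thesis using F by simp
next
  case False
  define k where "k = deg R q"
  have "up_ring.coeff P (F \<otimes>\<^bsub>P\<^esub> q) (d + k) = (\<Oplus>i\<in>{..d + k}. up_ring.coeff P F i \<otimes> up_ring.coeff P q (d + k - i))"
    using F q by simp
  also have "\<dots> = (\<Oplus>i\<in>{..d + k}. if d = i then up_ring.coeff P q k else \<zero>)"
  proof (rule R.finsum_cong')
    fix i assume "i \<in> {..d + k}"
    consider "i < d" | "i = d" | "i > d" by linarith
    then show "up_ring.coeff P F i \<otimes> up_ring.coeff P q (d + k - i) = (if d = i then up_ring.coeff P q k else \<zero>)"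
    proof cases
      case 1
      then have "up_ring.coeff P q (d + k - i) = \<zero>" using q by (intro deg_aboveD) (auto simp: k_def)
      then show ?thesis using 1 F by simp
    next
      case 3
      then show ?thesis using F(3)[OF 3] q by simp
    qed (use F q in auto)
  qed (use q in auto)
  also have "\<dots> = up_ring.coeff P q k"
    using R.add.finprod_singleton[of d "{..d + k}" "\<lambda>_. up_ring.coeff P q k"] q by simp
  finally have "up_ring.coeff P q k = \<zero>" using low[of "d + k"] by simp
  moreover have "up_ring.coeff P q k \<noteq> \<zero>" unfolding k_def using lcoeff_nonzero[OF False q] .
  ultimately show ?thesis by contradiction
qed

text \<open>Division with remainder by the monic \<open>F\<close> gives \<open>span\<close>, and a
  multiple of \<open>F\<close> of degree below \<open>d\<close> vanishes, which gives
  \<open>independent\<close>. The maximal ideal over \<open>m\<close> and \<open>a\<close> extends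
  the image of the ideal of all \<open>g\<close> with \<open>g(a)\<close> in
  \<open>m\<close>.\<close>

lemma (in UP_cring) exists_monogenic_algebra:
  assumes one_not_zero: "\<one> \<noteq> \<zero>" and c: "\<And>i. c i \<in> carrier R" and cd: "c d = \<one>"
  shows "\<exists>(S :: (nat \<Rightarrow> 'a) set ring) \<phi> \<xi>. monogenic_algebra R S \<phi> \<xi> d c"
proof -
  define F where "F = (\<Oplus>\<^bsub>P\<^esub>i\<in>{..d}. up_ring.monom P (c i) i)"
  have Fc: "F \<in> carrier P" using c by (auto simp: F_def intro!: P.finsum_closed)
  have Fcoeff: "up_ring.coeff P F n = (if n \<le> d then c n else \<zero>)" for n
    using coeff_sum_monom[of c "{..d}" n] c by (simp add: F_def)
  have F0: "F \<noteq> \<zero>\<^bsub>P\<^esub>"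
  proof
    assume "F = \<zero>\<^bsub>P\<^esub>"
    then have "up_ring.coeff P F d = \<zero>" by simp
    then show False using Fcoeff[of d] cd one_not_zero by simp
  qed
  have degF: "deg R F = d"
  proof (rule antisym)
    show "deg R F \<le> d" by (rule deg_aboveI) (use Fcoeff Fc in auto)
    show "d \<le> deg R F" by (rule deg_belowI) (use Fcoeff[of d] cd one_not_zero Fc in auto)
  qed
  define I where "I = PIdl\<^bsub>P\<^esub> F"
  have I: "ideal I P" unfolding I_def by (rule P.cgenideal_ideal[OF Fc])
  interpret I: ideal I P by (rule I)
  have memI: "g \<in> I \<longleftrightarrow> (\<exists>q \<in> carrier P. g = F \<otimes>\<^bsub>P\<^esub> q)" for g
    unfolding I_def cgenideal_def using P.m_comm[OF Fc] by force
  define S where "S = P Quot I"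
  define cl where "cl = (+>\<^bsub>P\<^esub>) I"
  interpret cl: ring_hom_cring P S cl
    unfolding S_def cl_def by (rule I.rcos_ring_hom_cring[OF P.is_cring])
  have cl_surj: "\<exists>g \<in> carrier P. cl g = s" if "s \<in> carrier S" for s
    using that unfolding S_def cl_def FactRing_def A_RCOSETS_def' by auto
  have cl_eq: "cl g = cl h \<longleftrightarrow> g \<ominus>\<^bsub>P\<^esub> h \<in> I" if "g \<in> carrier P" "h \<in> carrier P" for g h
    unfolding cl_def using P.quotient_eq_iff_same_a_r_cos[OF I that] by simp
  define \<phi> where "\<phi> a = cl (up_ring.monom P a 0)" for a
  define \<xi> where "\<xi> = cl (up_ring.monom P \<one> 1)"
  have xi: "\<xi> \<in> carrier S" by (simp add: \<xi>_def)
  have xi_pow: "\<xi> [^]\<^bsub>S\<^esub> n = cl (up_ring.monom P \<one> n)" for n :: nat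
  proof (induction n)
    case 0
    then show ?case by simp
  next
    case (Suc n)
    then show ?case unfolding monom_one_Suc[of n] by (simp add: \<xi>_def)
  qed
  have phi_xi: "\<phi> a \<otimes>\<^bsub>S\<^esub> \<xi> [^]\<^bsub>S\<^esub> n = cl (up_ring.monom P a n)" if "a \<in> carrier R" for a n
    using monom_mult[of a \<one> 0 n] that unfolding xi_pow \<phi>_def by simp
  have phi_hom: "\<phi> \<in> ring_hom R S"
  proof (rule ring_hom_memI)
    show "\<phi> (x \<otimes> y) = \<phi> x \<otimes>\<^bsub>S\<^esub> \<phi> y" if "x \<in> carrier R" "y \<in> carrier R" for x y
      using monom_mult[of x y 0 0] that unfolding \<phi>_def by simp
  qed (auto simp: \<phi>_def)
  have sum_cl: "(\<Oplus>\<^bsub>S\<^esub>i\<in>J. \<phi> (u i) \<otimes>\<^bsub>S\<^esub> \<xi> [^]\<^bsub>S\<^esub> i) = cl (\<Oplus>\<^bsub>P\<^esub>i\<in>J. up_ring.monom P (u i) i)"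
    if u: "\<And>i. u i \<in> carrier R" for u and J :: "nat set"
  proof -
    have "(\<Oplus>\<^bsub>S\<^esub>i\<in>J. \<phi> (u i) \<otimes>\<^bsub>S\<^esub> \<xi> [^]\<^bsub>S\<^esub> i) = (\<Oplus>\<^bsub>S\<^esub>i\<in>J. cl (up_ring.monom P (u i) i))"
      using u by (intro cl.S.finsum_cong') (auto simp: phi_xi)
    also have "\<dots> = cl (\<Oplus>\<^bsub>P\<^esub>i\<in>J. up_ring.monom P (u i) i)"
      using u by (subst cl.hom_finsum) (auto simp: comp_def)
    finally show ?thesis .
  qed
  have clF: "cl F = \<zero>\<^bsub>S\<^esub>"
  proof -
    have "F = F \<otimes>\<^bsub>P\<^esub> \<one>\<^bsub>P\<^esub>" using Fc by simp
    then have "F \<in> I" unfolding memI by blast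
    then have "F \<ominus>\<^bsub>P\<^esub> \<zero>\<^bsub>P\<^esub> \<in> I" using Fc by (simp add: P.minus_eq)
    then show ?thesis using cl_eq[OF Fc P.zero_closed] by simp
  qed
  have "monogenic_algebra R S \<phi> \<xi> d c"
  proof (unfold_locales)
    show "\<phi> \<in> ring_hom R S" by (rule phi_hom)
    show "\<xi> \<in> carrier S" by (rule xi)
    show "c i \<in> carrier R" for i by (rule c)
    show "c d = \<one>" by (rule cd)
  next
    fix s assume "s \<in> carrier S"
    then obtain g where g: "g \<in> carrier P" "cl g = s" using cl_surj by blast
    obtain q r and k :: nat where qr: "q \<in> carrier P" "r \<in> carrier P"
      "up_ring.coeff P F (deg R F) [^] k \<odot>\<^bsub>P\<^esub> g = F \<otimes>\<^bsub>P\<^esub> q \<oplus>\<^bsub>P\<^esub> r" "r = \<zero>\<^bsub>P\<^esub> \<or> deg R r < deg R F"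
      using long_div_theorem[OF Fc g(1) F0] by blast
    \<comment> \<open>The power of the leading coefficient in pseudo-division is 1.\<close>
    have gqr: "g = F \<otimes>\<^bsub>P\<^esub> q \<oplus>\<^bsub>P\<^esub> r" using qr(3) g(1) by (simp add: degF Fcoeff cd)
    have r0: "up_ring.coeff P r n = \<zero>" if "n \<ge> d" for n
    proof (cases "r = \<zero>\<^bsub>P\<^esub>")
      case False
      then have "deg R r < n" using qr(4) that by (simp add: degF)
      then show ?thesis using qr(2) by (rule deg_aboveD)
    qed simp
    have "cl g = cl r" unfolding gqr using Fc qr clF by simp
    moreover have "r = (\<Oplus>\<^bsub>P\<^esub>i\<in>{..<d}. up_ring.monom P (up_ring.coeff P r i) i)"
    proof (rule up_eqI)
      fix n
      have "up_ring.coeff P (\<Oplus>\<^bsub>P\<^esub>i\<in>{..<d}. up_ring.monom P (up_ring.coeff P r i) i) n = (if n \<in> {..<d} then up_ring.coeff P r n else \<zero>)"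
        by (rule coeff_sum_monom) (use qr in auto)
      then show "up_ring.coeff P r n = up_ring.coeff P (\<Oplus>\<^bsub>P\<^esub>i\<in>{..<d}. up_ring.monom P (up_ring.coeff P r i) i) n"
        using r0[of n] by auto
    qed (use qr in \<open>auto intro!: P.finsum_closed\<close>)
    ultimately have "s = (\<Oplus>\<^bsub>S\<^esub>i\<in>{..<d}. \<phi> (up_ring.coeff P r i) \<otimes>\<^bsub>S\<^esub> \<xi> [^]\<^bsub>S\<^esub> i)"
      using sum_cl[of "up_ring.coeff P r" "{..<d}"] qr(2) g(2) by simp
    then show "\<exists>u. (\<forall>i. u i \<in> carrier R) \<and> s = (\<Oplus>\<^bsub>S\<^esub>i\<in>{..<d}. \<phi> (u i) \<otimes>\<^bsub>S\<^esub> \<xi> [^]\<^bsub>S\<^esub> i)"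
      using qr(2) by (intro exI[of _ "up_ring.coeff P r"]) auto
  next
    fix u i assume u: "\<And>i. u i \<in> carrier R"
      and sum0: "(\<Oplus>\<^bsub>S\<^esub>i\<in>{..<d}. \<phi> (u i) \<otimes>\<^bsub>S\<^esub> \<xi> [^]\<^bsub>S\<^esub> i) = \<zero>\<^bsub>S\<^esub>" and i: "i < d"
    define r where "r = (\<Oplus>\<^bsub>P\<^esub>i\<in>{..<d}. up_ring.monom P (u i) i)"
    have rc: "r \<in> carrier P" using u by (auto simp: r_def intro!: P.finsum_closed)
    have rcoeff: "up_ring.coeff P r n = (if n < d then u n else \<zero>)" for n
      using coeff_sum_monom[of u "{..<d}" n] u by (simp add: r_def)
    have "cl r = cl \<zero>\<^bsub>P\<^esub>" using sum0 sum_cl[of u "{..<d}"] u by (simp add: r_def)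
    then have "r \<ominus>\<^bsub>P\<^esub> \<zero>\<^bsub>P\<^esub> \<in> I" using cl_eq[OF rc P.zero_closed] by simp
    then have "r \<in> I" using rc by (simp add: P.minus_eq)
    then obtain q where q: "q \<in> carrier P" "r = F \<otimes>\<^bsub>P\<^esub> q" using memI by blast
    have "F \<otimes>\<^bsub>P\<^esub> q = \<zero>\<^bsub>P\<^esub>"
    proof (rule monic_multiple_low_degree[OF Fc, of d])
      show "up_ring.coeff P F d = \<one>" using Fcoeff cd by simp
      show "up_ring.coeff P F n = \<zero>" if "n > d" for n using Fcoeff that by simp
      show "up_ring.coeff P (F \<otimes>\<^bsub>P\<^esub> q) n = \<zero>" if "n \<ge> d" for n
        using rcoeff[of n] that unfolding q(2) by simp
    qed (rule q(1))
    then have "up_ring.coeff P r i = \<zero>" unfolding q(2) by simp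
    then show "u i = \<zero>" using rcoeff[of i] i by simp
  next
    show "(\<Oplus>\<^bsub>S\<^esub>i\<in>{..d}. \<phi> (c i) \<otimes>\<^bsub>S\<^esub> \<xi> [^]\<^bsub>S\<^esub> i) = \<zero>\<^bsub>S\<^esub>"
      using sum_cl[of c "{..d}"] c clF by (simp add: F_def)
  next
    fix a m assume a: "a \<in> carrier R" and m: "ideal m R" "\<one> \<notin> m"
      and fa: "(\<Oplus>i\<in>{..d}. c i \<otimes> a [^] i) \<in> m"
    interpret m: ideal m R by (rule m)
    \<comment> \<open>Evaluation asks for a homomorphism on the coefficients; here it is the
      identity.\<close>
    define h where "h x = x" for x :: 'a
    interpret ev: UP_pre_univ_prop R R h P
      by unfold_locales (auto simp: ring_hom_def P_def h_def)
    define E where "E = UnivPoly.eval R R h a"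
    have E_hom: "E \<in> ring_hom P R" unfolding E_def by (rule ev.eval_ring_hom[OF a])
    interpret E: ring_hom_cring P R E by unfold_locales (rule E_hom)
    have E_monom: "E (up_ring.monom P r n) = r \<otimes> a [^] n" if "r \<in> carrier R" for r n
      using ev.eval_monom[OF that a] unfolding E_def by (simp add: h_def)
    define M where "M = {g \<in> carrier P. E g \<in> m}"
    have M: "ideal M P"
    proof (rule idealI[OF P.ring_axioms])
      show "subgroup M (add_monoid P)"
      proof (rule P.add.subgroupI)
        show "M \<subseteq> carrier P" by (auto simp: M_def)
        have "\<zero>\<^bsub>P\<^esub> \<in> M" using m.zero_closed by (simp add: M_def)
        then show "M \<noteq> {}" by blast
        show "\<ominus>\<^bsub>P\<^esub> g \<in> M" if "g \<in> M" for g
          using that m.a_inv_closed unfolding M_def by simp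
        show "g \<oplus>\<^bsub>P\<^esub> h \<in> M" if "g \<in> M" "h \<in> M" for g h
          using that m.a_closed unfolding M_def by simp
      qed
    next
      fix g x assume "g \<in> M" "x \<in> carrier P"
      then show "x \<otimes>\<^bsub>P\<^esub> g \<in> M" "g \<otimes>\<^bsub>P\<^esub> x \<in> M"
        by (auto simp: M_def m.I_l_closed m.I_r_closed)
    qed
    have EF: "E F \<in> m"
    proof -
      have "E F = (\<Oplus>i\<in>{..d}. E (up_ring.monom P (c i) i))"
        unfolding F_def using c by (subst E.hom_finsum) (auto simp: comp_def)
      also have "\<dots> = (\<Oplus>i\<in>{..d}. c i \<otimes> a [^] i)"
        using c a by (intro R.finsum_cong') (auto simp: E_monom)
      finally show ?thesis using fa by simp
    qed
    have IM: "I \<subseteq> M"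
    proof
      fix g assume "g \<in> I"
      then obtain q where "q \<in> carrier P" "g = F \<otimes>\<^bsub>P\<^esub> q" using memI by blast
      then show "g \<in> M" using Fc EF by (auto simp: M_def m.I_r_closed)
    qed
    have J: "ideal (cl ` M) S"
      unfolding cl_def S_def by (rule P.ring_ideal_imp_quot_ideal[OF I M])
    \<comment> \<open>\<open>M\<close> contains the kernel \<open>I\<close> of the quotient map, so
      a 1 in the image of \<open>M\<close> would put 1 into \<open>M\<close> and hence into
      \<open>m\<close>.\<close>
    have "\<one>\<^bsub>S\<^esub> \<notin> cl ` M"
    proof
      assume "\<one>\<^bsub>S\<^esub> \<in> cl ` M"
      then obtain g where g: "g \<in> M" "cl \<one>\<^bsub>P\<^esub> = cl g" by auto
      have gc: "g \<in> carrier P" using g by (simp add: M_def)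
      have "\<one>\<^bsub>P\<^esub> \<ominus>\<^bsub>P\<^esub> g \<in> M" using cl_eq[OF P.one_closed gc] g(2) IM by auto
      then have "(\<one>\<^bsub>P\<^esub> \<ominus>\<^bsub>P\<^esub> g) \<oplus>\<^bsub>P\<^esub> g \<in> M"
        using g(1) additive_subgroup.a_closed[OF ideal.axioms(1)[OF M]] by blast
      moreover have "(\<one>\<^bsub>P\<^esub> \<ominus>\<^bsub>P\<^esub> g) \<oplus>\<^bsub>P\<^esub> g = \<one>\<^bsub>P\<^esub>" using gc by (simp add: P.minus_eq P.a_assoc P.l_neg)
      ultimately show False using m by (simp add: M_def)
    qed
    from cl.S.exists_maximalideal_containing[OF J this]
    obtain n where n: "maximalideal n S" "cl ` M \<subseteq> n" by blast
    have "\<phi> ` m \<subseteq> n"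
    proof
      fix y assume "y \<in> \<phi> ` m"
      then obtain x where x: "x \<in> m" "y = cl (up_ring.monom P x 0)" by (auto simp: \<phi>_def)
      have "E (up_ring.monom P x 0) = x" using E_monom[of x 0] m.a_Hcarr[OF x(1)] by simp
      then have "up_ring.monom P x 0 \<in> M" using x m.a_Hcarr[OF x(1)] by (simp add: M_def)
      then show "y \<in> n" using n x by blast
    qed
    moreover have "\<xi> \<ominus>\<^bsub>S\<^esub> \<phi> a \<in> n"
    proof -
      let ?g = "up_ring.monom P \<one> 1 \<ominus>\<^bsub>P\<^esub> up_ring.monom P a 0"
      have "E ?g = a \<ominus> a" using a E_monom[of \<one> 1] E_monom[of a 0] by (simp add: P.minus_eq R.minus_eq)
      then have "?g \<in> M" using a m.zero_closed by (simp add: M_def R.minus_eq R.r_neg)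
      moreover have "cl ?g = \<xi> \<ominus>\<^bsub>S\<^esub> \<phi> a" using a by (simp add: \<xi>_def \<phi>_def P.minus_eq cl.S.minus_eq)
      ultimately show ?thesis using n by (metis image_subset_iff)
    qed
    ultimately show "\<exists>n. maximalideal n S \<and> \<phi> ` m \<subseteq> n \<and> \<xi> \<ominus>\<^bsub>S\<^esub> \<phi> a \<in> n" using n by blast
  qed
  then show ?thesis by blast
qed

section \<open>Lifting simple roots\<close>

text \<open>The expansion to first order with quadratic remainder holds over every commutative ring:
  multiplying by \<open>x = y + (x - y)\<close> passes from one exponent to the next.\<close>

lemma (in cring) taylor_power:
  assumes x: "x \<in> carrier R" and y: "y \<in> carrier R"
  shows "\<exists>q \<in> carrier R. x [^] Suc n =
    y [^] Suc n \<oplus> (x \<ominus> y) \<otimes> (([Suc n] \<cdot> \<one>) \<otimes> y [^] n) \<oplus> (x \<ominus> y) \<otimes> ((x \<ominus> y) \<otimes> q)"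
proof (induction n)
  case 0
  have "x = y \<oplus> (x \<ominus> y) \<oplus> (x \<ominus> y) \<otimes> ((x \<ominus> y) \<otimes> \<zero>)" using x y by algebra
  then show ?case using x y by (intro bexI[of _ \<zero>]) simp_all
next
  case (Suc n)
  then obtain q where q: "q \<in> carrier R" "x [^] Suc n =
    y [^] Suc n \<oplus> (x \<ominus> y) \<otimes> (([Suc n] \<cdot> \<one>) \<otimes> y [^] n) \<oplus> (x \<ominus> y) \<otimes> ((x \<ominus> y) \<otimes> q)" by blast
  define N Y where "N = [Suc n] \<cdot> \<one>" and "Y = y [^] n"
  have c: "N \<in> carrier R" "Y \<in> carrier R" using y by (simp_all add: N_def Y_def)
  have N: "[Suc (Suc n)] \<cdot> \<one> = N \<oplus> \<one>" by (simp add: N_def)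
  have "x [^] Suc (Suc n) = x [^] Suc n \<otimes> x" by simp
  also have "\<dots> = (Y \<otimes> y \<oplus> (x \<ominus> y) \<otimes> (N \<otimes> Y) \<oplus> (x \<ominus> y) \<otimes> ((x \<ominus> y) \<otimes> q)) \<otimes> x"
    unfolding q(2) by (simp add: N_def Y_def)
  also have "\<dots> = (Y \<otimes> y) \<otimes> y \<oplus> (x \<ominus> y) \<otimes> ((N \<oplus> \<one>) \<otimes> (Y \<otimes> y))
      \<oplus> (x \<ominus> y) \<otimes> ((x \<ominus> y) \<otimes> (N \<otimes> Y \<oplus> q \<otimes> x))"
    using x y c q(1) by algebra
  finally have "x [^] Suc (Suc n) = y [^] Suc (Suc n) \<oplus> (x \<ominus> y) \<otimes> (([Suc (Suc n)] \<cdot> \<one>) \<otimes> y [^] Suc n)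
      \<oplus> (x \<ominus> y) \<otimes> ((x \<ominus> y) \<otimes> (N \<otimes> Y \<oplus> q \<otimes> x))"
    unfolding N by (simp add: Y_def)
  moreover have "N \<otimes> Y \<oplus> q \<otimes> x \<in> carrier R" using x c q(1) by simp
  ultimately show ?case by (intro bexI[of _ "N \<otimes> Y \<oplus> q \<otimes> x"])
qed

text \<open>The remainder keeps two explicit factors, so that taking out one \<open>x - y\<close>
  leaves the derivative plus a multiple of \<open>x - y\<close>. The formula is used at
  \<open>\<xi>\<close> around the approximate root, and at the new root around
  \<open>\<xi>\<close>.\<close>

lemma (in cring) taylor:
  assumes x: "x \<in> carrier R" and y: "y \<in> carrier R" and c: "\<And>i. c i \<in> carrier R"
  shows "\<exists>q \<in> carrier R. (\<Oplus>i\<in>{..d}. c i \<otimes> x [^] i) =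
    (\<Oplus>i\<in>{..d}. c i \<otimes> y [^] i) \<oplus> (x \<ominus> y) \<otimes> (\<Oplus>i\<in>{..<d}. ([Suc i] \<cdot> c (Suc i)) \<otimes> y [^] i)
      \<oplus> (x \<ominus> y) \<otimes> ((x \<ominus> y) \<otimes> q)"
proof (induction d)
  case 0
  have "c 0 = c 0 \<oplus> (x \<ominus> y) \<otimes> \<zero> \<oplus> (x \<ominus> y) \<otimes> ((x \<ominus> y) \<otimes> \<zero>)" using x y c[of 0] by algebra
  then show ?case using x y c by (intro bexI[of _ \<zero>]) simp_all
next
  case (Suc d)
  define f where "f z = (\<Oplus>i\<in>{..d}. c i \<otimes> z [^] i)" for z
  define f' where "f' = (\<Oplus>i\<in>{..<d}. ([Suc i] \<cdot> c (Suc i)) \<otimes> y [^] i)"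
  obtain q where q: "q \<in> carrier R" "f x = f y \<oplus> (x \<ominus> y) \<otimes> f' \<oplus> (x \<ominus> y) \<otimes> ((x \<ominus> y) \<otimes> q)"
    using Suc unfolding f_def f'_def by blast
  obtain r where r: "r \<in> carrier R" "x [^] Suc d =
    y [^] Suc d \<oplus> (x \<ominus> y) \<otimes> (([Suc d] \<cdot> \<one>) \<otimes> y [^] d) \<oplus> (x \<ominus> y) \<otimes> ((x \<ominus> y) \<otimes> r)"
    using taylor_power[OF x y, of d] by blast
  have fc: "f x \<in> carrier R" "f y \<in> carrier R" "f' \<in> carrier R"
    using x y c by (auto simp: f_def f'_def intro!: finsum_closed)
  define C N Y Y' where "C = c (Suc d)" and "N = [Suc d] \<cdot> \<one>" and "Y = y [^] d" and "Y' = y [^] Suc d"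
  have cl: "C \<in> carrier R" "N \<in> carrier R" "Y \<in> carrier R" "Y' \<in> carrier R"
    using y c by (simp_all add: C_def N_def Y_def Y'_def)
  have NC: "[Suc d] \<cdot> C = C \<otimes> N" using cl(1) by (simp add: N_def add_pow_rdistr del: add.nat_pow_Suc)
  have 1: "(\<Oplus>i\<in>{..Suc d}. c i \<otimes> z [^] i) = C \<otimes> z [^] Suc d \<oplus> f z" if "z \<in> carrier R" for z
    unfolding f_def C_def using that c by (intro finsum_Suc) simp
  have 2: "(\<Oplus>i\<in>{..<Suc d}. ([Suc i] \<cdot> c (Suc i)) \<otimes> y [^] i) = (C \<otimes> N) \<otimes> Y \<oplus> f'"
  proof -
    have "(\<Oplus>i\<in>{..<Suc d}. ([Suc i] \<cdot> c (Suc i)) \<otimes> y [^] i) = ([Suc d] \<cdot> C) \<otimes> Y \<oplus> f'"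
      unfolding lessThan_Suc f'_def C_def Y_def using y c by (subst finsum_insert) auto
    then show ?thesis by (simp only: NC)
  qed
  have "C \<otimes> x [^] Suc d \<oplus> f x = C \<otimes> (Y' \<oplus> (x \<ominus> y) \<otimes> (N \<otimes> Y) \<oplus> (x \<ominus> y) \<otimes> ((x \<ominus> y) \<otimes> r))
      \<oplus> (f y \<oplus> (x \<ominus> y) \<otimes> f' \<oplus> (x \<ominus> y) \<otimes> ((x \<ominus> y) \<otimes> q))"
    unfolding q(2) r(2) by (simp only: N_def Y_def Y'_def)
  also have "\<dots> = (C \<otimes> Y' \<oplus> f y) \<oplus> (x \<ominus> y) \<otimes> ((C \<otimes> N) \<otimes> Y \<oplus> f') \<oplus> (x \<ominus> y) \<otimes> ((x \<ominus> y) \<otimes> (C \<otimes> r \<oplus> q))"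
  proof -
    have "C \<otimes> (Y' \<oplus> z \<otimes> (N \<otimes> Y) \<oplus> z \<otimes> (z \<otimes> r)) \<oplus> (u \<oplus> z \<otimes> f' \<oplus> z \<otimes> (z \<otimes> q))
      = (C \<otimes> Y' \<oplus> u) \<oplus> z \<otimes> ((C \<otimes> N) \<otimes> Y \<oplus> f') \<oplus> z \<otimes> (z \<otimes> (C \<otimes> r \<oplus> q))"
      if "z \<in> carrier R" "u \<in> carrier R" for z u
      using that cl fc(3) q(1) r(1) by algebra
    then show ?thesis using x y fc by simp
  qed
  finally show ?case
    unfolding 1[OF x] 1[OF y] 2 Y'_def[symmetric] using cl q(1) r(1)
    by (intro bexI[of _ "C \<otimes> r \<oplus> q"]) simp_all
qed

context monogenic_algebra
begin

lemma phi_eval: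
  assumes "x \<in> carrier A" "\<And>i. u i \<in> carrier A"
  shows "\<phi> (\<Oplus>i\<in>J. u i \<otimes> x [^] (i :: nat)) = (\<Oplus>\<^bsub>S\<^esub>i\<in>J. \<phi> (u i) \<otimes>\<^bsub>S\<^esub> \<phi> x [^]\<^bsub>S\<^esub> i)"
proof -
  have pow: "\<phi> (x [^] i) = \<phi> x [^]\<^bsub>S\<^esub> i" for i :: nat
    by (induction i) (use assms(1) in auto)
  have "\<phi> (\<Oplus>i\<in>J. u i \<otimes> x [^] i) = (\<Oplus>\<^bsub>S\<^esub>i\<in>J. \<phi> (u i \<otimes> x [^] i))"
    using assms by (subst hom_finsum) (auto simp: comp_def)
  also have "\<dots> = (\<Oplus>\<^bsub>S\<^esub>i\<in>J. \<phi> (u i) \<otimes>\<^bsub>S\<^esub> \<phi> x [^]\<^bsub>S\<^esub> i)"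
    using assms by (intro S.finsum_cong') (auto simp: pow)
  finally show ?thesis .
qed

text \<open>
  Nakayama's lemma by elimination: if \<open>y i \<in> A e + \<pi> span(y 0, ..., y (k-1))\<close> for all \<open>i\<close>, then
  the last generator can be eliminated because \<open>1 - \<pi> c\<close> is a unit.
\<close>

lemma eliminate_generators:
  assumes y: "\<And>i. y i \<in> carrier S" and e: "e \<in> carrier S" and \<pi>: "\<pi> \<in> carrier A"
    and unit: "\<And>x. x \<in> carrier A \<Longrightarrow> \<exists>z \<in> carrier A. (\<one> \<ominus> \<pi> \<otimes> x) \<otimes> z = \<one>"
    and span: "\<And>i. \<exists>\<alpha> u. \<alpha> \<in> carrier A \<and> (\<forall>j. u j \<in> carrier A) \<and>
      y i = \<phi> \<alpha> \<otimes>\<^bsub>S\<^esub> e \<oplus>\<^bsub>S\<^esub> \<phi> \<pi> \<otimes>\<^bsub>S\<^esub> (\<Oplus>\<^bsub>S\<^esub>j\<in>{..<k :: nat}. \<phi> (u j) \<otimes>\<^bsub>S\<^esub> y j)"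
  shows "\<exists>\<alpha> \<in> carrier A. y i = \<phi> \<alpha> \<otimes>\<^bsub>S\<^esub> e"
  using span
proof (induction k arbitrary: i)
  case 0
  then obtain \<alpha> where "\<alpha> \<in> carrier A" "y i = \<phi> \<alpha> \<otimes>\<^bsub>S\<^esub> e \<oplus>\<^bsub>S\<^esub> \<phi> \<pi> \<otimes>\<^bsub>S\<^esub> \<zero>\<^bsub>S\<^esub>"
    by (metis S.finsum_empty lessThan_0)
  then show ?case using e \<pi> by auto
next
  case (Suc k)
  define sm where "sm u = (\<Oplus>\<^bsub>S\<^esub>j\<in>{..<k}. \<phi> (u j) \<otimes>\<^bsub>S\<^esub> y j)" for u
  have sm: "sm u \<in> carrier S" if "\<And>j. u j \<in> carrier A" for u
    unfolding sm_def using that y by (intro S.finsum_closed) auto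
  have sm_Suc: "(\<Oplus>\<^bsub>S\<^esub>j\<in>{..<Suc k}. \<phi> (u j) \<otimes>\<^bsub>S\<^esub> y j) = \<phi> (u k) \<otimes>\<^bsub>S\<^esub> y k \<oplus>\<^bsub>S\<^esub> sm u"
    if "\<And>j. u j \<in> carrier A" for u
    unfolding sm_def lessThan_Suc using that y by (subst S.finsum_insert) auto
  have sm_lin: "sm u \<oplus>\<^bsub>S\<^esub> \<phi> b \<otimes>\<^bsub>S\<^esub> sm v = sm (\<lambda>j. u j \<oplus> b \<otimes> v j)"
    if "\<And>j. u j \<in> carrier A" "\<And>j. v j \<in> carrier A" "b \<in> carrier A" for u v b
  proof -
    have "sm (\<lambda>j. u j \<oplus> b \<otimes> v j) = (\<Oplus>\<^bsub>S\<^esub>j\<in>{..<k}. \<phi> (u j) \<otimes>\<^bsub>S\<^esub> y j \<oplus>\<^bsub>S\<^esub> \<phi> b \<otimes>\<^bsub>S\<^esub> (\<phi> (v j) \<otimes>\<^bsub>S\<^esub> y j))"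
      unfolding sm_def using that y by (intro S.finsum_cong') (auto simp: S.l_distr S.m_assoc)
    also have "\<dots> = sm u \<oplus>\<^bsub>S\<^esub> (\<Oplus>\<^bsub>S\<^esub>j\<in>{..<k}. \<phi> b \<otimes>\<^bsub>S\<^esub> (\<phi> (v j) \<otimes>\<^bsub>S\<^esub> y j))"
      unfolding sm_def using that y by (intro S.finsum_addf) auto
    also have "(\<Oplus>\<^bsub>S\<^esub>j\<in>{..<k}. \<phi> b \<otimes>\<^bsub>S\<^esub> (\<phi> (v j) \<otimes>\<^bsub>S\<^esub> y j)) = \<phi> b \<otimes>\<^bsub>S\<^esub> sm v"
      unfolding sm_def using that y by (intro S.finsum_rdistr[symmetric]) auto
    finally show ?thesis by simp
  qed
  obtain \<alpha> u where u: "\<alpha> \<in> carrier A" "\<And>j. u j \<in> carrier A"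
    "y k = \<phi> \<alpha> \<otimes>\<^bsub>S\<^esub> e \<oplus>\<^bsub>S\<^esub> \<phi> \<pi> \<otimes>\<^bsub>S\<^esub> (\<phi> (u k) \<otimes>\<^bsub>S\<^esub> y k \<oplus>\<^bsub>S\<^esub> sm u)"
    using Suc.prems[of k] sm_Suc by metis
  obtain z where z: "z \<in> carrier A" "(\<one> \<ominus> \<pi> \<otimes> u k) \<otimes> z = \<one>" using unit[OF u(2)] by blast
  \<comment> \<open>The relation for \<open>y k\<close> contains \<open>y k\<close> itself with
    coefficient \<open>\<pi> u_k\<close>. Collecting gives \<open>1 - \<pi> u_k\<close> as a factor,
    which \<open>z\<close> inverts.\<close>
  have "\<phi> z \<otimes>\<^bsub>S\<^esub> (\<phi> \<alpha> \<otimes>\<^bsub>S\<^esub> e \<oplus>\<^bsub>S\<^esub> \<phi> \<pi> \<otimes>\<^bsub>S\<^esub> sm u) = y k"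
  proof -
    have 1: "\<phi> z \<otimes>\<^bsub>S\<^esub> (\<one>\<^bsub>S\<^esub> \<ominus>\<^bsub>S\<^esub> \<phi> \<pi> \<otimes>\<^bsub>S\<^esub> \<phi> (u k)) = \<one>\<^bsub>S\<^esub>"
    proof -
      have "\<phi> ((\<one> \<ominus> \<pi> \<otimes> u k) \<otimes> z) = \<one>\<^bsub>S\<^esub>" unfolding z(2) by simp
      then show ?thesis using z(1) u(2)[of k] \<pi> by (simp add: R.minus_eq S.minus_eq S.m_comm)
    qed
    have "\<phi> \<alpha> \<otimes>\<^bsub>S\<^esub> e \<oplus>\<^bsub>S\<^esub> \<phi> \<pi> \<otimes>\<^bsub>S\<^esub> sm u = y k \<ominus>\<^bsub>S\<^esub> \<phi> \<pi> \<otimes>\<^bsub>S\<^esub> (\<phi> (u k) \<otimes>\<^bsub>S\<^esub> y k)"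
    proof -
      have "g \<oplus>\<^bsub>S\<^esub> P \<otimes>\<^bsub>S\<^esub> v = (g \<oplus>\<^bsub>S\<^esub> P \<otimes>\<^bsub>S\<^esub> (w \<oplus>\<^bsub>S\<^esub> v)) \<ominus>\<^bsub>S\<^esub> P \<otimes>\<^bsub>S\<^esub> w"
        if "g \<in> carrier S" "P \<in> carrier S" "w \<in> carrier S" "v \<in> carrier S" for g P w v using that by algebra
      from this[of "\<phi> \<alpha> \<otimes>\<^bsub>S\<^esub> e" "\<phi> \<pi>" "\<phi> (u k) \<otimes>\<^bsub>S\<^esub> y k" "sm u"] u \<pi> e y sm[OF u(2)]
      show ?thesis by simp
    qed
    also have "\<dots> = (\<one>\<^bsub>S\<^esub> \<ominus>\<^bsub>S\<^esub> \<phi> \<pi> \<otimes>\<^bsub>S\<^esub> \<phi> (u k)) \<otimes>\<^bsub>S\<^esub> y k"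
      using hom_closed[OF \<pi>] hom_closed[OF u(2)[of k]] y[of k] by algebra
    finally have "\<phi> z \<otimes>\<^bsub>S\<^esub> (\<phi> \<alpha> \<otimes>\<^bsub>S\<^esub> e \<oplus>\<^bsub>S\<^esub> \<phi> \<pi> \<otimes>\<^bsub>S\<^esub> sm u)
      = (\<phi> z \<otimes>\<^bsub>S\<^esub> (\<one>\<^bsub>S\<^esub> \<ominus>\<^bsub>S\<^esub> \<phi> \<pi> \<otimes>\<^bsub>S\<^esub> \<phi> (u k))) \<otimes>\<^bsub>S\<^esub> y k"
      using hom_closed[OF z(1)] hom_closed[OF \<pi>] hom_closed[OF u(2)[of k]] y[of k]
      by (simp add: S.m_assoc)
    then show ?thesis unfolding 1 using y by simp
  qed
  then have yk: "y k = \<phi> (z \<otimes> \<alpha>) \<otimes>\<^bsub>S\<^esub> e \<oplus>\<^bsub>S\<^esub> \<phi> \<pi> \<otimes>\<^bsub>S\<^esub> (\<phi> z \<otimes>\<^bsub>S\<^esub> sm u)"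
    using z(1) u(1) e \<pi> sm[OF u(2)] by (simp add: S.r_distr S.m_assoc S.m_lcomm[of "\<phi> z" "\<phi> \<pi>"])
  show ?case
  \<comment> \<open>Substituting the expression for \<open>y k\<close> leaves relations of the same
    shape in \<open>k\<close> generators, again with the factor \<open>\<pi>\<close> in
    front.\<close>
  proof (rule Suc.IH)
    fix i
    obtain \<beta> v where v: "\<beta> \<in> carrier A" "\<And>j. v j \<in> carrier A"
      "y i = \<phi> \<beta> \<otimes>\<^bsub>S\<^esub> e \<oplus>\<^bsub>S\<^esub> \<phi> \<pi> \<otimes>\<^bsub>S\<^esub> (\<phi> (v k) \<otimes>\<^bsub>S\<^esub> y k \<oplus>\<^bsub>S\<^esub> sm v)"
      using Suc.prems[of i] sm_Suc by metis
    have "y i = \<phi> (\<beta> \<oplus> \<pi> \<otimes> (v k \<otimes> (z \<otimes> \<alpha>))) \<otimes>\<^bsub>S\<^esub> e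
      \<oplus>\<^bsub>S\<^esub> \<phi> \<pi> \<otimes>\<^bsub>S\<^esub> (sm v \<oplus>\<^bsub>S\<^esub> \<phi> (\<pi> \<otimes> v k \<otimes> z) \<otimes>\<^bsub>S\<^esub> sm u)"
    proof -
      have "b \<otimes>\<^bsub>S\<^esub> e \<oplus>\<^bsub>S\<^esub> P \<otimes>\<^bsub>S\<^esub> (w \<otimes>\<^bsub>S\<^esub> (g \<otimes>\<^bsub>S\<^esub> e \<oplus>\<^bsub>S\<^esub> P \<otimes>\<^bsub>S\<^esub> (t \<otimes>\<^bsub>S\<^esub> s)) \<oplus>\<^bsub>S\<^esub> s')
        = (b \<oplus>\<^bsub>S\<^esub> P \<otimes>\<^bsub>S\<^esub> (w \<otimes>\<^bsub>S\<^esub> g)) \<otimes>\<^bsub>S\<^esub> e \<oplus>\<^bsub>S\<^esub> P \<otimes>\<^bsub>S\<^esub> (s' \<oplus>\<^bsub>S\<^esub> (P \<otimes>\<^bsub>S\<^esub> w \<otimes>\<^bsub>S\<^esub> t) \<otimes>\<^bsub>S\<^esub> s)"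
        if "b \<in> carrier S" "P \<in> carrier S" "w \<in> carrier S" "g \<in> carrier S" "t \<in> carrier S" "s \<in> carrier S" "s' \<in> carrier S"
        for b P w g t s s' using that e by algebra
      from this[of "\<phi> \<beta>" "\<phi> \<pi>" "\<phi> (v k)" "\<phi> (z \<otimes> \<alpha>)" "\<phi> z" "sm u" "sm v"]
      show ?thesis unfolding v(3) unfolding yk using u v z \<pi> e sm[OF u(2)] sm[OF v(2)] by simp
    qed
    also have "sm v \<oplus>\<^bsub>S\<^esub> \<phi> (\<pi> \<otimes> v k \<otimes> z) \<otimes>\<^bsub>S\<^esub> sm u = sm (\<lambda>j. v j \<oplus> (\<pi> \<otimes> v k \<otimes> z) \<otimes> u j)"
      using u v z \<pi> by (intro sm_lin) auto
    finally show "\<exists>\<alpha> u. \<alpha> \<in> carrier A \<and> (\<forall>j. u j \<in> carrier A) \<and>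
      y i = \<phi> \<alpha> \<otimes>\<^bsub>S\<^esub> e \<oplus>\<^bsub>S\<^esub> \<phi> \<pi> \<otimes>\<^bsub>S\<^esub> (\<Oplus>\<^bsub>S\<^esub>j\<in>{..<k}. \<phi> (u j) \<otimes>\<^bsub>S\<^esub> y j)"
      unfolding sm_def using u v z \<pi>
      by (intro exI[of _ "\<beta> \<oplus> \<pi> \<otimes> (v k \<otimes> (z \<otimes> \<alpha>))"] exI[of _ "\<lambda>j. v j \<oplus> (\<pi> \<otimes> v k \<otimes> z) \<otimes> u j"]) auto
  qed
qed

end

text \<open>The element \<open>g e + (1 - e)\<close> is 1 at every maximal ideal other than
  \<open>n\<close>, and its product with \<open>e\<close> is \<open>g e\<close>, which is not in
  \<open>n\<close>. So it is a unit, and \<open>h\<close> is \<open>e\<close> times its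
  inverse.\<close>

lemma (in cring) invertible_at_idempotent:
  assumes n: "maximalideal n R" and e: "e \<in> carrier R" "e \<otimes> e = e" "e \<notin> n"
    and others: "\<And>k. maximalideal k R \<Longrightarrow> k \<noteq> n \<Longrightarrow> e \<in> k"
    and g: "g \<in> carrier R" "g \<notin> n"
  shows "\<exists>h \<in> carrier R. g \<otimes> h = e \<and> e \<otimes> h = h"
proof -
  interpret n: maximalideal n R by (rule n)
  define u where "u = g \<otimes> e \<oplus> (\<one> \<ominus> e)"
  have uc: "u \<in> carrier R" using e g by (simp add: u_def)
  have ue: "e \<otimes> u = g \<otimes> e"
  proof -
    have "e \<otimes> u = g \<otimes> (e \<otimes> e) \<oplus> (e \<ominus> e \<otimes> e)" unfolding u_def using e(1) g(1) by algebra
    then show ?thesis unfolding e(2) using e(1) g(1) by (simp add: minus_eq r_neg)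
  qed
  have "u \<notin> k" if k: "maximalideal k R" for k
  proof
    interpret k: maximalideal k R by (rule k)
    assume "u \<in> k"
    show False
    proof (cases "k = n")
      case True
      have "e \<otimes> u \<in> n" using \<open>u \<in> k\<close> True e(1) n.I_l_closed by blast
      then show False using n.prime[OF is_cring g(1) e(1)] g(2) e(3) unfolding ue by blast
    next
      case False
      have ek: "e \<in> k" using others[OF k False] .
      have "u \<ominus> (g \<otimes> e \<ominus> e) \<in> k"
        unfolding minus_eq using \<open>u \<in> k\<close> ek g(1) by (intro k.a_closed k.a_inv_closed k.I_l_closed) auto
      moreover have "u \<ominus> (g \<otimes> e \<ominus> e) = \<one>" unfolding u_def using e(1) g(1) by algebra
      ultimately show False using k.one_notin by simp
    qed
  qed
  then obtain b where b: "b \<in> carrier R" "u \<otimes> b = \<one>" using unit_if_no_maximalideal[OF uc] by blast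
  have "g \<otimes> (e \<otimes> b) = (e \<otimes> u) \<otimes> b" unfolding ue using g(1) e(1) b(1) by (simp add: m_assoc)
  also have "\<dots> = e" using e(1) uc b by (simp add: m_assoc)
  finally have "g \<otimes> (e \<otimes> b) = e" .
  moreover have "e \<otimes> (e \<otimes> b) = e \<otimes> b" using m_assoc[OF e(1) e(1) b(1)] e(2) by simp
  ultimately show ?thesis using e(1) b(1) by blast
qed

text \<open>As \<open>e\<close> lies outside an ideal containing the image of \<open>m\<close>, some
  coordinate \<open>u i\<close> of \<open>e\<close> lies outside \<open>m\<close> and is a unit.
  Independence turns \<open>\<phi> r e = 0\<close> into \<open>r u_i = 0\<close>. Thus equations in
  \<open>A\<close> may be checked in the factor \<open>e S\<close>.\<close>

lemma (in monogenic_algebra) idempotent_faithful: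
  assumes units: "\<And>x. x \<in> carrier A \<Longrightarrow> x \<notin> m \<Longrightarrow> \<exists>y \<in> carrier A. x \<otimes> y = \<one>"
    and n: "ideal n S" "\<phi> ` m \<subseteq> n" and e: "e \<in> carrier S" "e \<notin> n"
    and r: "r \<in> carrier A" "\<phi> r \<otimes>\<^bsub>S\<^esub> e = \<zero>\<^bsub>S\<^esub>"
  shows "r = \<zero>"
proof -
  interpret n: ideal n S by (rule n)
  obtain u where u: "\<And>i. u i \<in> carrier A" "e = (\<Oplus>\<^bsub>S\<^esub>i\<in>{..<d}. \<phi> (u i) \<otimes>\<^bsub>S\<^esub> \<xi> [^]\<^bsub>S\<^esub> i)"
    using span[OF e(1)] by blast
  have "\<exists>i<d. u i \<notin> m"
  proof (rule ccontr)
    assume "\<not> ?thesis"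
    then have all: "u i \<in> m" if "i < d" for i using that by blast
    have "(\<Oplus>\<^bsub>S\<^esub>i\<in>J. \<phi> (u i) \<otimes>\<^bsub>S\<^esub> \<xi> [^]\<^bsub>S\<^esub> i) \<in> n" if "finite J" "J \<subseteq> {..<d}" for J
      using that
    proof (induction J)
      case empty
      then show ?case using n.zero_closed by simp
    next
      case (insert j J)
      have "\<phi> (u j) \<otimes>\<^bsub>S\<^esub> \<xi> [^]\<^bsub>S\<^esub> j \<in> n"
        using insert.prems all n(2) xi_closed by (intro n.I_r_closed) auto
      moreover have "(\<Oplus>\<^bsub>S\<^esub>i\<in>insert j J. \<phi> (u i) \<otimes>\<^bsub>S\<^esub> \<xi> [^]\<^bsub>S\<^esub> i)
          = \<phi> (u j) \<otimes>\<^bsub>S\<^esub> \<xi> [^]\<^bsub>S\<^esub> j \<oplus>\<^bsub>S\<^esub> (\<Oplus>\<^bsub>S\<^esub>i\<in>J. \<phi> (u i) \<otimes>\<^bsub>S\<^esub> \<xi> [^]\<^bsub>S\<^esub> i)"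
        using insert.hyps u(1) xi_closed by (intro S.finsum_insert) auto
      ultimately show ?case using insert by (simp add: n.a_closed)
    qed
    from this[of "{..<d}"] show False using e(2) u(2) by simp
  qed
  then obtain i where i: "i < d" "u i \<notin> m" by blast
  have "(\<Oplus>\<^bsub>S\<^esub>i\<in>{..<d}. \<phi> (r \<otimes> u i) \<otimes>\<^bsub>S\<^esub> \<xi> [^]\<^bsub>S\<^esub> i) = \<phi> r \<otimes>\<^bsub>S\<^esub> e"
  proof -
    have "(\<Oplus>\<^bsub>S\<^esub>i\<in>{..<d}. \<phi> (r \<otimes> u i) \<otimes>\<^bsub>S\<^esub> \<xi> [^]\<^bsub>S\<^esub> i)
        = (\<Oplus>\<^bsub>S\<^esub>i\<in>{..<d}. \<phi> r \<otimes>\<^bsub>S\<^esub> (\<phi> (u i) \<otimes>\<^bsub>S\<^esub> \<xi> [^]\<^bsub>S\<^esub> i))"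
      using r(1) u(1) xi_closed by (intro S.finsum_cong') (auto simp: S.m_assoc)
    also have "\<dots> = \<phi> r \<otimes>\<^bsub>S\<^esub> e"
      unfolding u(2) using r(1) u(1) xi_closed by (intro S.finsum_rdistr[symmetric]) auto
    finally show ?thesis .
  qed
  then have ru: "r \<otimes> u i = \<zero>"
    using independent[of "\<lambda>i. r \<otimes> u i" i] r u(1) i(1) by simp
  obtain y where y: "y \<in> carrier A" "u i \<otimes> y = \<one>" using units[OF u(1) i(2)] by blast
  have "r = r \<otimes> (u i \<otimes> y)" unfolding y(2) using r(1) by simp
  also have "\<dots> = (r \<otimes> u i) \<otimes> y" using r(1) u(1) y(1) by (simp add: R.m_assoc)
  finally show ?thesis unfolding ru using y(1) by simp
qed

text \<open>For \<open>z = \<xi> - a\<close>, Taylor's formula gives \<open>0 = f(a) + z g\<close>,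
  where \<open>g\<close> is \<open>f'(a)\<close> up to a multiple of \<open>z\<close> and hence
  invertible in \<open>e S\<close>. So there \<open>\<xi>\<close> agrees with \<open>a\<close>
  modulo the single element \<open>\<pi> = f(a)\<close>, which makes the elimination form of
  Nakayama's lemma applicable and yields \<open>\<xi> e = b e\<close>.\<close>

theorem (in monogenic_algebra) hensel_root:
  assumes tame: "tame_cring S p"
    and m: "ideal m A" "\<one> \<notin> m"
    and units: "\<And>x. x \<in> carrier A \<Longrightarrow> x \<notin> m \<Longrightarrow> \<exists>y \<in> carrier A. x \<otimes> y = \<one>"
    and a: "a \<in> carrier A" "(\<Oplus>i\<in>{..d}. c i \<otimes> a [^] i) \<in> m"
      "(\<Oplus>i\<in>{..<d}. ([Suc i] \<cdot> c (Suc i)) \<otimes> a [^] i) \<notin> m"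
  shows "\<exists>b \<in> carrier A. (\<Oplus>i\<in>{..d}. c i \<otimes> b [^] i) = \<zero> \<and> b \<ominus> a \<in> m"
proof -
  interpret m: ideal m A by (rule m)
  obtain n where n: "maximalideal n S" "\<phi> ` m \<subseteq> n" "\<xi> \<ominus>\<^bsub>S\<^esub> \<phi> a \<in> n"
    using maximalideal_over[OF a(1) m a(2)] by blast
  interpret n: maximalideal n S by (rule n(1))
  define f where "f x = (\<Oplus>i\<in>{..d}. c i \<otimes> x [^] i)" for x
  define f' where "f' = (\<Oplus>i\<in>{..<d}. ([Suc i] \<cdot> c (Suc i)) \<otimes> a [^] i)"
  define fS where "fS x = (\<Oplus>\<^bsub>S\<^esub>i\<in>{..d}. \<phi> (c i) \<otimes>\<^bsub>S\<^esub> x [^]\<^bsub>S\<^esub> i)" for x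
  have fc: "f x \<in> carrier A" if "x \<in> carrier A" for x
    unfolding f_def using that coeff_closed by (intro R.finsum_closed) auto
  have f'c: "f' \<in> carrier A" unfolding f'_def using a(1) coeff_closed by (intro R.finsum_closed) auto
  have phi_f: "\<phi> (f x) = fS (\<phi> x)" if "x \<in> carrier A" for x
    unfolding f_def fS_def by (rule phi_eval[OF that coeff_closed])
  have phi_f': "\<phi> f' = (\<Oplus>\<^bsub>S\<^esub>i\<in>{..<d}. ([Suc i] \<cdot>\<^bsub>S\<^esub> \<phi> (c (Suc i))) \<otimes>\<^bsub>S\<^esub> \<phi> a [^]\<^bsub>S\<^esub> i)"
  proof -
    have phi_add_pow: "\<phi> ([k] \<cdot> x) = [k] \<cdot>\<^bsub>S\<^esub> \<phi> x" if "x \<in> carrier A" for k :: nat and x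
      by (induction k) (use that in auto)
    have "\<phi> f' = (\<Oplus>\<^bsub>S\<^esub>i\<in>{..<d}. \<phi> ([Suc i] \<cdot> c (Suc i)) \<otimes>\<^bsub>S\<^esub> \<phi> a [^]\<^bsub>S\<^esub> i)"
      unfolding f'_def by (rule phi_eval[OF a(1)]) (use coeff_closed in simp)
    then show ?thesis using coeff_closed by (simp only: phi_add_pow)
  qed
  define \<pi> where "\<pi> = f a"
  have \<pi>: "\<pi> \<in> carrier A" "\<pi> \<in> m" using fc a(1,2) by (auto simp: \<pi>_def f_def)
  define z where "z = \<xi> \<ominus>\<^bsub>S\<^esub> \<phi> a"
  have zc: "z \<in> carrier S" using xi_closed a(1) by (simp add: z_def)
  have zn: "z \<in> n" using n(3) by (simp add: z_def)
  obtain q where q: "q \<in> carrier S" "fS \<xi> = fS (\<phi> a) \<oplus>\<^bsub>S\<^esub> z \<otimes>\<^bsub>S\<^esub> \<phi> f' \<oplus>\<^bsub>S\<^esub> z \<otimes>\<^bsub>S\<^esub> (z \<otimes>\<^bsub>S\<^esub> q)"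
    using S.taylor[OF xi_closed hom_closed[OF a(1)], of "\<lambda>i. \<phi> (c i)" d] coeff_closed
    unfolding fS_def z_def phi_f' by auto
  define g where "g = \<phi> f' \<oplus>\<^bsub>S\<^esub> z \<otimes>\<^bsub>S\<^esub> q"
  have gc: "g \<in> carrier S" using f'c zc q(1) by (simp add: g_def)
  have zg: "z \<otimes>\<^bsub>S\<^esub> g = \<ominus>\<^bsub>S\<^esub> \<phi> \<pi>"
  proof -
    have "fS \<xi> = \<zero>\<^bsub>S\<^esub>" unfolding fS_def by (rule root)
    then have "\<zero>\<^bsub>S\<^esub> = \<phi> \<pi> \<oplus>\<^bsub>S\<^esub> z \<otimes>\<^bsub>S\<^esub> \<phi> f' \<oplus>\<^bsub>S\<^esub> z \<otimes>\<^bsub>S\<^esub> (z \<otimes>\<^bsub>S\<^esub> q)"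
      using q(2) phi_f[OF a(1)] by (simp add: \<pi>_def)
    also have "\<dots> = z \<otimes>\<^bsub>S\<^esub> g \<oplus>\<^bsub>S\<^esub> \<phi> \<pi>"
      unfolding g_def using zc q(1) hom_closed[OF \<pi>(1)] hom_closed[OF f'c] by algebra
    finally show ?thesis
      using S.minus_equality[of "z \<otimes>\<^bsub>S\<^esub> g" "\<phi> \<pi>"] zc gc \<pi>(1) by simp
  qed
  \<comment> \<open>Otherwise the unit \<open>f'(a)\<close> of \<open>A\<close> would map into
    \<open>n\<close>, because \<open>z\<close> is in \<open>n\<close>.\<close>
  have gn: "g \<notin> n"
  proof
    assume "g \<in> n"
    then have "g \<ominus>\<^bsub>S\<^esub> z \<otimes>\<^bsub>S\<^esub> q \<in> n"
      unfolding S.minus_eq using zn q(1) by (intro n.a_closed n.a_inv_closed n.I_r_closed)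
    moreover have "g \<ominus>\<^bsub>S\<^esub> z \<otimes>\<^bsub>S\<^esub> q = \<phi> f'"
      unfolding g_def using zc q(1) hom_closed[OF f'c] by algebra
    ultimately have "\<phi> f' \<in> n" by simp
    moreover obtain y where y: "y \<in> carrier A" "f' \<otimes> y = \<one>" using units[OF f'c] a(3) by (auto simp: f'_def)
    ultimately have "\<phi> f' \<otimes>\<^bsub>S\<^esub> \<phi> y \<in> n" by (intro n.I_r_closed) auto
    moreover have "\<phi> f' \<otimes>\<^bsub>S\<^esub> \<phi> y = \<one>\<^bsub>S\<^esub>" using hom_mult[OF f'c y(1)] y(2) by simp
    ultimately show False using n.one_notin by simp
  qed
  obtain e where e: "e \<in> carrier S" "e \<otimes>\<^bsub>S\<^esub> e = e" "e \<notin> n" "\<And>k. maximalideal k S \<Longrightarrow> k \<noteq> n \<Longrightarrow> e \<in> k"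
    by (rule tame_cring.maximal_idempotent[OF tame n(1)]) (rule that)
  obtain h where h: "h \<in> carrier S" "g \<otimes>\<^bsub>S\<^esub> h = e" "e \<otimes>\<^bsub>S\<^esub> h = h"
    using S.invertible_at_idempotent[OF n(1) e gc gn] by blast
  \<comment> \<open>\<open>h\<close> inverts \<open>g\<close> within \<open>e S\<close>, so
    \<open>z g = -\<pi>\<close> makes \<open>z e\<close> divisible by \<open>\<pi>\<close>.\<close>
  have ze: "z \<otimes>\<^bsub>S\<^esub> e = \<ominus>\<^bsub>S\<^esub> (\<phi> \<pi> \<otimes>\<^bsub>S\<^esub> h)"
  proof -
    have "z \<otimes>\<^bsub>S\<^esub> e = (z \<otimes>\<^bsub>S\<^esub> g) \<otimes>\<^bsub>S\<^esub> h" unfolding h(2)[symmetric] using zc gc h(1) by (simp add: S.m_assoc)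
    then show ?thesis unfolding zg using \<pi>(1) h(1) by (simp add: S.l_minus)
  qed
  define y where "y i = \<xi> [^]\<^bsub>S\<^esub> i \<otimes>\<^bsub>S\<^esub> e" for i :: nat
  have yc: "y i \<in> carrier S" for i using xi_closed e(1) by (simp add: y_def)
  have xi_e: "\<xi> \<otimes>\<^bsub>S\<^esub> e = \<phi> a \<otimes>\<^bsub>S\<^esub> e \<ominus>\<^bsub>S\<^esub> \<phi> \<pi> \<otimes>\<^bsub>S\<^esub> h"
  proof -
    have "\<xi> \<otimes>\<^bsub>S\<^esub> e = \<phi> a \<otimes>\<^bsub>S\<^esub> e \<oplus>\<^bsub>S\<^esub> z \<otimes>\<^bsub>S\<^esub> e"
      unfolding z_def using xi_closed hom_closed[OF a(1)] e(1) by algebra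
    then show ?thesis unfolding ze by (simp add: S.minus_eq)
  qed
  have y_approx: "\<exists>s \<in> carrier S. y i = \<phi> (a [^] i) \<otimes>\<^bsub>S\<^esub> e \<oplus>\<^bsub>S\<^esub> \<phi> \<pi> \<otimes>\<^bsub>S\<^esub> s" for i
  proof (induction i)
    case 0
    then show ?case using e(1) \<pi>(1) by (intro bexI[of _ "\<zero>\<^bsub>S\<^esub>"]) (auto simp: y_def)
  next
    case (Suc i)
    then obtain s where s: "s \<in> carrier S" "y i = \<phi> (a [^] i) \<otimes>\<^bsub>S\<^esub> e \<oplus>\<^bsub>S\<^esub> \<phi> \<pi> \<otimes>\<^bsub>S\<^esub> s" by blast
    define \<alpha> where "\<alpha> = \<phi> (a [^] i)"
    have \<alpha>: "\<alpha> \<in> carrier S" "\<phi> (a [^] Suc i) = \<alpha> \<otimes>\<^bsub>S\<^esub> \<phi> a" using a(1) by (simp_all add: \<alpha>_def)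
    have "y (Suc i) = \<xi> \<otimes>\<^bsub>S\<^esub> y i"
      using xi_closed e(1) S.nat_pow_Suc2[OF xi_closed, of i] by (simp add: y_def S.m_assoc del: S.nat_pow_Suc)
    also have "\<dots> = \<alpha> \<otimes>\<^bsub>S\<^esub> (\<xi> \<otimes>\<^bsub>S\<^esub> e) \<oplus>\<^bsub>S\<^esub> \<phi> \<pi> \<otimes>\<^bsub>S\<^esub> (\<xi> \<otimes>\<^bsub>S\<^esub> s)"
      unfolding s(2) \<alpha>_def[symmetric] using \<alpha>(1) xi_closed e(1) s(1) hom_closed[OF \<pi>(1)] by algebra
    also have "\<dots> = (\<alpha> \<otimes>\<^bsub>S\<^esub> \<phi> a) \<otimes>\<^bsub>S\<^esub> e \<oplus>\<^bsub>S\<^esub> \<phi> \<pi> \<otimes>\<^bsub>S\<^esub> (\<xi> \<otimes>\<^bsub>S\<^esub> s \<ominus>\<^bsub>S\<^esub> \<alpha> \<otimes>\<^bsub>S\<^esub> h)"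
      unfolding xi_e using \<alpha>(1) xi_closed e(1) s(1) h(1) hom_closed[OF \<pi>(1)] hom_closed[OF a(1)] by algebra
    finally show ?case unfolding \<alpha>(2) using \<alpha>(1) xi_closed s(1) h(1) by blast
  qed
  \<comment> \<open>Multiplying the approximation by \<open>e\<close> keeps \<open>y i\<close> fixed
    and places the error in the span of the generators \<open>y j\<close>.\<close>
  have y_span: "\<exists>\<alpha> u. \<alpha> \<in> carrier A \<and> (\<forall>j. u j \<in> carrier A) \<and>
      y i = \<phi> \<alpha> \<otimes>\<^bsub>S\<^esub> e \<oplus>\<^bsub>S\<^esub> \<phi> \<pi> \<otimes>\<^bsub>S\<^esub> (\<Oplus>\<^bsub>S\<^esub>j\<in>{..<d}. \<phi> (u j) \<otimes>\<^bsub>S\<^esub> y j)" for i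
  proof -
    obtain s where s: "s \<in> carrier S" "y i = \<phi> (a [^] i) \<otimes>\<^bsub>S\<^esub> e \<oplus>\<^bsub>S\<^esub> \<phi> \<pi> \<otimes>\<^bsub>S\<^esub> s"
      using y_approx by blast
    obtain u where u: "\<And>i. u i \<in> carrier A" "s = (\<Oplus>\<^bsub>S\<^esub>i\<in>{..<d}. \<phi> (u i) \<otimes>\<^bsub>S\<^esub> \<xi> [^]\<^bsub>S\<^esub> i)"
      using span[OF s(1)] by blast
    have "s \<otimes>\<^bsub>S\<^esub> e = (\<Oplus>\<^bsub>S\<^esub>i\<in>{..<d}. (\<phi> (u i) \<otimes>\<^bsub>S\<^esub> \<xi> [^]\<^bsub>S\<^esub> i) \<otimes>\<^bsub>S\<^esub> e)"
      unfolding u(2) using u(1) xi_closed e(1) by (intro S.finsum_ldistr) auto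
    also have "\<dots> = (\<Oplus>\<^bsub>S\<^esub>j\<in>{..<d}. \<phi> (u j) \<otimes>\<^bsub>S\<^esub> y j)"
      using u(1) xi_closed e(1) yc by (intro S.finsum_cong') (auto simp: y_def S.m_assoc)
    finally have se: "s \<otimes>\<^bsub>S\<^esub> e = (\<Oplus>\<^bsub>S\<^esub>j\<in>{..<d}. \<phi> (u j) \<otimes>\<^bsub>S\<^esub> y j)" .
    have "y i = y i \<otimes>\<^bsub>S\<^esub> e" using xi_closed e(1,2) by (simp add: y_def S.m_assoc)
    also have "\<dots> = \<phi> (a [^] i) \<otimes>\<^bsub>S\<^esub> (e \<otimes>\<^bsub>S\<^esub> e) \<oplus>\<^bsub>S\<^esub> \<phi> \<pi> \<otimes>\<^bsub>S\<^esub> (s \<otimes>\<^bsub>S\<^esub> e)"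
      unfolding s(2) using e(1) s(1) hom_closed[OF \<pi>(1)] hom_closed[of "a [^] i"] a(1)
      by (simp add: S.l_distr S.m_assoc)
    finally have "y i = \<phi> (a [^] i) \<otimes>\<^bsub>S\<^esub> e \<oplus>\<^bsub>S\<^esub> \<phi> \<pi> \<otimes>\<^bsub>S\<^esub> (\<Oplus>\<^bsub>S\<^esub>j\<in>{..<d}. \<phi> (u j) \<otimes>\<^bsub>S\<^esub> y j)"
      unfolding e(2) se .
    then show ?thesis using a(1) u(1) by (intro exI[of _ "a [^] i"] exI[of _ u]) simp
  qed
  have unit: "\<exists>w \<in> carrier A. (\<one> \<ominus> \<pi> \<otimes> x) \<otimes> w = \<one>" if x: "x \<in> carrier A" for x
  proof (rule units)
    show "\<one> \<ominus> \<pi> \<otimes> x \<in> carrier A" using x \<pi>(1) by simp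
    show "\<one> \<ominus> \<pi> \<otimes> x \<notin> m"
    proof
      assume "\<one> \<ominus> \<pi> \<otimes> x \<in> m"
      then have "(\<one> \<ominus> \<pi> \<otimes> x) \<oplus> \<pi> \<otimes> x \<in> m" using \<pi>(2) x by (intro m.a_closed m.I_r_closed)
      moreover have "(\<one> \<ominus> \<pi> \<otimes> x) \<oplus> \<pi> \<otimes> x = \<one>" using x \<pi>(1) by algebra
      ultimately show False using m(2) by simp
    qed
  qed
  \<comment> \<open>The index 1 need not be below \<open>d\<close>, which is why the relations are
    stated for every \<open>i\<close>.\<close>
  obtain b where b: "b \<in> carrier A" "y 1 = \<phi> b \<otimes>\<^bsub>S\<^esub> e"
    using eliminate_generators[OF yc e(1) \<pi>(1) unit y_span, of 1] by blast
  have xb: "\<xi> \<otimes>\<^bsub>S\<^esub> e = \<phi> b \<otimes>\<^bsub>S\<^esub> e" using b(2) xi_closed by (simp add: y_def)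
  \<comment> \<open>In \<open>e S\<close> the images of \<open>b\<close> and \<open>\<xi>\<close>
    coincide, so expanding around the root \<open>\<xi>\<close> leaves only multiples of
    \<open>t e = 0\<close>.\<close>
  have "\<phi> (f b) \<otimes>\<^bsub>S\<^esub> e = \<zero>\<^bsub>S\<^esub>"
  proof -
    define t where "t = \<phi> b \<ominus>\<^bsub>S\<^esub> \<xi>"
    have tc: "t \<in> carrier S" using b(1) xi_closed by (simp add: t_def)
    have te: "t \<otimes>\<^bsub>S\<^esub> e = \<zero>\<^bsub>S\<^esub>"
    proof -
      have "t \<otimes>\<^bsub>S\<^esub> e = \<phi> b \<otimes>\<^bsub>S\<^esub> e \<ominus>\<^bsub>S\<^esub> \<xi> \<otimes>\<^bsub>S\<^esub> e"
        unfolding t_def using xi_closed hom_closed[OF b(1)] e(1) by algebra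
      then show ?thesis unfolding xb using b(1) e(1) by (simp add: S.minus_eq S.r_neg)
    qed
    define D where "D = (\<Oplus>\<^bsub>S\<^esub>i\<in>{..<d}. ([Suc i] \<cdot>\<^bsub>S\<^esub> \<phi> (c (Suc i))) \<otimes>\<^bsub>S\<^esub> \<xi> [^]\<^bsub>S\<^esub> i)"
    have Dc: "D \<in> carrier S" unfolding D_def using xi_closed coeff_closed by (intro S.finsum_closed) auto
    obtain q where q: "q \<in> carrier S" "fS (\<phi> b) = fS \<xi> \<oplus>\<^bsub>S\<^esub> t \<otimes>\<^bsub>S\<^esub> D \<oplus>\<^bsub>S\<^esub> t \<otimes>\<^bsub>S\<^esub> (t \<otimes>\<^bsub>S\<^esub> q)"
      using S.taylor[OF hom_closed[OF b(1)] xi_closed, of "\<lambda>i. \<phi> (c i)" d] coeff_closed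
      unfolding fS_def t_def D_def by auto
    have "fS \<xi> = \<zero>\<^bsub>S\<^esub>" unfolding fS_def by (rule root)
    then have "\<phi> (f b) = t \<otimes>\<^bsub>S\<^esub> (D \<oplus>\<^bsub>S\<^esub> t \<otimes>\<^bsub>S\<^esub> q)"
      using q phi_f[OF b(1)] tc Dc by (simp add: S.r_distr)
    then have "\<phi> (f b) \<otimes>\<^bsub>S\<^esub> e = (t \<otimes>\<^bsub>S\<^esub> e) \<otimes>\<^bsub>S\<^esub> (D \<oplus>\<^bsub>S\<^esub> t \<otimes>\<^bsub>S\<^esub> q)"
      using tc Dc q(1) e(1) by (simp add: S.m_assoc S.m_comm[of _ e])
    then show ?thesis unfolding te using tc Dc q(1) by simp
  qed
  then have "f b = \<zero>"
    using idempotent_faithful[OF units n.is_ideal n(2) e(1,3) fc[OF b(1)]] by blast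
  moreover have "b \<ominus> a \<in> m"
  proof (rule ccontr)
    \<comment> \<open>With \<open>b - a\<close> a unit, \<open>\<phi> (b - a) e = z e\<close> in
      \<open>n\<close> would force \<open>e\<close> into \<open>n\<close>.\<close>
    assume "b \<ominus> a \<notin> m"
    then obtain y where y: "y \<in> carrier A" "(b \<ominus> a) \<otimes> y = \<one>" using units[of "b \<ominus> a"] a(1) b(1) by auto
    have "\<phi> (b \<ominus> a) \<otimes>\<^bsub>S\<^esub> e = z \<otimes>\<^bsub>S\<^esub> e"
    proof -
      have "\<phi> (b \<ominus> a) \<otimes>\<^bsub>S\<^esub> e = \<phi> b \<otimes>\<^bsub>S\<^esub> e \<ominus>\<^bsub>S\<^esub> \<phi> a \<otimes>\<^bsub>S\<^esub> e"
        using a(1) b(1) e(1) by (simp add: R.minus_eq S.minus_eq S.l_distr S.l_minus)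
      also have "\<dots> = z \<otimes>\<^bsub>S\<^esub> e"
        unfolding xb[symmetric] z_def using xi_closed hom_closed[OF a(1)] e(1) by algebra
      finally show ?thesis .
    qed
    also have "z \<otimes>\<^bsub>S\<^esub> e \<in> n" using zn e(1) by (rule n.I_r_closed)
    finally have "\<phi> (b \<ominus> a) \<otimes>\<^bsub>S\<^esub> e \<in> n" .
    from n.I_l_closed[OF this hom_closed[OF y(1)]]
    have "\<phi> y \<otimes>\<^bsub>S\<^esub> (\<phi> (b \<ominus> a) \<otimes>\<^bsub>S\<^esub> e) \<in> n" .
    moreover have "\<phi> y \<otimes>\<^bsub>S\<^esub> (\<phi> (b \<ominus> a) \<otimes>\<^bsub>S\<^esub> e) = \<phi> ((b \<ominus> a) \<otimes> y) \<otimes>\<^bsub>S\<^esub> e"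
      using y(1) a(1) b(1) e(1) hom_mult[of "b \<ominus> a" y] S.m_comm[of "\<phi> y" "\<phi> (b \<ominus> a)"]
      by (simp add: S.m_assoc[symmetric] del: hom_mult)
    ultimately show False unfolding y(2) using e(1,3) by simp
  qed
  ultimately show ?thesis using b(1) unfolding f_def by blast
qed

section \<open>Factors of a ring defined by idempotents\<close>

text \<open>The factor \<open>e R\<close>, described by fixed points within the type of
  \<open>R\<close>, so that all factors fit into one list.\<close>

definition corner :: "('a, 'm) ring_scheme \<Rightarrow> 'a \<Rightarrow> 'a ring" where
  "corner R e = \<lparr>carrier = {x \<in> carrier R. e \<otimes>\<^bsub>R\<^esub> x = x}, mult = mult R, one = e, zero = \<zero>\<^bsub>R\<^esub>, add = add R\<rparr>"

lemma corner_simps: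
  "carrier (corner R e) = {x \<in> carrier R. e \<otimes>\<^bsub>R\<^esub> x = x}" "mult (corner R e) = mult R"
  "\<one>\<^bsub>corner R e\<^esub> = e" "\<zero>\<^bsub>corner R e\<^esub> = \<zero>\<^bsub>R\<^esub>" "add (corner R e) = add R"
  by (simp_all add: corner_def)

locale idempotent_corner = cring R for R (structure) +
  fixes e
  assumes e_closed: "e \<in> carrier R" and idem: "e \<otimes> e = e"
begin

lemma corner_mem: "x \<in> carrier R \<Longrightarrow> e \<otimes> x \<in> carrier (corner R e)"
  using m_assoc[OF e_closed e_closed, of x] e_closed by (simp add: corner_simps idem)

lemma corner_cring: "cring (corner R e)"
proof (rule cringI)
  show "abelian_group (corner R e)"
  proof (rule abelian_groupI)
    fix x assume x: "x \<in> carrier (corner R e)"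
    then have "\<ominus> x \<in> carrier (corner R e)" "\<ominus> x \<oplus> x = \<zero>"
      using e_closed by (auto simp: corner_simps r_minus l_neg)
    then show "\<exists>y\<in>carrier (corner R e). y \<oplus>\<^bsub>corner R e\<^esub> x = \<zero>\<^bsub>corner R e\<^esub>"
      by (auto simp: corner_simps)
  qed (use e_closed in \<open>auto simp: corner_simps r_distr a_assoc intro: a_comm\<close>)
  show "comm_monoid (corner R e)"
  proof (rule comm_monoidI)
    fix x y assume "x \<in> carrier (corner R e)" "y \<in> carrier (corner R e)"
    then show "x \<otimes>\<^bsub>corner R e\<^esub> y \<in> carrier (corner R e)"
      using m_assoc[OF e_closed, of x y] e_closed by (auto simp: corner_simps)
  qed (use e_closed idem in \<open>auto simp: corner_simps m_assoc intro: m_comm\<close>)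
qed (auto simp: corner_simps l_distr)

lemma corner_hom: "ring_hom_cring R (corner R e) (\<lambda>x. e \<otimes> x)"
proof (intro ring_hom_cring.intro ring_hom_cring_axioms.intro is_cring corner_cring ring_hom_memI)
  show "e \<otimes> x \<in> carrier (corner R e)" if "x \<in> carrier R" for x using corner_mem[OF that] .
  show "e \<otimes> (x \<otimes> y) = (e \<otimes> x) \<otimes>\<^bsub>corner R e\<^esub> (e \<otimes> y)" if "x \<in> carrier R" "y \<in> carrier R" for x y
  proof -
    have "(e \<otimes> x) \<otimes> (e \<otimes> y) = (e \<otimes> e) \<otimes> (x \<otimes> y)"
      using that e_closed by (simp add: m_assoc m_lcomm[of x e])
    then show ?thesis by (simp add: idem corner_simps)
  qed
qed (use e_closed in \<open>auto simp: corner_simps r_distr\<close>)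

end

section \<open>Monogenic algebras over quotients are coded by tuples\<close>

text \<open>Two layers are composed: elements of \<open>B\<close> represent those of
  \<open>A\<close> up to the kernel of \<open>\<pi>\<close>, which \<open>\<epsilon>\<close>
  detects, and \<open>d\<close>-tuples over \<open>A\<close> represent those of \<open>S\<close> by
  freeness. The structure constants are lifted coordinates of the products of powers of
  \<open>\<xi>\<close>.\<close>

lemma (in monogenic_algebra) coded:
  fixes B :: "('base, 'k) ring_scheme"
  assumes hom: "ring_hom_cring B A \<pi>" and e: "\<epsilon> \<in> carrier B"
    and surj: "\<And>x. x \<in> carrier A \<Longrightarrow> \<exists>y \<in> carrier B. \<pi> y = x"
    and ker: "\<And>x y. x \<in> carrier B \<Longrightarrow> y \<in> carrier B \<Longrightarrow> \<pi> x = \<pi> y \<longleftrightarrow> \<epsilon> \<otimes>\<^bsub>B\<^esub> x = \<epsilon> \<otimes>\<^bsub>B\<^esub> y"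
  shows "\<exists>\<beta> \<gamma>. coded_ring B S d \<epsilon> \<beta> \<gamma>"
proof -
  interpret pi: ring_hom_cring B A \<pi> by (rule hom)
  define \<psi> where "\<psi> x = \<phi> (\<pi> x)" for x
  interpret psi: ring_hom_cring B S \<psi>
    by (intro ring_hom_cring.intro ring_hom_cring_axioms.intro pi.R.is_cring S.is_cring ring_hom_memI)
      (auto simp: \<psi>_def)
  define \<beta> where "\<beta> u = (\<Oplus>\<^bsub>S\<^esub>i\<in>{..<d}. \<psi> (u i) \<otimes>\<^bsub>S\<^esub> \<xi> [^]\<^bsub>S\<^esub> i)" for u
  have closed: "\<beta> u \<in> carrier S" if "range u \<subseteq> carrier B" for u
    unfolding \<beta>_def using that xi_closed by (intro S.finsum_closed) (auto simp: image_subset_iff)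
  have add: "\<beta> u \<oplus>\<^bsub>S\<^esub> \<beta> v = \<beta> (\<lambda>i. u i \<oplus>\<^bsub>B\<^esub> v i)" if uv: "range u \<subseteq> carrier B" "range v \<subseteq> carrier B" for u v
  proof -
    have "u i \<in> carrier B" "v i \<in> carrier B" for i using uv by auto
    then have "\<beta> (\<lambda>i. u i \<oplus>\<^bsub>B\<^esub> v i)
      = (\<Oplus>\<^bsub>S\<^esub>i\<in>{..<d}. \<psi> (u i) \<otimes>\<^bsub>S\<^esub> \<xi> [^]\<^bsub>S\<^esub> i \<oplus>\<^bsub>S\<^esub> \<psi> (v i) \<otimes>\<^bsub>S\<^esub> \<xi> [^]\<^bsub>S\<^esub> i)"
      unfolding \<beta>_def using xi_closed by (intro S.finsum_cong') (auto simp: S.l_distr)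
    also have "\<dots> = \<beta> u \<oplus>\<^bsub>S\<^esub> \<beta> v"
      unfolding \<beta>_def using \<open>\<And>i. u i \<in> _\<close> \<open>\<And>i. v i \<in> _\<close> xi_closed by (intro S.finsum_addf) auto
    finally show ?thesis by simp
  qed
  have scale: "\<psi> r \<otimes>\<^bsub>S\<^esub> \<beta> u = \<beta> (\<lambda>i. u i \<otimes>\<^bsub>B\<^esub> r)" if r: "r \<in> carrier B" and u: "range u \<subseteq> carrier B" for r u
  proof -
    have u': "u i \<in> carrier B" for i using u by auto
    have "\<beta> (\<lambda>i. u i \<otimes>\<^bsub>B\<^esub> r) = (\<Oplus>\<^bsub>S\<^esub>i\<in>{..<d}. \<psi> r \<otimes>\<^bsub>S\<^esub> (\<psi> (u i) \<otimes>\<^bsub>S\<^esub> \<xi> [^]\<^bsub>S\<^esub> i))"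
      unfolding \<beta>_def using r u' xi_closed
      by (intro S.finsum_cong') (auto simp: S.m_assoc S.m_comm[of "\<psi> (u _)" "\<psi> r"] S.m_lcomm)
    also have "\<dots> = \<psi> r \<otimes>\<^bsub>S\<^esub> \<beta> u"
      unfolding \<beta>_def using r u' xi_closed by (intro S.finsum_rdistr[symmetric]) auto
    finally show ?thesis by simp
  qed
  have zero: "\<beta> (\<lambda>i. \<zero>\<^bsub>B\<^esub>) = \<zero>\<^bsub>S\<^esub>"
  proof -
    have "\<beta> (\<lambda>i. \<zero>\<^bsub>B\<^esub>) = (\<Oplus>\<^bsub>S\<^esub>i\<in>{..<d}. \<zero>\<^bsub>S\<^esub>)"
      unfolding \<beta>_def using xi_closed by (intro S.finsum_cong') auto
    then show ?thesis by simp
  qed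
  have sum: "(\<Oplus>\<^bsub>S\<^esub>i\<in>I. \<beta> (w i)) = \<beta> (\<lambda>l. \<Oplus>\<^bsub>B\<^esub>i\<in>I. w i l)"
    if "finite I" and w: "\<And>i. range (w i) \<subseteq> carrier B" for w and I :: "nat set"
    using that(1)
  proof (induction I)
    case empty
    then show ?case using zero by simp
  next
    case (insert j I)
    have w': "w i l \<in> carrier B" for i l using w[of i] by auto
    have "(\<Oplus>\<^bsub>S\<^esub>i\<in>insert j I. \<beta> (w i)) = \<beta> (w j) \<oplus>\<^bsub>S\<^esub> (\<Oplus>\<^bsub>S\<^esub>i\<in>I. \<beta> (w i))"
      using insert.hyps closed[OF w] by (intro S.finsum_insert) auto
    also have "\<dots> = \<beta> (w j) \<oplus>\<^bsub>S\<^esub> \<beta> (\<lambda>l. \<Oplus>\<^bsub>B\<^esub>i\<in>I. w i l)" using insert.IH by simp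
    also have "\<dots> = \<beta> (\<lambda>l. w j l \<oplus>\<^bsub>B\<^esub> (\<Oplus>\<^bsub>B\<^esub>i\<in>I. w i l))"
      by (rule add) (use w' in \<open>auto intro!: pi.R.finsum_closed\<close>)
    also have "(\<lambda>l. w j l \<oplus>\<^bsub>B\<^esub> (\<Oplus>\<^bsub>B\<^esub>i\<in>I. w i l)) = (\<lambda>l. \<Oplus>\<^bsub>B\<^esub>i\<in>insert j I. w i l)"
      using insert.hyps w' by (intro ext pi.R.finsum_insert[symmetric]) auto
    finally show ?case .
  qed
  have surj': "\<exists>u. range u \<subseteq> carrier B \<and> \<beta> u = s" if s: "s \<in> carrier S" for s
  proof -
    obtain u where u: "\<And>i. u i \<in> carrier A" "s = (\<Oplus>\<^bsub>S\<^esub>i\<in>{..<d}. \<phi> (u i) \<otimes>\<^bsub>S\<^esub> \<xi> [^]\<^bsub>S\<^esub> i)"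
      using span[OF s] by blast
    have "\<forall>i. \<exists>y. y \<in> carrier B \<and> \<pi> y = u i" using surj[OF u(1)] by blast
    from choice[OF this] obtain v where v: "\<And>i. v i \<in> carrier B" "\<And>i. \<pi> (v i) = u i" by blast
    have "\<beta> v = s" unfolding \<beta>_def \<psi>_def v(2) u(2) ..
    with v(1) show ?thesis by (intro exI[of _ v]) auto
  qed
  have "\<forall>ij :: nat \<times> nat. \<exists>u. range u \<subseteq> carrier B \<and> \<beta> u = \<xi> [^]\<^bsub>S\<^esub> fst ij \<otimes>\<^bsub>S\<^esub> \<xi> [^]\<^bsub>S\<^esub> snd ij"
    by (intro allI surj' S.m_closed S.nat_pow_closed xi_closed)
  from choice[OF this] obtain \<gamma>' where
    g: "\<And>ij :: nat \<times> nat. range (\<gamma>' ij) \<subseteq> carrier B" "\<And>ij. \<beta> (\<gamma>' ij) = \<xi> [^]\<^bsub>S\<^esub> fst ij \<otimes>\<^bsub>S\<^esub> \<xi> [^]\<^bsub>S\<^esub> snd ij" by blast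
  define \<gamma> where "\<gamma> i j = \<gamma>' (i, j)" for i j :: nat
  have gc: "\<gamma> i j l \<in> carrier B" for i j l using g(1)[of "(i, j)"] by (auto simp: \<gamma>_def)
  have gb: "\<beta> (\<gamma> i j) = \<xi> [^]\<^bsub>S\<^esub> i \<otimes>\<^bsub>S\<^esub> \<xi> [^]\<^bsub>S\<^esub> j" for i j using g(2)[of "(i, j)"] by (simp add: \<gamma>_def)
  have "coded_ring B S d \<epsilon> \<beta> \<gamma>"
  proof (intro coded_ring.intro coded_ring_axioms.intro pi.R.is_cring S.is_cring e gc closed surj' add)
    fix u v :: "nat \<Rightarrow> 'base" assume uv: "range u \<subseteq> carrier B" "range v \<subseteq> carrier B"
    have u: "u i \<in> carrier B" and v: "v i \<in> carrier B" for i using uv by auto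
    have product: "(\<psi> (u i) \<otimes>\<^bsub>S\<^esub> \<xi> [^]\<^bsub>S\<^esub> i) \<otimes>\<^bsub>S\<^esub> (\<psi> (v j) \<otimes>\<^bsub>S\<^esub> \<xi> [^]\<^bsub>S\<^esub> j)
        = \<beta> (\<lambda>l. \<gamma> i j l \<otimes>\<^bsub>B\<^esub> (u i \<otimes>\<^bsub>B\<^esub> v j))" for i j
    proof -
      have "(\<psi> (u i) \<otimes>\<^bsub>S\<^esub> \<xi> [^]\<^bsub>S\<^esub> i) \<otimes>\<^bsub>S\<^esub> (\<psi> (v j) \<otimes>\<^bsub>S\<^esub> \<xi> [^]\<^bsub>S\<^esub> j)
        = \<psi> (u i \<otimes>\<^bsub>B\<^esub> v j) \<otimes>\<^bsub>S\<^esub> \<beta> (\<gamma> i j)"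
        unfolding gb using u v xi_closed by (simp add: S.m_assoc S.m_lcomm[of "\<xi> [^]\<^bsub>S\<^esub> i" "\<psi> (v j)"])
      also have "\<dots> = \<beta> (\<lambda>l. \<gamma> i j l \<otimes>\<^bsub>B\<^esub> (u i \<otimes>\<^bsub>B\<^esub> v j))"
        by (rule scale) (use u v gc in auto)
      finally show ?thesis .
    qed
    have "\<beta> u \<otimes>\<^bsub>S\<^esub> \<beta> v = (\<Oplus>\<^bsub>S\<^esub>i\<in>{..<d}. (\<psi> (u i) \<otimes>\<^bsub>S\<^esub> \<xi> [^]\<^bsub>S\<^esub> i) \<otimes>\<^bsub>S\<^esub> \<beta> v)"
      unfolding \<beta>_def[of u] using u xi_closed closed[OF uv(2)] by (intro S.finsum_ldistr) auto
    also have "\<dots> = (\<Oplus>\<^bsub>S\<^esub>i\<in>{..<d}. \<beta> (\<lambda>l. \<Oplus>\<^bsub>B\<^esub>j\<in>{..<d}. \<gamma> i j l \<otimes>\<^bsub>B\<^esub> (u i \<otimes>\<^bsub>B\<^esub> v j)))"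
    proof (rule S.finsum_cong')
      fix i
      have "(\<psi> (u i) \<otimes>\<^bsub>S\<^esub> \<xi> [^]\<^bsub>S\<^esub> i) \<otimes>\<^bsub>S\<^esub> \<beta> v
        = (\<Oplus>\<^bsub>S\<^esub>j\<in>{..<d}. (\<psi> (u i) \<otimes>\<^bsub>S\<^esub> \<xi> [^]\<^bsub>S\<^esub> i) \<otimes>\<^bsub>S\<^esub> (\<psi> (v j) \<otimes>\<^bsub>S\<^esub> \<xi> [^]\<^bsub>S\<^esub> j))"
        unfolding \<beta>_def[of v] using u v xi_closed by (intro S.finsum_rdistr) auto
      also have "\<dots> = \<beta> (\<lambda>l. \<Oplus>\<^bsub>B\<^esub>j\<in>{..<d}. \<gamma> i j l \<otimes>\<^bsub>B\<^esub> (u i \<otimes>\<^bsub>B\<^esub> v j))"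
        unfolding product by (rule sum) (use u v gc in auto)
      finally show "(\<psi> (u i) \<otimes>\<^bsub>S\<^esub> \<xi> [^]\<^bsub>S\<^esub> i) \<otimes>\<^bsub>S\<^esub> \<beta> v
        = \<beta> (\<lambda>l. \<Oplus>\<^bsub>B\<^esub>j\<in>{..<d}. \<gamma> i j l \<otimes>\<^bsub>B\<^esub> (u i \<otimes>\<^bsub>B\<^esub> v j))" .
    qed (use u v gc in \<open>auto intro!: closed pi.R.finsum_closed\<close>)
    also have "\<dots> = \<beta> (\<lambda>l. \<Oplus>\<^bsub>B\<^esub>i\<in>{..<d}. \<Oplus>\<^bsub>B\<^esub>j\<in>{..<d}. \<gamma> i j l \<otimes>\<^bsub>B\<^esub> (u i \<otimes>\<^bsub>B\<^esub> v j))"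
      by (rule sum) (use u v gc in \<open>auto intro!: pi.R.finsum_closed\<close>)
    finally show "\<beta> u \<otimes>\<^bsub>S\<^esub> \<beta> v = \<beta> (\<lambda>l. \<Oplus>\<^bsub>B\<^esub>i\<in>{..<d}. \<Oplus>\<^bsub>B\<^esub>j\<in>{..<d}. \<gamma> i j l \<otimes>\<^bsub>B\<^esub> (u i \<otimes>\<^bsub>B\<^esub> v j))" .
    show "\<beta> u = \<beta> v \<longleftrightarrow> (\<forall>i<d. \<epsilon> \<otimes>\<^bsub>B\<^esub> u i = \<epsilon> \<otimes>\<^bsub>B\<^esub> v i)"
    proof
      assume "\<forall>i<d. \<epsilon> \<otimes>\<^bsub>B\<^esub> u i = \<epsilon> \<otimes>\<^bsub>B\<^esub> v i"
      then have "\<pi> (u i) = \<pi> (v i)" if "i < d" for i using ker[OF u[of i] v[of i]] that by blast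
      then have "\<psi> (u i) = \<psi> (v i)" if "i < d" for i using that by (simp add: \<psi>_def)
      then show "\<beta> u = \<beta> v" unfolding \<beta>_def using v xi_closed by (intro S.finsum_cong') auto
    next
      assume eq: "\<beta> u = \<beta> v"
      \<comment> \<open>Equality of the two sums becomes the vanishing of a difference, to which
        \<open>independent\<close> applies.\<close>
      define w where "w i = \<pi> (v i) \<oplus> \<pi> (\<ominus>\<^bsub>B\<^esub> u i)" for i
      have m: "range (\<lambda>i. \<ominus>\<^bsub>B\<^esub> u i) \<subseteq> carrier B" using u by auto
      have "\<beta> (\<lambda>i. v i \<oplus>\<^bsub>B\<^esub> \<ominus>\<^bsub>B\<^esub> u i) = \<beta> v \<oplus>\<^bsub>S\<^esub> \<beta> (\<lambda>i. \<ominus>\<^bsub>B\<^esub> u i)"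
        by (rule add[OF uv(2) m, symmetric])
      also have "\<dots> = \<beta> (\<lambda>i. u i \<oplus>\<^bsub>B\<^esub> \<ominus>\<^bsub>B\<^esub> u i)" unfolding eq[symmetric] by (rule add[OF uv(1) m])
      also have "\<dots> = \<zero>\<^bsub>S\<^esub>" using zero u by (simp add: pi.R.r_neg)
      finally have "(\<Oplus>\<^bsub>S\<^esub>i\<in>{..<d}. \<phi> (w i) \<otimes>\<^bsub>S\<^esub> \<xi> [^]\<^bsub>S\<^esub> i) = \<zero>\<^bsub>S\<^esub>"
        unfolding \<beta>_def \<psi>_def w_def using u v by simp
      moreover have "w i \<in> carrier A" for i using u v by (simp add: w_def)
      ultimately have w0: "w i = \<zero>" if "i < d" for i using independent that by blast
      show "\<forall>i<d. \<epsilon> \<otimes>\<^bsub>B\<^esub> u i = \<epsilon> \<otimes>\<^bsub>B\<^esub> v i"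
      proof (intro allI impI)
        fix i assume "i < d"
        then have "\<pi> (v i) \<ominus> \<pi> (u i) = \<zero>" using w0[of i] u v by (simp add: w_def R.minus_eq)
        then have "\<pi> (u i) = \<pi> (v i)" using u v by (metis R.r_right_minus_eq pi.hom_closed)
        then show "\<epsilon> \<otimes>\<^bsub>B\<^esub> u i = \<epsilon> \<otimes>\<^bsub>B\<^esub> v i" using ker[OF u[of i] v[of i]] by simp
      qed
    qed
  qed
  then show ?thesis by blast
qed

section \<open>The factors are Henselian local rings\<close>

text \<open>An element outside \<open>M\<close> is a unit, so every proper ideal is contained in
  \<open>M\<close>.\<close>

lemma (in cring) maximalideal_iff_if_local:
  assumes M: "ideal M R" "\<one> \<notin> M"
    and units: "\<And>x. x \<in> carrier R \<Longrightarrow> x \<notin> M \<Longrightarrow> \<exists>y \<in> carrier R. x \<otimes> y = \<one>"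
  shows "maximalideal n R \<longleftrightarrow> n = M"
proof -
  have le: "J \<subseteq> M" if J: "ideal J R" "\<one> \<notin> J" for J
  proof
    interpret J: ideal J R by (rule J(1))
    fix x assume x: "x \<in> J"
    show "x \<in> M"
    proof (rule ccontr)
      assume "x \<notin> M"
      then obtain y where "y \<in> carrier R" "x \<otimes> y = \<one>" using units[of x] J.a_Hcarr[OF x] by blast
      then show False using J.I_r_closed[OF x] J(2) by metis
    qed
  qed
  have max: "maximalideal M R"
  proof (rule maximalidealI[OF M(1)])
    show "carrier R \<noteq> M" using M(2) by auto
    show "J = M \<or> J = carrier R" if "ideal J R" "M \<subseteq> J" "J \<subseteq> carrier R" for J
      using le[OF that(1)] that ideal.one_imp_carrier[OF that(1)] by blast
  qed
  show ?thesis
  proof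
    assume n: "maximalideal n R"
    interpret n: maximalideal n R by (rule n)
    have "n \<subseteq> M" using le[OF n.is_ideal n.one_notin] .
    then show "n = M"
      using n.I_maximal[OF M(1)] additive_subgroup.a_subset[OF ideal.axioms(1)[OF M(1)]] M(2) by auto
  qed (use max in simp)
qed

section \<open>Evaluation of coefficient lists\<close>

lemma (in ring) eval_as_sum:
  assumes "set f \<subseteq> carrier R" "x \<in> carrier R"
  shows "eval f x = (\<Oplus>i\<in>{..<length f}. coeff f i \<otimes> x [^] i)"
  using assms(1)
proof (induction f)
  case (Cons a f)
  have c: "coeff f i \<in> carrier R" for i using Cons.prems coeff_in_carrier[of f] by auto
  have "(\<Oplus>i\<in>{..<length f}. coeff (a # f) i \<otimes> x [^] i) = (\<Oplus>i\<in>{..<length f}. coeff f i \<otimes> x [^] i)"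
    using c assms(2) by (intro finsum_cong') auto
  moreover have "(\<Oplus>i\<in>{..<length (a # f)}. coeff (a # f) i \<otimes> x [^] i)
      = a \<otimes> x [^] length f \<oplus> (\<Oplus>i\<in>{..<length f}. coeff (a # f) i \<otimes> x [^] i)"
    using c assms(2) Cons.prems by (simp add: lessThan_Suc finsum_insert)
  ultimately show ?case using Cons by simp
qed simp

text \<open>In characteristic \<open>p\<close> leading terms of the derivative may vanish and are
  stripped by \<open>formal_deriv\<close>; evaluation does not see this.\<close>

lemma (in ring) eval_formal_deriv:
  assumes f: "set f \<subseteq> carrier R" "length f = Suc d" and x: "x \<in> carrier R"
  shows "eval (formal_deriv R f) x = (\<Oplus>i\<in>{..<d}. ([Suc i] \<cdot> coeff f (Suc i)) \<otimes> x [^] i)"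
proof -
  define L where "L = map (\<lambda>i. [i] \<cdot> coeff f i) (rev [1..<length f])"
  have c: "coeff f i \<in> carrier R" for i using f(1) coeff_in_carrier[of f] by auto
  have L: "set L \<subseteq> carrier R" "length L = d" using c f(2) by (auto simp: L_def)
  have "eval (formal_deriv R f) x = eval L x"
    using eval_normalize[OF L(1) x] by (simp add: formal_deriv_def L_def)
  also have "\<dots> = (\<Oplus>i\<in>{..<d}. coeff L i \<otimes> x [^] i)" using eval_as_sum[OF L(1) x] L(2) by simp
  also have "\<dots> = (\<Oplus>i\<in>{..<d}. ([Suc i] \<cdot> coeff f (Suc i)) \<otimes> x [^] i)"
  proof (rule finsum_cong')
    fix i assume "i \<in> {..<d}"
    then have i: "i < d" by simp
    \<comment> \<open>Lists start with the leading coefficient, so coefficient \<open>i\<close>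
      stands at position \<open>d - 1 - i\<close>.\<close>
    have "coeff L i = L ! (d - 1 - i)" using coeff_nth[of i L] L(2) i by simp
    also have "rev [1..<length f] ! (d - 1 - i) = Suc i"
      using i f(2) by (simp add: rev_nth del: upt_Suc)
    then have "L ! (d - 1 - i) = [Suc i] \<cdot> coeff f (Suc i)"
      using i f(2) by (simp add: L_def del: upt_Suc add.nat_pow_Suc)
    finally show "coeff L i \<otimes> x [^] i = ([Suc i] \<cdot> coeff f (Suc i)) \<otimes> x [^] i" by simp
  qed (use c x in auto)
  finally show ?thesis .
qed

text \<open>The corner is local because elements outside \<open>m\<close> are invertible at
  \<open>e\<close>. For Hensel's lemma, \<open>A[X]/(f)\<close> is coded over \<open>R\<close>
  itself, the ring known to be NIP, with \<open>e\<close> as the element \<open>\<epsilon>\<close>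
  that tests equality in the corner.\<close>

lemma (in cring) henselian_corner:
  fixes p :: nat
  assumes nip: "NIP_ring R" and p: "Factorial_Ring.prime p" and char: "[p] \<cdot> \<one> = \<zero>"
    and m: "maximalideal m R" and e: "e \<in> carrier R" "e \<otimes> e = e" "e \<notin> m"
    and others: "\<And>n. maximalideal n R \<Longrightarrow> n \<noteq> m \<Longrightarrow> e \<in> n"
  shows "henselian_local_ring (corner R e)"
proof -
  interpret idempotent_corner R e by unfold_locales (use e in auto)
  interpret m: maximalideal m R by (rule m)
  define A where "A = corner R e"
  interpret A: cring A unfolding A_def by (rule corner_cring)
  define M where "M = m \<inter> carrier A"
  have A_simps: "carrier A = {x \<in> carrier R. e \<otimes> x = x}" "mult A = mult R" "\<one>\<^bsub>A\<^esub> = e" "\<zero>\<^bsub>A\<^esub> = \<zero>" "add A = add R"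
    by (simp_all add: A_def corner_simps)
  have M: "ideal M A"
  proof (rule idealI[OF A.ring_axioms])
    show "subgroup M (add_monoid A)"
    proof (rule A.add.subgroupI)
      show "M \<subseteq> carrier A" by (auto simp: M_def)
      have "\<zero>\<^bsub>A\<^esub> \<in> M" using m.zero_closed A.zero_closed by (simp add: M_def A_simps(4))
      then show "M \<noteq> {}" by blast
      show "\<ominus>\<^bsub>A\<^esub> x \<in> M" if x: "x \<in> M" for x
      proof -
        have xc: "x \<in> carrier A" "x \<in> m" using x by (auto simp: M_def)
        have "\<ominus> x \<in> carrier A" using xc(1) e(1) by (simp add: A_simps r_minus)
        then have "\<ominus>\<^bsub>A\<^esub> x = \<ominus> x"
          using xc(1) by (intro A.minus_equality) (auto simp: A_simps l_neg)
        then show ?thesis using A.a_inv_closed[OF xc(1)] m.a_inv_closed[OF xc(2)] by (simp add: M_def)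
      qed
      show "x \<oplus>\<^bsub>A\<^esub> y \<in> M" if "x \<in> M" "y \<in> M" for x y
        using that A.a_closed[of x y] m.a_closed[of x y] by (simp add: M_def A_simps(5))
    qed
  next
    fix a x assume "a \<in> M" "x \<in> carrier A"
    then show "x \<otimes>\<^bsub>A\<^esub> a \<in> M" "a \<otimes>\<^bsub>A\<^esub> x \<in> M"
      using A.m_closed[of x a] A.m_closed[of a x] m.I_l_closed[of a x] m.I_r_closed[of a x]
      by (simp_all add: M_def A_simps)
  qed
  have one: "\<one>\<^bsub>A\<^esub> \<notin> M" using e by (simp add: M_def A_simps)
  have units: "\<exists>y \<in> carrier A. x \<otimes>\<^bsub>A\<^esub> y = \<one>\<^bsub>A\<^esub>" if x: "x \<in> carrier A" "x \<notin> M" for x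
  proof -
    have "x \<in> carrier R" "x \<notin> m" using x by (auto simp: M_def A_simps)
    then obtain h where "h \<in> carrier R" "x \<otimes> h = e" "e \<otimes> h = h"
      using invertible_at_idempotent[OF m e others] by blast
    then show ?thesis by (auto simp: A_simps)
  qed
  have max: "maximalideal n A \<longleftrightarrow> n = M" for n
    by (rule A.maximalideal_iff_if_local[OF M one units])
  have local: "local_cring A"
    unfolding local_cring_def using A.is_cring max by auto
  have "\<exists>b \<in> carrier A. ring.eval A f b = \<zero>\<^bsub>A\<^esub> \<and> b \<ominus>\<^bsub>A\<^esub> a \<in> M"
    if f: "f \<in> carrier ((carrier A)[X]\<^bsub>A\<^esub>)" "f \<noteq> []" "lead_coeff f = \<one>\<^bsub>A\<^esub>" and a: "a \<in> carrier A"
      and fa: "ring.eval A f a \<in> M" "ring.eval A (formal_deriv A f) a \<notin> M" for f a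
  proof -
    have fc: "set f \<subseteq> carrier A" using f(1) unfolding univ_poly_def polynomial_def by auto
    define d where "d = length f - 1"
    have len: "length f = Suc d" using f(2) by (simp add: d_def)
    define c where "c = A.coeff f"
    have cc: "c i \<in> carrier A" for i using fc A.coeff_in_carrier[of f] by (auto simp: c_def)
    have cd: "c d = \<one>\<^bsub>A\<^esub>" using A.lead_coeff_simp[OF f(2)] f(3) by (simp add: c_def d_def)
    have ev: "A.eval f x = (\<Oplus>\<^bsub>A\<^esub>i\<in>{..d}. c i \<otimes>\<^bsub>A\<^esub> x [^]\<^bsub>A\<^esub> i)" if "x \<in> carrier A" for x
      using A.eval_as_sum[OF fc that] by (simp add: len c_def lessThan_Suc_atMost)
    have ev': "A.eval (formal_deriv A f) a = (\<Oplus>\<^bsub>A\<^esub>i\<in>{..<d}. ([Suc i] \<cdot>\<^bsub>A\<^esub> c (Suc i)) \<otimes>\<^bsub>A\<^esub> a [^]\<^bsub>A\<^esub> i)"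
      using A.eval_formal_deriv[OF fc len a] by (simp only: c_def)
    \<comment> \<open>The corner is nontrivial because \<open>e\<close> is outside \<open>m\<close>;
      otherwise \<open>f\<close> would not have degree \<open>d\<close>.\<close>
    have A01: "\<one>\<^bsub>A\<^esub> \<noteq> \<zero>\<^bsub>A\<^esub>" using e(3) m.zero_closed by (auto simp: A_simps)
    interpret UP_cring A "UP A" by unfold_locales
    obtain S :: "(nat \<Rightarrow> 'a) set ring" and \<phi> \<xi> where mono: "monogenic_algebra A S \<phi> \<xi> d c"
      using exists_monogenic_algebra[of c d] A01 cc cd by blast
    interpret S: monogenic_algebra A S \<phi> \<xi> d c by (rule mono)
    have hom: "ring_hom_cring R A (\<lambda>x. e \<otimes> x)" unfolding A_def by (rule corner_hom)
    have "\<exists>\<beta> \<gamma>. coded_ring R S d e \<beta> \<gamma>"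
    proof (rule S.coded[OF hom e(1)])
      show "\<exists>y \<in> carrier R. e \<otimes> y = x" if "x \<in> carrier A" for x
        using that by (auto simp: A_simps)
    qed simp
    then obtain \<beta> \<gamma> where coded: "coded_ring R S d e \<beta> \<gamma>" by blast
    \<comment> \<open>The characteristic passes along the homomorphisms from \<open>R\<close> to
      \<open>A\<close> and from \<open>A\<close> to \<open>S\<close>.\<close>
    have charS: "[p] \<cdot>\<^bsub>S\<^esub> \<one>\<^bsub>S\<^esub> = \<zero>\<^bsub>S\<^esub>"
    proof -
      interpret h: ring_hom_cring R A "\<lambda>x. e \<otimes> x" by (rule hom)
      have "\<phi> (e \<otimes> ([k] \<cdot> \<one>)) = [k] \<cdot>\<^bsub>S\<^esub> \<one>\<^bsub>S\<^esub>" for k :: nat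
      proof (induction k)
        case 0
        then show ?case using e(1) S.hom_zero by (simp add: A_simps)
      next
        case (Suc k)
        have "\<phi> (e \<otimes> ([Suc k] \<cdot> \<one>)) = \<phi> (e \<otimes> ([k] \<cdot> \<one>) \<oplus>\<^bsub>A\<^esub> \<one>\<^bsub>A\<^esub>)"
          using e(1) by (simp add: r_distr A_simps)
        also have "\<dots> = \<phi> (e \<otimes> ([k] \<cdot> \<one>)) \<oplus>\<^bsub>S\<^esub> \<one>\<^bsub>S\<^esub>"
          using h.hom_closed[of "[k] \<cdot> \<one>"] by (subst S.hom_add) auto
        finally show ?case using Suc by simp
      qed
      from this[of p] show ?thesis unfolding char using e(1) S.hom_zero by (simp add: A_simps)
    qed
    have tame: "tame_cring S p" by (rule coded_ring.tame[OF coded nip p charS])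
    from S.hensel_root[OF tame M one units a] fa
    show ?thesis unfolding ev' by (metis ev a)
  qed
  then show ?thesis
    unfolding A_def[symmetric] henselian_local_ring_def using local max by auto
qed

section \<open>Decomposition into a product\<close>

text \<open>Stated for \<open>e + f\<close> in place of 1, so that idempotents can be split off a
  list one by one. The inverse map is addition, as the mixed products vanish.\<close>

lemma (in cring) corner_prod_iso:
  assumes e: "e \<in> carrier R" "e \<otimes> e = e" and f: "f \<in> carrier R" "f \<otimes> f = f" and ef: "e \<otimes> f = \<zero>"
  shows "(\<lambda>x. (e \<otimes> x, f \<otimes> x)) \<in> ring_iso (corner R (e \<oplus> f)) (RDirProd (corner R e) (corner R f))"
proof -
  interpret e: idempotent_corner R e by unfold_locales (use e in auto)
  interpret f: idempotent_corner R f by unfold_locales (use f in auto)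
  have fe: "f \<otimes> e = \<zero>" using ef m_comm[OF e(1) f(1)] by simp
  have swap: "g \<otimes> (x \<otimes> y) = (g \<otimes> x) \<otimes> (g \<otimes> y)"
    if "g \<in> carrier R" "g \<otimes> g = g" "x \<in> carrier R" "y \<in> carrier R" for g x y
  proof -
    have "(g \<otimes> x) \<otimes> (g \<otimes> y) = (g \<otimes> g) \<otimes> (x \<otimes> y)" using that(1,3,4) by (simp add: m_assoc m_lcomm[of x g])
    then show ?thesis by (simp only: that(2))
  qed
  have kill: "g \<otimes> (h \<otimes> x) = \<zero>" if "g \<in> carrier R" "h \<in> carrier R" "g \<otimes> h = \<zero>" "x \<in> carrier R" for g h x
    using m_assoc[OF that(1,2,4)] that by simp
  have keep: "g \<otimes> (g \<otimes> x) = g \<otimes> x" if "g \<in> carrier R" "g \<otimes> g = g" "x \<in> carrier R" for g x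
    using m_assoc[OF that(1,1,3)] that by simp
  show ?thesis
    unfolding ring_iso_def
  proof (intro CollectI conjI ring_hom_memI)
    fix x assume "x \<in> carrier (corner R (e \<oplus> f))"
    then show "(e \<otimes> x, f \<otimes> x) \<in> carrier (RDirProd (corner R e) (corner R f))"
      using e.corner_mem[of x] f.corner_mem[of x]
      by (simp add: RDirProd_def DirProd_def monoid.defs corner_simps)
  next
    fix x y assume "x \<in> carrier (corner R (e \<oplus> f))" "y \<in> carrier (corner R (e \<oplus> f))"
    then show "(e \<otimes> (x \<otimes>\<^bsub>corner R (e \<oplus> f)\<^esub> y), f \<otimes> (x \<otimes>\<^bsub>corner R (e \<oplus> f)\<^esub> y)) =
        (e \<otimes> x, f \<otimes> x) \<otimes>\<^bsub>RDirProd (corner R e) (corner R f)\<^esub> (e \<otimes> y, f \<otimes> y)"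
      using swap[OF e, of x y] swap[OF f, of x y]
      by (simp add: RDirProd_def DirProd_def monoid.defs corner_simps)
  next
    fix x y assume "x \<in> carrier (corner R (e \<oplus> f))" "y \<in> carrier (corner R (e \<oplus> f))"
    then show "(e \<otimes> (x \<oplus>\<^bsub>corner R (e \<oplus> f)\<^esub> y), f \<otimes> (x \<oplus>\<^bsub>corner R (e \<oplus> f)\<^esub> y)) =
        (e \<otimes> x, f \<otimes> x) \<oplus>\<^bsub>RDirProd (corner R e) (corner R f)\<^esub> (e \<otimes> y, f \<otimes> y)"
      using e f by (simp add: RDirProd_def DirProd_def monoid.defs corner_simps r_distr)
  next
    show "(e \<otimes> \<one>\<^bsub>corner R (e \<oplus> f)\<^esub>, f \<otimes> \<one>\<^bsub>corner R (e \<oplus> f)\<^esub>) = \<one>\<^bsub>RDirProd (corner R e) (corner R f)\<^esub>"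
      using e f ef fe by (simp add: RDirProd_def DirProd_def monoid.defs corner_simps r_distr)
  next
    show "bij_betw (\<lambda>x. (e \<otimes> x, f \<otimes> x)) (carrier (corner R (e \<oplus> f)))
        (carrier (RDirProd (corner R e) (corner R f)))"
    proof (rule bij_betw_byWitness[where f' = "\<lambda>(x, y). x \<oplus> y"])
      show "\<forall>x \<in> carrier (corner R (e \<oplus> f)). (\<lambda>(x, y). x \<oplus> y) (e \<otimes> x, f \<otimes> x) = x"
        using e f by (auto simp: corner_simps l_distr)
      have "e \<otimes> (x \<oplus> y) = x \<and> f \<otimes> (x \<oplus> y) = y"
        if "x \<in> carrier R" "e \<otimes> x = x" "y \<in> carrier R" "f \<otimes> y = y" for x y
        using kill[OF e(1) f(1) ef that(3)] kill[OF f(1) e(1) fe that(1)] that e f by (simp add: r_distr)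
      then show "\<forall>xy \<in> carrier (RDirProd (corner R e) (corner R f)).
          (\<lambda>x. (e \<otimes> x, f \<otimes> x)) ((\<lambda>(x, y). x \<oplus> y) xy) = xy"
        by (auto simp: RDirProd_def DirProd_def monoid.defs corner_simps)
      show "(\<lambda>x. (e \<otimes> x, f \<otimes> x)) ` carrier (corner R (e \<oplus> f)) \<subseteq> carrier (RDirProd (corner R e) (corner R f))"
        using e.corner_mem f.corner_mem
        by (auto simp: RDirProd_def DirProd_def monoid.defs corner_simps)
      show "(\<lambda>(x, y). x \<oplus> y) ` carrier (RDirProd (corner R e) (corner R f)) \<subseteq> carrier (corner R (e \<oplus> f))"
      proof (rule image_subsetI)
        fix xy assume "xy \<in> carrier (RDirProd (corner R e) (corner R f))"
        then obtain x y where xy: "xy = (x, y)" "x \<in> carrier R" "e \<otimes> x = x" "y \<in> carrier R" "f \<otimes> y = y"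
          by (auto simp: RDirProd_def DirProd_def monoid.defs corner_simps)
        have "e \<otimes> y = \<zero>" "f \<otimes> x = \<zero>"
          using kill[OF e(1) f(1) ef xy(4)] kill[OF f(1) e(1) fe xy(2)] xy by simp_all
        then show "(\<lambda>(x, y). x \<oplus> y) xy \<in> carrier (corner R (e \<oplus> f))"
          using xy e f by (simp add: corner_simps l_distr r_distr)
      qed
    qed
  qed
qed

lemma (in cring) orthogonal_idempotents:
  assumes "set es \<subseteq> carrier R" "\<forall>e \<in> set es. e \<otimes> e = e" "sorted_wrt (\<lambda>e f. e \<otimes> f = \<zero>) es"
  shows "foldr (\<oplus>) es \<zero> \<in> carrier R"
    and "\<And>e. e \<in> set es \<Longrightarrow> e \<otimes> foldr (\<oplus>) es \<zero> = e"
    and "foldr (\<oplus>) es \<zero> \<otimes> foldr (\<oplus>) es \<zero> = foldr (\<oplus>) es \<zero>"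
    and "corner R (foldr (\<oplus>) es \<zero>) \<simeq> RDirProd_list (map (corner R) es)"
proof -
  \<comment> \<open>The second conjunct is added for the induction: it makes the new head orthogonal
    to the sum of the tail.\<close>
  have "foldr (\<oplus>) es \<zero> \<in> carrier R \<and>
    (\<forall>g \<in> carrier R. (\<forall>e \<in> set es. g \<otimes> e = \<zero>) \<longrightarrow> g \<otimes> foldr (\<oplus>) es \<zero> = \<zero>) \<and>
    (\<forall>e \<in> set es. e \<otimes> foldr (\<oplus>) es \<zero> = e) \<and>
    foldr (\<oplus>) es \<zero> \<otimes> foldr (\<oplus>) es \<zero> = foldr (\<oplus>) es \<zero> \<and>
    corner R (foldr (\<oplus>) es \<zero>) \<simeq> RDirProd_list (map (corner R) es)"
    using assms
  proof (induction es)
    case Nil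
    \<comment> \<open>The empty sum is 0, and its corner is the zero ring, matching the empty
      product.\<close>
    have "(\<lambda>_. []) \<in> ring_iso (corner R \<zero>) nil_ring"
      unfolding ring_iso_def ring_hom_def bij_betw_def inj_on_def
      by (auto simp: corner_simps monoid.defs)
    then show ?case by (auto simp: is_ring_iso_def)
  next
    case (Cons e es)
    define E where "E = foldr (\<oplus>) es \<zero>"
    have IH: "E \<in> carrier R" "\<And>g. g \<in> carrier R \<Longrightarrow> \<forall>e \<in> set es. g \<otimes> e = \<zero> \<Longrightarrow> g \<otimes> E = \<zero>"
      "\<And>f. f \<in> set es \<Longrightarrow> f \<otimes> E = f" "E \<otimes> E = E" "corner R E \<simeq> RDirProd_list (map (corner R) es)"
      using Cons unfolding E_def by auto
    have e: "e \<in> carrier R" "e \<otimes> e = e" using Cons.prems by auto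
    have eE: "e \<otimes> E = \<zero>" using IH(2)[OF e(1)] Cons.prems(3) by simp
    have Ee: "E \<otimes> e = \<zero>" using eE m_comm[OF e(1) IH(1)] by simp
    have 1: "e \<oplus> E \<in> carrier R" using e IH by simp
    have 2: "g \<otimes> (e \<oplus> E) = \<zero>" if "g \<in> carrier R" "\<forall>f \<in> set (e # es). g \<otimes> f = \<zero>" for g
      using that IH(1) IH(2)[OF that(1)] e by (simp add: r_distr)
    have 3: "f \<otimes> (e \<oplus> E) = f" if f: "f \<in> set (e # es)" for f
    proof (cases "f = e")
      case True
      then show ?thesis using e eE IH(1) by (simp add: r_distr)
    next
      case False
      then have f': "f \<in> set es" "f \<in> carrier R" using f Cons.prems by auto
      have "e \<otimes> f = \<zero>" using Cons.prems(3) f' by simp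
      then have "f \<otimes> e = \<zero>" using m_comm[OF e(1) f'(2)] by simp
      then show ?thesis using IH(1) IH(3)[OF f'(1)] f' e by (simp add: r_distr)
    qed
    have 4: "(e \<oplus> E) \<otimes> (e \<oplus> E) = e \<oplus> E"
      using e IH(1,4) eE Ee by (simp add: r_distr l_distr)
    obtain \<iota> where \<iota>: "\<iota> \<in> ring_iso (corner R E) (RDirProd_list (map (corner R) es))"
      using IH(5) unfolding is_ring_iso_def by blast
    have "\<exists>h. h \<in> ring_iso (corner R (e \<oplus> E)) (RDirProd_list (corner R e # map (corner R) es))"
      using ring_iso_set_trans[OF ring_iso_set_trans[OF corner_prod_iso[OF e IH(1,4) eE] RDirProd_iso5[OF \<iota>]]
          RDirProd_list_iso1] by blast
    then have 5: "corner R (e \<oplus> E) \<simeq> RDirProd_list (map (corner R) (e # es))"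
      unfolding is_ring_iso_def by auto
    show ?case using 1 2 3 4 5 unfolding E_def by simp
  qed
  then show "foldr (\<oplus>) es \<zero> \<in> carrier R"
    and "\<And>e. e \<in> set es \<Longrightarrow> e \<otimes> foldr (\<oplus>) es \<zero> = e"
    and "foldr (\<oplus>) es \<zero> \<otimes> foldr (\<oplus>) es \<zero> = foldr (\<oplus>) es \<zero>"
    and "corner R (foldr (\<oplus>) es \<zero>) \<simeq> RDirProd_list (map (corner R) es)" by auto
qed

text \<open>No maximal ideal contains \<open>1 - f\<close>, so it is a unit; but
  \<open>f (1 - f) = 0\<close>.\<close>

lemma (in cring) idempotent_in_all_maximalideals:
  assumes f: "f \<in> carrier R" "f \<otimes> f = f" and all: "\<And>m. maximalideal m R \<Longrightarrow> f \<in> m"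
  shows "f = \<zero>"
proof -
  have "\<one> \<ominus> f \<notin> m" if m: "maximalideal m R" for m
  proof
    interpret m: maximalideal m R by (rule m)
    assume "\<one> \<ominus> f \<in> m"
    then have "(\<one> \<ominus> f) \<oplus> f \<in> m" using all[OF m] by (rule m.a_closed)
    moreover have "(\<one> \<ominus> f) \<oplus> f = \<one>" using f(1) by algebra
    ultimately show False using m.one_notin by simp
  qed
  then obtain b where b: "b \<in> carrier R" "(\<one> \<ominus> f) \<otimes> b = \<one>"
    using unit_if_no_maximalideal[of "\<one> \<ominus> f"] f(1) by auto
  have "f = f \<otimes> ((\<one> \<ominus> f) \<otimes> b)" unfolding b(2) using f(1) by simp
  also have "\<dots> = (f \<ominus> f \<otimes> f) \<otimes> b" using f(1) b(1) by algebra
  also have "\<dots> = \<zero>" unfolding f(2) using f(1) b(1) by (simp add: minus_eq r_neg)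
  finally show ?thesis .
qed

text \<open>Products of two distinct isolating idempotents lie in all maximal ideals and so vanish.
  Their sum \<open>G\<close> is an idempotent outside every maximal ideal, because
  \<open>E m G = E m\<close>; an idempotent unit is 1.\<close>

lemma (in tame_cring) corner_decomposition:
  obtains es where "R \<simeq> RDirProd_list (map (corner R) es)"
    "\<And>e. e \<in> set es \<Longrightarrow> \<exists>m. maximalideal m R \<and> e \<in> carrier R \<and> e \<otimes> e = e \<and> e \<notin> m \<and>
      (\<forall>n. maximalideal n R \<longrightarrow> n \<noteq> m \<longrightarrow> e \<in> n)"
proof -
  define good where "good m e \<longleftrightarrow> e \<in> carrier R \<and> e \<otimes> e = e \<and> e \<notin> m \<and>
      (\<forall>n. maximalideal n R \<longrightarrow> n \<noteq> m \<longrightarrow> e \<in> n)" for m e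
  have "\<forall>m. \<exists>e. maximalideal m R \<longrightarrow> good m e"
  proof (intro allI)
    fix m
    show "\<exists>e. maximalideal m R \<longrightarrow> good m e"
    proof (cases "maximalideal m R")
      case True
      show ?thesis by (rule maximal_idempotent[OF True]) (auto simp: good_def)
    qed simp
  qed
  from choice[OF this] obtain E where E: "\<And>m. maximalideal m R \<Longrightarrow> good m (E m)" by blast
  obtain ms where ms: "distinct ms" "set ms = {m. maximalideal m R}"
    using finite_distinct_list[OF finite_maximalideals] by blast
  define es where "es = map E ms"
  have es: "\<exists>m. maximalideal m R \<and> good m e" if "e \<in> set es" for e
    using that E ms(2) by (auto simp: es_def)
  have closed: "set es \<subseteq> carrier R"
  proof
    fix e assume "e \<in> set es"
    from es[OF this] show "e \<in> carrier R" by (auto simp: good_def)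
  qed
  have idem: "\<forall>e \<in> set es. e \<otimes> e = e"
  proof
    fix e assume "e \<in> set es"
    from es[OF this] show "e \<otimes> e = e" by (auto simp: good_def)
  qed
  have EE: "E m \<otimes> E n = \<zero>" if m: "maximalideal m R" and n: "maximalideal n R" and "m \<noteq> n" for m n
  proof (rule idempotent_in_all_maximalideals)
    have c: "E m \<in> carrier R" "E n \<in> carrier R" "E m \<otimes> E m = E m" "E n \<otimes> E n = E n"
      using E[OF m] E[OF n] by (auto simp: good_def)
    show "E m \<otimes> E n \<in> carrier R" using c by simp
    have "(E m \<otimes> E n) \<otimes> (E m \<otimes> E n) = (E m \<otimes> E m) \<otimes> (E n \<otimes> E n)"
      using c(1,2) by (simp add: m_assoc m_lcomm[of "E n" "E m"])
    then show "(E m \<otimes> E n) \<otimes> (E m \<otimes> E n) = E m \<otimes> E n" by (simp add: c)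
    fix k assume k: "maximalideal k R"
    interpret k: maximalideal k R by (rule k)
    have "E m \<in> k \<or> E n \<in> k" using E[OF m] E[OF n] k \<open>m \<noteq> n\<close> unfolding good_def by metis
    then show "E m \<otimes> E n \<in> k" using c k.I_l_closed k.I_r_closed by blast
  qed
  have orth: "sorted_wrt (\<lambda>e f. e \<otimes> f = \<zero>) es"
    unfolding sorted_wrt_iff_nth_less
  proof (intro allI impI)
    fix i j assume ij: "i < j" "j < length es"
    then have len: "i < length ms" "j < length ms" by (simp_all add: es_def)
    then have "ms ! i \<noteq> ms ! j" using ij ms(1) by (simp add: nth_eq_iff_index_eq)
    then show "es ! i \<otimes> es ! j = \<zero>"
      using EE[of "ms ! i" "ms ! j"] nth_mem[OF len(1)] nth_mem[OF len(2)] ms(2) len by (simp add: es_def)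
  qed
  define G where "G = foldr (\<oplus>) es \<zero>"
  note oi = orthogonal_idempotents[OF closed idem orth, folded G_def]
  have "G \<notin> m" if m: "maximalideal m R" for m
  proof
    interpret m: maximalideal m R by (rule m)
    assume "G \<in> m"
    have Em: "E m \<in> set es" using m ms(2) by (simp add: es_def)
    then have "E m \<otimes> G \<in> m" using \<open>G \<in> m\<close> closed by (intro m.I_l_closed) auto
    then show False using oi(2)[OF Em] E[OF m] by (simp add: good_def)
  qed
  then obtain b where b: "b \<in> carrier R" "G \<otimes> b = \<one>" using unit_if_no_maximalideal[OF oi(1)] by blast
  have "G = G \<otimes> (G \<otimes> b)" unfolding b(2) using oi(1) by simp
  also have "\<dots> = (G \<otimes> G) \<otimes> b" using oi(1) b(1) by (simp add: m_assoc)
  also have "\<dots> = \<one>" using oi(3) b(2) by simp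
  finally have G: "G = \<one>" .
  have id: "(\<lambda>x. x) \<in> ring_iso R (corner R \<one>)"
    unfolding ring_iso_def by (auto simp: ring_hom_def corner_simps bij_betw_def)
  have "R \<simeq> RDirProd_list (map (corner R) es)"
    using oi(4) ring_iso_set_trans[OF id] unfolding G is_ring_iso_def by blast
  then show thesis using es by (intro that[of es]) (auto simp: good_def)
qed

section \<open>Characteristic \<open>p\<close> and the conclusion\<close>

lemma algebra_ZFact_char:
  fixes R :: "(int set, 'a, 'm) module_scheme"
  assumes "Module.algebra (ZFact (int p)) R"
  shows "[p] \<cdot>\<^bsub>R\<^esub> \<one>\<^bsub>R\<^esub> = \<zero>\<^bsub>R\<^esub>"
proof -
  interpret R: Module.algebra "ZFact (int p)" R by (rule assms)
  define I where "I = Idl\<^bsub>\<Z>\<^esub> {int p}"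
  have I: "ideal I \<Z>" unfolding I_def by (rule int.genideal_ideal) simp
  have Z: "ZFact (int p) = \<Z> Quot I" by (simp add: ZFact_def I_def)
  interpret h: ring_hom_cring \<Z> "ZFact (int p)" "(+>\<^bsub>\<Z>\<^esub>) I"
    unfolding Z by (rule ideal.rcos_ring_hom_cring[OF I int.is_cring])
  \<comment> \<open>Classes of integers act on the unit as its multiples; the class of
    \<open>p\<close> is zero.\<close>
  have k: "(I +>\<^bsub>\<Z>\<^esub> int k) \<odot>\<^bsub>R\<^esub> \<one>\<^bsub>R\<^esub> = [k] \<cdot>\<^bsub>R\<^esub> \<one>\<^bsub>R\<^esub>" for k :: nat
  proof (induction k)
    case 0
    have "I +>\<^bsub>\<Z>\<^esub> int 0 = \<zero>\<^bsub>ZFact (int p)\<^esub>" using h.hom_zero by simp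
    then show ?case by simp
  next
    case (Suc k)
    have "I +>\<^bsub>\<Z>\<^esub> int (Suc k) = (I +>\<^bsub>\<Z>\<^esub> int k) \<oplus>\<^bsub>ZFact (int p)\<^esub> (I +>\<^bsub>\<Z>\<^esub> 1)"
      using h.hom_add[of "int k" 1] by (simp add: add.commute)
    moreover have "I +>\<^bsub>\<Z>\<^esub> 1 = \<one>\<^bsub>ZFact (int p)\<^esub>" using h.hom_one by simp
    moreover have "I +>\<^bsub>\<Z>\<^esub> int k \<in> carrier (ZFact (int p))" using h.hom_closed[of "int k"] by simp
    ultimately show ?case using Suc by (simp add: R.smult_l_distr R.smult_one)
  qed
  have "int p \<in> I" unfolding I_def using int.genideal_self[of "{int p}"] by simp
  then have "I +>\<^bsub>\<Z>\<^esub> int p = I" by (rule int.a_rcos_zero[OF I])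
  also have "I = \<zero>\<^bsub>ZFact (int p)\<^esub>" unfolding Z by (simp add: FactRing_def)
  finally show ?thesis using k[of p] by simp
qed

text \<open>\<open>R\<close> codes itself by 1-tuples, with \<open>\<epsilon>\<close> and the
  structure constants equal to 1.\<close>

lemma NIP_ring_tame:
  fixes R :: "('a, 'm) ring_scheme" (structure)
  assumes nip: "NIP_ring R" and p: "Factorial_Ring.prime p" and char: "[p] \<cdot> \<one> = \<zero>"
  shows "tame_cring R p"
proof -
  interpret cring R using nip by (simp add: NIP_ring_def)
  have "coded_ring R R 1 \<one> (\<lambda>u. u 0) (\<lambda>i j l. \<one>)"
  proof (intro coded_ring.intro coded_ring_axioms.intro is_cring one_closed)
    show "\<exists>u. range u \<subseteq> carrier R \<and> u 0 = s" if "s \<in> carrier R" for s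
      using that by (intro exI[of _ "\<lambda>_. s"]) auto
  next
    fix u v :: "nat \<Rightarrow> 'a" assume "range u \<subseteq> carrier R" "range v \<subseteq> carrier R"
    then have "u 0 \<in> carrier R" "v 0 \<in> carrier R" by auto
    then show "u 0 \<otimes> v 0 = (\<Oplus>i\<in>{..<1}. \<Oplus>j\<in>{..<1}. \<one> \<otimes> (u i \<otimes> v j))"
      and "u 0 = v 0 \<longleftrightarrow> (\<forall>i<1. \<one> \<otimes> u i = \<one> \<otimes> v i)"
      by (simp_all add: lessThan_Suc)
  qed auto
  from coded_ring.tame[OF this nip p char] show ?thesis .
qed

theorem theorem3p14:
  fixes p :: nat and R :: "(int set, 'a, 'm) module_scheme"
  assumes "Factorial_Ring.prime p"
    and "Module.algebra (ZFact (int p)) R"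
    and "NIP_ring R"
  shows "\<exists>Rs :: 'a ring list.
           (\<forall>A \<in> set Rs. henselian_local_ring A) \<and> R \<simeq> RDirProd_list Rs"
proof -
  note char = algebra_ZFact_char[OF assms(2)]
  interpret tame_cring R p by (rule NIP_ring_tame[OF assms(3,1) char])
  obtain es where es: "R \<simeq> RDirProd_list (map (corner R) es)"
    "\<And>e. e \<in> set es \<Longrightarrow> \<exists>m. maximalideal m R \<and> e \<in> carrier R \<and> e \<otimes>\<^bsub>R\<^esub> e = e \<and> e \<notin> m \<and>
      (\<forall>n. maximalideal n R \<longrightarrow> n \<noteq> m \<longrightarrow> e \<in> n)"
    by (rule corner_decomposition) (rule that)
  have "henselian_local_ring (corner R e)" if e: "e \<in> set es" for e
  proof -
    obtain m where "maximalideal m R" "e \<in> carrier R" "e \<otimes>\<^bsub>R\<^esub> e = e" "e \<notin> m"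
      "\<forall>n. maximalideal n R \<longrightarrow> n \<noteq> m \<longrightarrow> e \<in> n" using es(2)[OF e] by (elim exE conjE)
    then show ?thesis by (intro henselian_corner[OF assms(3,1) char]) auto
  qed
  with es(1) show ?thesis by (intro exI[of _ "map (corner R) es"]) auto
qed

end
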